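(* Let $d\ge 1$, $1\leq p\leq\infty$, $1\leq q<2$ and $\alpha\in(0,\infty)\setminus 2\mathbb N$. Then: (1) there exists $f\in W^{p,1}(\mathbb R^d)$ such that $f|f|^\alpha\notin W^{p,q}(\mathbb R^d)$; (2) there exists $f\in M^{p,1}(\mathbb R^d)$ such that $f|f|^\alpha\notin M^{p,q}(\mathbb R^d)$.
   Context: $2\mathbb N$ denotes the set of even positive integers. Fix a nonzero window $g\in\mathcal S(\mathbb R^d)$ and let $V_gf(x,w)=\int_{\mathbb R^d}f(t)\overline{g(t-x)}e^{-2\pi i w\cdot t}\,dt$, interpreted by duality for $f\in\mathcal S'(\mathbb R^d)$. For $1\le p,q\le\infty$, the modulation space $M^{p,q}(\mathbb R^d)$ is the set of $f\in\mathcal S'(\mathbb R^d)$ with $\|f\|_{M^{p,q}}=\left(\int_{\mathbb R^d}\left(\int_{\mathbb R^d}|V_gf(x,w)|^p\,dx\right)^{q/p}dw\right)^{1/q}<\infty$, and the Wiener amalgam space $W^{p,q}(\mathbb R^d)$ is the set of $f\in\mathcal S'(\mathbb R^d)$ with $\|f\|_{W^{p,q}}=\left(\int_{\mathbb R^d}\left(\int_{\mathbb R^d}|V_gf(x,w)|^q\,dw\right)^{p/q}dx\right)^{1/p}<\infty$, with the usual modifications if $p$ or $q$ is $\infty$. Different windows give the same spaces with equivalent norms. Elements of $M^{p,1}(\mathbb R^d)$ and $W^{p,1}(\mathbb R^d)$ are identified with their continuous representatives. *)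

theory Defs
  imports "HOL-Analysis.Analysis" "HOL-Probability.Essential_Supremum"
begin

definition partial_deriv :: "'a::euclidean_space \<Rightarrow> ('a \<Rightarrow> complex) \<Rightarrow> 'a \<Rightarrow> complex" where
  "partial_deriv b f x = frechet_derivative f (at x) b"

text \<open>Multi-indices are represented by lists of basis vectors, one entry for each derivative taken.\<close>

definition iterated_partial :: "'a::euclidean_space list \<Rightarrow> ('a \<Rightarrow> complex) \<Rightarrow> 'a \<Rightarrow> complex" where
  "iterated_partial bs f = foldr partial_deriv bs f"

text \<open>Differentiability of all iterated partial derivatives (the function itself being the case of
  the empty list) is the same as being infinitely differentiable.\<close>

definition schwartz_space :: "('a::euclidean_space \<Rightarrow> complex) set" where
  "schwartz_space = {\<phi>. \<forall>bs k. set bs \<subseteq> Basis \<longrightarrow>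
     iterated_partial bs \<phi> differentiable_on UNIV \<and>
     bounded (range (\<lambda>x. of_real ((1 + norm x) ^ k) * iterated_partial bs \<phi> x))}"

definition schwartz_seminorm :: "nat \<Rightarrow> ('a::euclidean_space \<Rightarrow> complex) \<Rightarrow> real" where
  "schwartz_seminorm N \<phi> = (\<Sum>bs | set bs \<subseteq> Basis \<and> length bs \<le> N.
     SUP x. (1 + norm x) ^ N * cmod (iterated_partial bs \<phi> x))"

text \<open>Distributions are (bilinear) functionals on functions; only the values on the Schwartz space
  matter. The seminorms above increase with \<open>N\<close> and generate the Schwartz topology, so a linear
  functional is continuous iff it is dominated by a multiple of one of them.\<close>

definition tempered_distributions :: "(('a::euclidean_space \<Rightarrow> complex) \<Rightarrow> complex) set" where
  "tempered_distributions = {u.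
     (\<forall>\<phi>\<in>schwartz_space. \<forall>\<psi>\<in>schwartz_space. u (\<lambda>x. \<phi> x + \<psi> x) = u \<phi> + u \<psi>) \<and>
     (\<forall>c. \<forall>\<phi>\<in>schwartz_space. u (\<lambda>x. c * \<phi> x) = c * u \<phi>) \<and>
     (\<exists>C N. \<forall>\<phi>\<in>schwartz_space. cmod (u \<phi>) \<le> C * schwartz_seminorm N \<phi>)}"

definition dist_of :: "('a::euclidean_space \<Rightarrow> complex) \<Rightarrow> ('a \<Rightarrow> complex) \<Rightarrow> complex" where
  "dist_of f \<phi> = (\<integral>x. f x * \<phi> x \<partial>lborel)"

text \<open>Integrability is required explicitly because the Bochner integral of a non-integrable
  function is \<open>0\<close>.\<close>

definition tempered_function :: "('a::euclidean_space \<Rightarrow> complex) \<Rightarrow> bool" where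
  "tempered_function f \<longleftrightarrow>
     (\<forall>\<phi>\<in>schwartz_space. integrable lborel (\<lambda>x. f x * \<phi> x)) \<and> dist_of f \<in> tempered_distributions"

text \<open>The short-time Fourier transform with window \<open>g\<close>. For \<open>u = dist_of f\<close> it is the integral of
  \<open>f t * cnj (g (t - x)) * exp (- 2 \<pi> \<i> w \<bullet> t)\<close> over \<open>t\<close>.\<close>

definition stft :: "('a::euclidean_space \<Rightarrow> complex) \<Rightarrow> (('a \<Rightarrow> complex) \<Rightarrow> complex) \<Rightarrow> 'a \<Rightarrow> 'a \<Rightarrow> complex" where
  "stft g u x w = u (\<lambda>t. cnj (g (t - x)) * exp (- 2 * of_real pi * \<i> * of_real (w \<bullet> t)))"

definition ennreal_powr :: "ennreal \<Rightarrow> real \<Rightarrow> ennreal" where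
  "ennreal_powr y r = (if y = \<infinity> then \<infinity> else ennreal (enn2real y powr r))"

definition Lp_norm :: "ennreal \<Rightarrow> ('a::euclidean_space \<Rightarrow> ennreal) \<Rightarrow> ennreal" where
  "Lp_norm p F = (if p = \<infinity> then esssup lborel F
     else ennreal_powr (\<integral>\<^sup>+x. ennreal_powr (F x) (enn2real p) \<partial>lborel) (1 / enn2real p))"

definition modulation_norm ::
    "('a::euclidean_space \<Rightarrow> complex) \<Rightarrow> ennreal \<Rightarrow> ennreal \<Rightarrow> (('a \<Rightarrow> complex) \<Rightarrow> complex) \<Rightarrow> ennreal" where
  "modulation_norm g p q u = Lp_norm q (\<lambda>w. Lp_norm p (\<lambda>x. ennreal (cmod (stft g u x w))))"

definition wiener_amalgam_norm ::
    "('a::euclidean_space \<Rightarrow> complex) \<Rightarrow> ennreal \<Rightarrow> ennreal \<Rightarrow> (('a \<Rightarrow> complex) \<Rightarrow> complex) \<Rightarrow> ennreal" where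
  "wiener_amalgam_norm g p q u = Lp_norm p (\<lambda>x. Lp_norm q (\<lambda>w. ennreal (cmod (stft g u x w))))"

definition modulation_space ::
    "('a::euclidean_space \<Rightarrow> complex) \<Rightarrow> ennreal \<Rightarrow> ennreal \<Rightarrow> (('a \<Rightarrow> complex) \<Rightarrow> complex) set" where
  "modulation_space g p q = {u \<in> tempered_distributions. modulation_norm g p q u < \<infinity>}"

definition wiener_amalgam_space ::
    "('a::euclidean_space \<Rightarrow> complex) \<Rightarrow> ennreal \<Rightarrow> ennreal \<Rightarrow> (('a \<Rightarrow> complex) \<Rightarrow> complex) set" where
  "wiener_amalgam_space g p q = {u \<in> tempered_distributions. wiener_amalgam_norm g p q u < \<infinity>}"

definition power_nonlinearity :: "real \<Rightarrow> ('a \<Rightarrow> complex) \<Rightarrow> 'a \<Rightarrow> complex" where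
  "power_nonlinearity \<alpha> f x = f x * of_real (cmod (f x) powr \<alpha>)"

end

theory Submission
  imports Defs "HOL-Probability.Probability"
begin

text \<open>
  Write \<open>G(s) = sin s |sin s|^\<alpha>\<close>. For a bounded phase \<open>h\<close> and a bump \<open>\<phi>\<close>, the nonlinearity maps
  \<open>\<phi> sin (h + s)\<close> to \<open>\<phi>^(1 + \<alpha>) G(h + s)\<close>, and averaging this against \<open>exp (- i n s)\<close> over \<open>s\<close> isolates
  \<open>c\<^sub>n \<phi>^(1 + \<alpha>) exp (i n h)\<close>, where \<open>c\<^sub>n\<close> is the \<open>n\<close>-th Fourier coefficient of \<open>G\<close>. The recursion
  \<open>(n + \<alpha> + 2) c\<^sub>n\<^sub>+\<^sub>1 = (n - \<alpha> - 2) c\<^sub>n\<^sub>-\<^sub>1\<close> shows that for odd \<open>n\<close> these coefficients do not vanish and decay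
  subexponentially, precisely because \<open>\<alpha>\<close> is not an even integer. On the other hand
  \<open>h = (1/n) (cos (L\<^sub>1 \<bullet> t) + \<dots> + cos (L\<^sub>n \<bullet> t))\<close> has Wiener norm at most 1, so \<open>\<phi> exp (\<plusminus> i h)\<close> stays
  bounded in \<open>M^(p,1)\<close> and \<open>W^(p,1)\<close>, while for rapidly increasing \<open>L\<^sub>k\<close> the Fourier transform of
  \<open>\<phi> exp (i n h)\<close> is uniformly \<open>O(\<rho>^n)\<close> with \<open>\<rho> < 1\<close>. As its \<open>L\<^sup>2\<close> norm is fixed, its \<open>L\<^sup>q'\<close> norm for \<open>q' > 2\<close>
  is exponentially small, and pairing with it shows that the \<open>M^(p,q)\<close> and \<open>W^(p,q)\<close> norms of
  \<open>\<phi>^(1 + \<alpha>) G(h + s)\<close> are exponentially large in \<open>n\<close> for a suitable \<open>s\<close>. Summing translates of such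
  pieces with disjoint supports and small coefficients gives one function for both claims.
\<close>

subsection \<open>The Fourier transform\<close>

text \<open>For even \<open>\<alpha>\<close> the function \<open>G\<close> is a trigonometric
  polynomial and only finitely many phases \<open>n h\<close> occur; otherwise every odd harmonic is
  available, and the \<open>n\<close>-th one turns a phase of Wiener norm 1 into one of norm
  \<open>n\<close>. Two rates then compete: the coefficients lose only a power of \<open>n\<close>,
  because consecutive ratios tend to 1, whereas each unit of Wiener norm flattens the spectrum by
  the fixed factor \<open>49/50\<close>. The exponent \<open>q\<close> enters through
  \<open>2 - q\<close>: interpolating between the \<open>L^2\<close> norm and the sup norm leaves
  the rate \<open>(49/50)^((2 - q)/2)\<close>, which is below 1 exactly for \<open>q < 2\<close>.
  The factor \<open>\<phi>^(1 + \<alpha>)\<close> is rough, but it only enters integrals that are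
  bounded from below; the upper bounds concern \<open>\<phi>\<close> itself, so a bump of finite
  smoothness suffices. The lower bound is local in space and sees one piece of the final sum at a
  time. Amplitudes are fixed before phases: a piece can be made large by an arbitrary factor at
  bounded cost in the source space, which outweighs the loss \<open>c^(1 + \<alpha>)\<close> from a
  small amplitude \<open>c\<close>.\<close>

definition fourier :: "('a::euclidean_space \<Rightarrow> complex) \<Rightarrow> 'a \<Rightarrow> complex" where
  "fourier v w = (LBINT t. v t * cis (- (2 * pi * (w \<bullet> t))))"

lemma cis_measurable [measurable]: "cis \<in> borel_measurable borel"
  by (intro borel_measurable_continuous_onI continuous_intros)

lemma integrable_mult_bounded:
  fixes v b :: "'a \<Rightarrow> 'b::{real_normed_field, banach, second_countable_topology}"
  assumes "integrable M v" "b \<in> borel_measurable M" "\<And>t. norm (b t) \<le> K"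
  shows "integrable M (\<lambda>t. v t * b t)"
proof (rule Bochner_Integration.integrable_bound)
  show "integrable M (\<lambda>t. K * norm (v t))"
    using assms(1) by auto
  show "(\<lambda>t. v t * b t) \<in> borel_measurable M"
    using assms by auto
  show "AE t in M. norm (v t * b t) \<le> norm (K * norm (v t))"
    by (intro AE_I2) (simp add: norm_mult mult.commute order_trans[OF mult_right_mono[OF assms(3)] abs_ge_self])
qed

lemma integrable_fourier_kernel:
  assumes "integrable lborel v"
  shows "integrable lborel (\<lambda>t. v t * cis (- (2 * pi * (w \<bullet> t))))"
  by (rule integrable_mult_bounded[OF assms, where K=1]) auto

lemma norm_fourier_le: "norm (fourier v w) \<le> (LBINT t. norm (v t))"
  unfolding fourier_def
  by (rule order_trans[OF integral_norm_bound]) (simp add: norm_mult)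

lemma fourier_cmult: "fourier (\<lambda>t. c * v t) w = c * fourier v w"
  by (simp add: fourier_def mult.assoc)

lemma fourier_add:
  assumes "integrable lborel v" "integrable lborel v'"
  shows "fourier (\<lambda>t. v t + v' t) w = fourier v w + fourier v' w"
  unfolding fourier_def ring_distribs
  by (intro Bochner_Integration.integral_add integrable_fourier_kernel assms)

lemma fourier_modulate: "fourier (\<lambda>t. v t * cis (2 * pi * (l \<bullet> t))) w = fourier v (w - l)"
  unfolding fourier_def by (simp add: mult.assoc cis_mult inner_diff algebra_simps)

text \<open>Valid for every \<open>f\<close>: translation preserves measurability in both
  directions, so for a non-measurable \<open>f\<close> both sides are the default value 0 of the
  Bochner integral.\<close>

lemma integral_lborel_translate:
  fixes f :: "'a::euclidean_space \<Rightarrow> 'b::{banach, second_countable_topology}"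
  shows "(LBINT t. f (t + y)) = (LBINT t. f t)"
proof -
  have "(LBINT t. f t) = (\<integral>t. f t \<partial>distr lborel borel ((+) y))"
    by (simp add: lborel_distr_plus)
  also have "\<dots> = (LBINT t. f (y + t))"
  proof (cases "f \<in> borel_measurable borel")
    case True
    then show ?thesis by (subst integral_distr) auto
  next
    case False
    have "(\<lambda>t. f (y + t)) \<notin> borel_measurable borel"
    proof
      assume "(\<lambda>t. f (y + t)) \<in> borel_measurable borel"
      then have "(\<lambda>t. f (y + (t - y))) \<in> borel_measurable borel"
        by (rule measurable_compose[rotated]) auto
      with False show False by simp
    qed
    with False have "\<not> integrable lborel f" "\<not> integrable lborel (\<lambda>t. f (y + t))"
      by (auto dest: borel_measurable_integrable)
    then show ?thesis
      by (simp add: lborel_distr_plus not_integrable_integral_eq)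
  qed
  finally show ?thesis by (simp add: add.commute)
qed

lemma integrable_lborel_translate:
  fixes f :: "'a::euclidean_space \<Rightarrow> 'b::{banach, second_countable_topology}"
  assumes "integrable lborel f"
  shows "integrable lborel (\<lambda>t. f (t + y))"
proof -
  have "integrable (distr lborel borel ((+) y)) f"
    using assms by (simp add: lborel_distr_plus)
  then show ?thesis
    by (subst (asm) integrable_distr_eq)
       (use assms in \<open>auto simp: add.commute dest: borel_measurable_integrable\<close>)
qed

lemma nn_integral_lborel_translate:
  fixes f :: "'a::euclidean_space \<Rightarrow> ennreal"
  assumes [measurable]: "f \<in> borel_measurable borel"
  shows "(\<integral>\<^sup>+t. f (t + y) \<partial>lborel) = (\<integral>\<^sup>+t. f t \<partial>lborel)"
proof -
  have "(\<integral>\<^sup>+t. f t \<partial>lborel) = (\<integral>\<^sup>+t. f t \<partial>distr lborel borel ((+) y))"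
    by (simp add: lborel_distr_plus)
  also have "\<dots> = (\<integral>\<^sup>+t. f (y + t) \<partial>lborel)"
    by (subst nn_integral_distr) auto
  finally show ?thesis by (simp add: add.commute)
qed

lemma fourier_translate:
  "fourier (\<lambda>t. v (t - y)) w = cis (- (2 * pi * (w \<bullet> y))) * fourier v w"
proof -
  have "fourier (\<lambda>t. v (t - y)) w
      = (LBINT t. v (t + y - y) * cis (- (2 * pi * (w \<bullet> (t + y)))))"
    unfolding fourier_def by (rule integral_lborel_translate[symmetric])
  also have "\<dots> = (LBINT t. cis (- (2 * pi * (w \<bullet> y))) * (v t * cis (- (2 * pi * (w \<bullet> t)))))"
  proof (intro Bochner_Integration.integral_cong refl)
    fix t
    have "cis (- (2 * pi * (w \<bullet> (t + y)))) = cis (- (2 * pi * (w \<bullet> y))) * cis (- (2 * pi * (w \<bullet> t)))"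
      by (simp add: cis_mult inner_add_right algebra_simps)
    then show "v (t + y - y) * cis (- (2 * pi * (w \<bullet> (t + y))))
        = cis (- (2 * pi * (w \<bullet> y))) * (v t * cis (- (2 * pi * (w \<bullet> t))))"
      by simp
  qed
  finally show ?thesis by (simp add: fourier_def)
qed

subsection \<open>Absolutely convergent trigonometric series\<close>

text \<open>Norm at most \<open>K\<close> in the algebra of absolutely convergent sums of characters
  with arbitrary real frequencies. The frequencies \<open>l m\<close> may repeat, so series can be
  merged freely, and \<open>K\<close> has to bound just one representation.\<close>

definition trig_series :: "real \<Rightarrow> ('a::euclidean_space \<Rightarrow> complex) \<Rightarrow> bool" where
  "trig_series K b \<longleftrightarrow> (\<exists>a l. summable (\<lambda>m. norm (a m)) \<and> (\<Sum>m. norm (a m)) \<le> K \<and>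
     (\<forall>t. (\<lambda>m::nat. a m * cis (2 * pi * (l m \<bullet> t))) sums b t))"

lemma trig_series_mono: "trig_series K b \<Longrightarrow> K \<le> K' \<Longrightarrow> trig_series K' b"
  unfolding trig_series_def by (meson order_trans)

lemma trig_series_monomial: "trig_series (norm c) (\<lambda>t. c * cis (2 * pi * (l \<bullet> t)))"
proof -
  let ?a = "\<lambda>m::nat. if m = 0 then c else 0"
  have "(\<lambda>m. norm (?a m)) sums norm (?a 0)"
    using sums_finite[of "{0}" "\<lambda>m. norm (?a m)"] by auto
  moreover have "(\<lambda>m. ?a m * cis (2 * pi * (l \<bullet> t))) sums (c * cis (2 * pi * (l \<bullet> t)))" for t
    using sums_finite[of "{0}" "\<lambda>m. ?a m * cis (2 * pi * (l \<bullet> t))"] by auto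
  ultimately show ?thesis
    unfolding trig_series_def by (intro exI[of _ ?a] exI[of _ "\<lambda>_. l"]) (auto simp: sums_iff)
qed

lemma trig_series_cmult:
  assumes "trig_series K b"
  shows "trig_series (norm c * K) (\<lambda>t. c * b t)"
proof -
  obtain a l where al: "summable (\<lambda>m. norm (a m))" "(\<Sum>m. norm (a m)) \<le> K"
     "\<And>t. (\<lambda>m::nat. a m * cis (2 * pi * (l m \<bullet> t))) sums b t"
    using assms unfolding trig_series_def by blast
  show ?thesis
    unfolding trig_series_def
  proof (intro exI[of _ "\<lambda>m. c * a m"] exI[of _ l] conjI allI)
    show "summable (\<lambda>m. norm (c * a m))" using al by (simp add: norm_mult)
    show "(\<Sum>m. norm (c * a m)) \<le> norm c * K"
      using al by (simp add: norm_mult suminf_mult mult_left_mono)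
    show "(\<lambda>m. c * a m * cis (2 * pi * (l m \<bullet> t))) sums (c * b t)" for t
      using sums_mult[OF al(3), of c] by (simp add: mult.assoc)
  qed
qed

lemma trig_series_modulate:
  assumes "trig_series K b"
  shows "trig_series K (\<lambda>t. cis (2 * pi * (k \<bullet> t)) * b t)"
proof -
  obtain a l where al: "summable (\<lambda>m. norm (a m))" "(\<Sum>m. norm (a m)) \<le> K"
     "\<And>t. (\<lambda>m::nat. a m * cis (2 * pi * (l m \<bullet> t))) sums b t"
    using assms unfolding trig_series_def by blast
  have "(\<lambda>m. a m * cis (2 * pi * ((k + l m) \<bullet> t))) sums (cis (2 * pi * (k \<bullet> t)) * b t)" for t
    using sums_mult[OF al(3), of "cis (2 * pi * (k \<bullet> t))"]
    by (simp add: inner_add ring_distribs cis_mult[symmetric] mult_ac)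
  with al show ?thesis
    unfolding trig_series_def by (intro exI[of _ a] exI[of _ "\<lambda>m. k + l m"]) auto
qed

lemma trig_series_nonneg: "trig_series K b \<Longrightarrow> 0 \<le> K"
  unfolding trig_series_def by (auto intro: order_trans[OF suminf_nonneg])

lemma trig_series_bounded:
  assumes "trig_series K b" shows "norm (b t) \<le> K"
proof -
  obtain a l where al: "summable (\<lambda>m. norm (a m))" "(\<Sum>m. norm (a m)) \<le> K"
     "\<And>t. (\<lambda>m::nat. a m * cis (2 * pi * (l m \<bullet> t))) sums b t"
    using assms unfolding trig_series_def by blast
  have "norm (\<Sum>m. a m * cis (2 * pi * (l m \<bullet> t))) \<le> (\<Sum>m. norm (a m * cis (2 * pi * (l m \<bullet> t))))"
    by (rule summable_norm) (use al in \<open>simp add: norm_mult\<close>)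
  with al show ?thesis by (simp add: norm_mult sums_iff)
qed

lemma trig_series_measurable:
  assumes "trig_series K b" shows "b \<in> borel_measurable borel"
proof -
  obtain a l where al: "\<And>t. (\<lambda>m::nat. a m * cis (2 * pi * (l m \<bullet> t))) sums b t"
    using assms unfolding trig_series_def by blast
  have b: "b = (\<lambda>t. \<Sum>m. a m * cis (2 * pi * (l m \<bullet> t)))"
    using al by (auto simp: sums_iff)
  show ?thesis unfolding b by measurable
qed

text \<open>Completeness of the algebra: the family \<open>a j m\<close> is absolutely summable over
  pairs, and \<open>prod_decode\<close> enumerates the pairs as one series. Sums, products and
  exponentials are obtained from this lemma.\<close>

lemma trig_series_series:
  fixes b :: "nat \<Rightarrow> 'a::euclidean_space \<Rightarrow> complex"
  assumes b: "\<And>j. trig_series (K j) (b j)" and K: "summable K"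
  shows "trig_series (\<Sum>j. K j) (\<lambda>t. \<Sum>j. b j t)"
proof -
  have "\<forall>j. \<exists>a l. summable (\<lambda>m. norm (a m)) \<and> (\<Sum>m. norm (a m)) \<le> K j \<and>
     (\<forall>t. (\<lambda>m::nat. a m * cis (2 * pi * (l m \<bullet> t))) sums b j t)"
    using b unfolding trig_series_def by blast
  then obtain a l where al: "\<And>j. summable (\<lambda>m. norm (a j m))" "\<And>j. (\<Sum>m. norm (a j m)) \<le> K j"
     "\<And>j t. (\<lambda>m::nat. a j m * cis (2 * pi * (l j m \<bullet> t))) sums b j t"
    by metis
  have K0: "summable (\<lambda>j. \<Sum>m. norm (a j m))"
    by (rule summable_comparison_test'[OF K]) (use al in \<open>simp add: suminf_nonneg\<close>)
  have hs: "((\<lambda>m. norm (a j m)) has_sum (\<Sum>m. norm (a j m))) UNIV" for j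
    by (rule norm_summable_imp_has_sum) (use al(1)[of j] in \<open>simp_all add: summable_sums\<close>)
  have inner: "(\<lambda>m. norm (a j m)) summable_on UNIV"
      "(\<Sum>\<^sub>\<infinity>m. norm (a j m)) = (\<Sum>m. norm (a j m))" for j
    using has_sum_imp_summable[OF hs] infsumI[OF hs] by auto
  have A1: "(\<lambda>p. norm (case_prod a p)) summable_on (SIGMA j:UNIV. UNIV)"
  proof (subst Infinite_Sum.abs_summable_on_Sigma_iff, intro conjI ballI)
    show "(\<lambda>y. norm (case_prod a (x, y))) summable_on UNIV" for x
      using inner by simp
    show "(\<lambda>x. norm (\<Sum>\<^sub>\<infinity>y. norm (case_prod a (x, y)))) summable_on UNIV"
      by (rule summable_on_iff_abs_summable_on_real[THEN iffD1])
         (use K0 al(1) in \<open>simp add: inner suminf_nonneg norm_summable_imp_summable_on\<close>)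
  qed
  \<comment> \<open>The rows sum to \<open>b j t\<close>, and absolute summability over pairs
    justifies summing row by row.\<close>
  have T: "((\<lambda>p. case_prod a p * cis (2 * pi * (case_prod l p \<bullet> t))) has_sum (\<Sum>j. b j t)) UNIV" for t
  proof -
    let ?T = "\<lambda>p. case_prod a p * cis (2 * pi * (case_prod l p \<bullet> t))"
    have "(\<lambda>p. norm (?T p)) summable_on UNIV"
      using A1 by (simp add: norm_mult)
    then have s: "?T summable_on (SIGMA j:UNIV. UNIV)"
      by (simp add: Infinite_Sum.abs_summable_summable)
    have "infsum (\<lambda>m. ?T (j, m)) UNIV = b j t" for j
      by (rule infsumI, rule norm_summable_imp_has_sum) (use al(1,3)[of j] in \<open>simp_all add: norm_mult\<close>)
    then have "infsum ?T (SIGMA j:UNIV. UNIV) = (\<Sum>\<^sub>\<infinity>j. b j t)"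
      using infsum_Sigma_banach[OF s] by simp
    moreover have "(\<Sum>\<^sub>\<infinity>j. b j t) = (\<Sum>j. b j t)"
    proof -
      have s': "summable (\<lambda>j. norm (b j t))"
        by (rule summable_comparison_test'[OF K]) (use trig_series_bounded[OF b] in auto)
      show ?thesis
        by (rule infsumI, rule norm_summable_imp_has_sum[OF s'])
           (rule summable_sums[OF summable_norm_cancel[OF s']])
    qed
    ultimately show ?thesis using has_sum_infsum[OF s] by simp
  qed
  have bij: "bij_betw prod_decode UNIV UNIV"
    by (simp add: bij_prod_decode)
  have sum_a: "summable (\<lambda>m. norm (case_prod a (prod_decode m)))"
  proof -
    have "(\<lambda>m. norm (case_prod a (prod_decode m))) summable_on UNIV"
      using summable_on_reindex_bij_betw[OF bij, of "\<lambda>p. norm (case_prod a p)"] A1 by simp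
    then show ?thesis by (rule summable_on_imp_summable)
  qed
  show ?thesis
    unfolding trig_series_def
  proof (intro exI[of _ "\<lambda>m. case_prod a (prod_decode m)"] exI[of _ "\<lambda>m. case_prod l (prod_decode m)"] conjI allI)
    show "summable (\<lambda>m. norm (case_prod a (prod_decode m)))" by (rule sum_a)
    show "(\<lambda>m. case_prod a (prod_decode m) * cis (2 * pi * (case_prod l (prod_decode m) \<bullet> t))) sums (\<Sum>j. b j t)" for t
      by (rule has_sum_imp_sums, rule has_sum_reindex_bij_betw[OF bij, THEN iffD2, OF T])
    have "(\<Sum>m. norm (case_prod a (prod_decode m))) = (\<Sum>\<^sub>\<infinity>m. norm (case_prod a (prod_decode m)))"
      by (rule infsumI[symmetric], rule norm_summable_imp_has_sum) (use sum_a in \<open>simp_all add: summable_sums\<close>)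
    also have "\<dots> = infsum (\<lambda>p. norm (case_prod a p)) (SIGMA j:UNIV. UNIV)"
      using infsum_reindex_bij_betw[OF bij, of "\<lambda>p. norm (case_prod a p)"] by simp
    also have "\<dots> = (\<Sum>\<^sub>\<infinity>j. \<Sum>\<^sub>\<infinity>m. norm (a j m))"
      using infsum_Sigma_banach[OF A1] by simp
    also have "\<dots> = (\<Sum>j. \<Sum>m. norm (a j m))"
      unfolding inner
      by (rule infsumI, rule norm_summable_imp_has_sum) (use K0 al(1) in \<open>simp_all add: suminf_nonneg summable_sums\<close>)
    also have "\<dots> \<le> (\<Sum>j. K j)"
      by (intro suminf_le al K0 K)
    finally show "(\<Sum>m. norm (case_prod a (prod_decode m))) \<le> (\<Sum>j. K j)" .
  qed
qed

lemma trig_series_zero: "trig_series 0 (\<lambda>t. 0)"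
  using trig_series_monomial[of 0 0] by simp

lemma trig_series_const: "trig_series (norm c) (\<lambda>t. c)"
  using trig_series_monomial[of c 0] by simp

lemma trig_series_add:
  assumes "trig_series K b" "trig_series K' b'" shows "trig_series (K + K') (\<lambda>t. b t + b' t)"
proof -
  define KK where "KK = (\<lambda>j::nat. if j = 0 then K else if j = 1 then K' else 0)"
  define bb where "bb = (\<lambda>j::nat. if j = 0 then b else if j = 1 then b' else (\<lambda>t. 0))"
  have "KK sums (\<Sum>j\<in>{0,1}. KK j)" "\<And>t. (\<lambda>j. bb j t) sums (\<Sum>j\<in>{0,1}. bb j t)"
    by (rule sums_finite; simp add: KK_def bb_def)+
  moreover have "trig_series (KK j) (bb j)" for j
    using assms trig_series_zero by (auto simp: KK_def bb_def)
  ultimately show ?thesis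
    using trig_series_series[of KK bb] by (simp add: KK_def bb_def sums_iff)
qed

text \<open>Only the first factor is expanded: a character times \<open>b'\<close> is a modulation
  of \<open>b'\<close> and keeps the bound \<open>K'\<close>, so the product is a series of terms
  with bounds \<open>norm (a m) * K'\<close>.\<close>

lemma trig_series_mult:
  assumes b: "trig_series K b" and b': "trig_series K' b'" shows "trig_series (K * K') (\<lambda>t. b t * b' t)"
proof -
  obtain a l where al: "summable (\<lambda>m. norm (a m))" "(\<Sum>m. norm (a m)) \<le> K"
     "\<And>t. (\<lambda>m::nat. a m * cis (2 * pi * (l m \<bullet> t))) sums b t"
    using b unfolding trig_series_def by blast
  have "trig_series (\<Sum>m. norm (a m) * K') (\<lambda>t. \<Sum>m. a m * (cis (2 * pi * (l m \<bullet> t)) * b' t))"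
    by (intro trig_series_series trig_series_cmult trig_series_modulate b' summable_mult2 al)
  moreover have "(\<Sum>m. a m * (cis (2 * pi * (l m \<bullet> t)) * b' t)) = b t * b' t" for t
    using sums_mult2[OF al(3)[of t], of "b' t"] by (simp add: sums_iff mult.assoc)
  moreover have "(\<Sum>m. norm (a m) * K') \<le> K * K'"
    using al trig_series_nonneg[OF b'] by (simp add: suminf_mult2[symmetric] mult_right_mono)
  ultimately show ?thesis by (simp add: trig_series_mono)
qed

lemma trig_series_power: "trig_series K b \<Longrightarrow> trig_series (K ^ n) (\<lambda>t. b t ^ n)"
  using trig_series_const[of 1] by (induction n) (auto intro: trig_series_mult)

text \<open>The bound is submultiplicative and the Taylor coefficients of \<open>exp\<close> are
  positive, so the tail at \<open>b\<close> is controlled by the numerical tail at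
  \<open>K\<close>.\<close>

lemma trig_series_exp_tail:
  assumes "trig_series K b"
  shows "trig_series (exp K - (\<Sum>j<n. K ^ j / fact j)) (\<lambda>t. exp (b t) - (\<Sum>j<n. b t ^ j / fact j))"
proof -
  have e: "(\<lambda>j. x ^ (j + n) / fact (j + n)) sums (exp x - (\<Sum>j<n. x ^ j / fact j))"
    for x :: "'x::{real_normed_field,banach}"
    using sums_split_initial_segment[OF exp_converges[of x], of n]
    by (simp add: scaleR_conv_of_real field_simps)
  have "trig_series (K ^ (j + n) / fact (j + n)) (\<lambda>t. b t ^ (j + n) / fact (j + n))" for j
    using trig_series_cmult[OF trig_series_power[OF assms, of "j + n"], of "1 / fact (j + n)"]
    by (simp add: norm_divide)
  then have "trig_series (\<Sum>j. K ^ (j + n) / fact (j + n)) (\<lambda>t. \<Sum>j. b t ^ (j + n) / fact (j + n))"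
    using e[of K] by (intro trig_series_series) (auto simp: sums_iff)
  then show ?thesis
    using e[of K] e[of "b t" for t, unfolded sums_iff] by (simp add: sums_iff)
qed

lemma trig_series_exp: "trig_series K b \<Longrightarrow> trig_series (exp K) (\<lambda>t. exp (b t))"
  using trig_series_exp_tail[of K b 0] by simp

lemma fourier_trig_series_sums:
  assumes v: "integrable lborel v" and a: "summable (\<lambda>m. norm (a m))"
    and b: "\<And>t. (\<lambda>m::nat. a m * cis (2 * pi * (l m \<bullet> t))) sums b t"
  shows "(\<lambda>m. a m * fourier v (w - l m)) sums fourier (\<lambda>t. v t * b t) w"
proof -
  let ?f = "\<lambda>m t. v t * (a m * cis (2 * pi * (l m \<bullet> t))) * cis (- (2 * pi * (w \<bullet> t)))"
  have i: "integrable lborel (?f m)" for m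
    by (intro integrable_fourier_kernel integrable_mult_bounded[OF v, where K="norm (a m)"])
       (auto simp: norm_mult)
  have "(\<lambda>m. LBINT t. ?f m t) sums (LBINT t. (\<Sum>m. ?f m t))"
  proof (rule sums_integral[OF i])
    show "AE t in lborel. summable (\<lambda>m. norm (?f m t))"
      using a by (intro AE_I2) (simp add: norm_mult summable_mult)
    show "summable (\<lambda>m. LBINT t. norm (?f m t))"
      using a by (simp add: norm_mult summable_mult2 mult.commute)
  qed
  moreover have "(LBINT t. ?f m t) = a m * fourier v (w - l m)" for m
    unfolding fourier_modulate[symmetric] fourier_cmult[symmetric] unfolding fourier_def
    by (intro Bochner_Integration.integral_cong) (auto simp: mult_ac)
  moreover have "(LBINT t. (\<Sum>m. ?f m t)) = fourier (\<lambda>t. v t * b t) w"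
    unfolding fourier_def
  proof (intro Bochner_Integration.integral_cong refl)
    fix t show "(\<Sum>m. ?f m t) = v t * b t * cis (- (2 * pi * (w \<bullet> t)))"
      using sums_mult2[OF sums_mult[OF b[of t], of "v t"]] by (simp add: sums_iff)
  qed
  ultimately show ?thesis by simp
qed

text \<open>Each character translates the transform, so the new majorant is the sum of
  \<open>norm (a m) * H (w - l m)\<close>. It depends on \<open>b\<close> and \<open>H\<close> only:
  one function of \<open>w\<close> serves all parameters \<open>x\<close>, and the factor
  \<open>\<omega> x\<close> stays separate. Both its integral and its supremum grow by at most the
  factor \<open>K\<close>.\<close>

lemma fourier_trig_series_dominated:
  fixes v :: "'x \<Rightarrow> 'a::euclidean_space \<Rightarrow> complex" and H :: "'a \<Rightarrow> ennreal"
  assumes v: "\<And>x. integrable lborel (v x)" and b: "trig_series K b" and H: "H \<in> borel_measurable borel"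
    and dom: "\<And>x w. ennreal (norm (fourier (v x) w)) \<le> \<omega> x * H w"
  obtains H' where "H' \<in> borel_measurable borel"
    "(\<integral>\<^sup>+w. H' w \<partial>lborel) \<le> ennreal K * (\<integral>\<^sup>+w. H w \<partial>lborel)"
    "\<And>S. (\<And>w. H w \<le> S) \<Longrightarrow> (\<And>w. H' w \<le> ennreal K * S)"
    "\<And>x w. ennreal (norm (fourier (\<lambda>t. v x t * b t) w)) \<le> \<omega> x * H' w"
proof -
  obtain a l where al: "summable (\<lambda>m. norm (a m))" "(\<Sum>m. norm (a m)) \<le> K"
     "\<And>t. (\<lambda>m::nat. a m * cis (2 * pi * (l m \<bullet> t))) sums b t"
    using b unfolding trig_series_def by blast
  define H' where "H' = (\<lambda>w. \<Sum>m. ennreal (norm (a m)) * H (w - l m))"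
  have suma: "(\<Sum>m. ennreal (norm (a m))) \<le> ennreal K"
    using al by (subst suminf_ennreal2) (auto intro: ennreal_leI)
  note H[measurable]
  show ?thesis
  proof (rule that)
    show "H' \<in> borel_measurable borel" unfolding H'_def by measurable
    have "(\<integral>\<^sup>+w. H' w \<partial>lborel) = (\<Sum>m. ennreal (norm (a m)) * (\<integral>\<^sup>+w. H (w - l m) \<partial>lborel))"
      unfolding H'_def by (subst nn_integral_suminf) (auto simp: nn_integral_cmult)
    also have "\<dots> = (\<Sum>m. ennreal (norm (a m))) * (\<integral>\<^sup>+w. H w \<partial>lborel)"
      using nn_integral_lborel_translate[OF H, of "- l m" for m] by simp
    also have "\<dots> \<le> ennreal K * (\<integral>\<^sup>+w. H w \<partial>lborel)"
      by (intro mult_right_mono suma) simp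
    finally show "(\<integral>\<^sup>+w. H' w \<partial>lborel) \<le> ennreal K * (\<integral>\<^sup>+w. H w \<partial>lborel)" .
    show "H' w \<le> ennreal K * S" if "\<And>w. H w \<le> S" for S w
    proof -
      have "H' w \<le> (\<Sum>m. ennreal (norm (a m)) * S)"
        unfolding H'_def by (intro suminf_le mult_left_mono that) auto
      also have "\<dots> \<le> ennreal K * S"
        by (simp add: suma mult_right_mono)
      finally show ?thesis .
    qed
    show "ennreal (norm (fourier (\<lambda>t. v x t * b t) w)) \<le> \<omega> x * H' w" for x w
    proof -
      have s: "summable (\<lambda>m. norm (a m * fourier (v x) (w - l m)))"
        by (rule summable_comparison_test'[OF summable_mult2[OF al(1), of "LBINT t. norm (v x t)"]])
           (auto simp: norm_mult norm_fourier_le mult_left_mono)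
      have "ennreal (norm (fourier (\<lambda>t. v x t * b t) w)) \<le> ennreal (\<Sum>m. norm (a m * fourier (v x) (w - l m)))"
        using summable_norm[OF s] fourier_trig_series_sums[OF v al(1) al(3), of x w]
        by (auto intro!: ennreal_leI simp: sums_iff)
      also have "\<dots> = (\<Sum>m. ennreal (norm (a m)) * ennreal (norm (fourier (v x) (w - l m))))"
        using s by (subst suminf_ennreal2[symmetric]) (auto simp: norm_mult ennreal_mult)
      also have "\<dots> \<le> (\<Sum>m. ennreal (norm (a m)) * (\<omega> x * H (w - l m)))"
        by (intro suminf_le mult_left_mono dom) auto
      also have "\<dots> = \<omega> x * H' w"
        unfolding H'_def by (subst ennreal_suminf_cmult[symmetric]) (simp add: mult_ac)
      finally show ?thesis .
    qed
  qed
qed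

text \<open>The case of a constant majorant and a one-point parameter space.\<close>

lemma norm_fourier_trig_series_le:
  fixes v :: "'a::euclidean_space \<Rightarrow> complex"
  assumes v: "integrable lborel v" and b: "trig_series K b" and S: "\<And>w. norm (fourier v w) \<le> S"
  shows "norm (fourier (\<lambda>t. v t * b t) w) \<le> K * S"
proof (rule fourier_trig_series_dominated[of "\<lambda>_::unit. v" K b "\<lambda>_. ennreal S" "\<lambda>_. 1"])
  have "0 \<le> S" using order_trans[OF norm_ge_zero S[of 0]] .
  fix H' :: "'a \<Rightarrow> ennreal"
  assume H': "\<And>S' w. (\<And>w::'a. ennreal S \<le> S') \<Longrightarrow> H' w \<le> ennreal K * S'"
    "\<And>x w. ennreal (norm (fourier (\<lambda>t. v t * b t) w)) \<le> 1 * H' w"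
  have "ennreal (norm (fourier (\<lambda>t. v t * b t) w)) \<le> H' w"
    using H'(2) by simp
  also have "\<dots> \<le> ennreal K * ennreal S"
    by (rule H'(1)) simp
  finally show ?thesis
    using trig_series_nonneg[OF b] \<open>0 \<le> S\<close> by (simp flip: ennreal_mult)
qed (use v b S in \<open>auto simp: ennreal_leI\<close>)

subsection \<open>Phases with a flat spectrum\<close>

lemma emeasure_lborel_cball_less_top: "emeasure lborel (cball c R :: 'a::euclidean_space set) < \<top>"
  using emeasure_bounded_finite[OF bounded_cball[of c R]] by simp

lemma integrable_bounded_support:
  fixes v :: "'a::euclidean_space \<Rightarrow> 'b::{banach, second_countable_topology}"
  assumes "v \<in> borel_measurable borel" "\<And>t. norm (v t) \<le> B" "\<And>t. t \<notin> cball c R \<Longrightarrow> v t = 0"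
  shows "integrable lborel v"
proof (rule Bochner_Integration.integrable_bound)
  show "integrable lborel (\<lambda>t. B * indicator (cball c R) t :: real)"
    by (intro integrable_mult_right integrable_real_indicator)
       (auto simp: emeasure_lborel_cball_less_top)
  show "AE t in lborel. norm (v t) \<le> norm (B * indicator (cball c R) t :: real)"
    using assms(2) assms(3) by (intro AE_I2) (auto simp: indicator_def intro: order_trans[OF _ abs_ge_self])
qed (use assms in auto)

lemma continuous_compact_support_bounded:
  fixes v :: "'a::euclidean_space \<Rightarrow> 'b::real_normed_vector"
  assumes "continuous_on UNIV v" "\<And>t. t \<notin> cball c R \<Longrightarrow> v t = 0"
  obtains B where "0 < B" "\<And>t. norm (v t) \<le> B"
proof -
  have "bounded (v ` cball c R)"
    by (intro compact_imp_bounded compact_continuous_image compact_cball continuous_on_subset[OF assms(1)]) auto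
  then obtain B where B: "0 < B" "\<forall>y\<in>v ` cball c R. norm y \<le> B"
    unfolding bounded_pos by blast
  have "norm (v t) \<le> B" for t
    using B assms(2)[of t] by (cases "t \<in> cball c R") auto
  with B(1) show ?thesis by (intro that) auto
qed

lemma integrable_continuous_compact_support:
  fixes v :: "'a::euclidean_space \<Rightarrow> 'b::{banach, second_countable_topology}"
  assumes "continuous_on UNIV v" "\<And>t. t \<notin> cball c R \<Longrightarrow> v t = 0"
  shows "integrable lborel v"
  using assms
  by (rule continuous_compact_support_bounded)
     (auto intro: integrable_bounded_support[OF borel_measurable_continuous_onI[OF assms(1)] _ assms(2)])

text \<open>A shift by \<open>y\<close> with \<open>w \<bullet> y = 1/2\<close> reverses the sign of
  the transform at \<open>w\<close>, so twice the transform of \<open>v\<close> is that of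
  \<open>v t - v (t - y)\<close>. As \<open>norm y = 1 / (2 * norm w)\<close> is small, uniform
  continuity makes this difference small.\<close>

lemma riemann_lebesgue:
  fixes v :: "'a::euclidean_space \<Rightarrow> complex"
  assumes v: "continuous_on UNIV v" and supp: "\<And>t. t \<notin> cball 0 R \<Longrightarrow> v t = 0" and e: "0 < \<epsilon>"
  obtains R' where "0 < R'" "\<And>w. R' \<le> norm w \<Longrightarrow> norm (fourier v w) \<le> \<epsilon>"
proof -
  have int: "integrable lborel v"
    by (rule integrable_continuous_compact_support[OF v supp])
  define M where "M = measure lborel (cball (0::'a) (R + 1))"
  define \<eta> where "\<eta> = \<epsilon> / (M + 1)"
  have M: "0 \<le> M" by (simp add: M_def)
  then have \<eta>: "0 < \<eta>" using e by (simp add: \<eta>_def)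
  \<comment> \<open>The margin 2 keeps \<open>t\<close> and \<open>t - y\<close> in the compact set
    whenever \<open>norm t \<le> R + 1\<close> and \<open>norm y \<le> 1\<close>; for larger
    \<open>t\<close> both values of \<open>v\<close> vanish.\<close>
  have "uniformly_continuous_on (cball 0 (R + 2)) v"
    by (intro compact_uniformly_continuous compact_cball continuous_on_subset[OF v]) auto
  then obtain d where d: "0 < d" "\<And>x y. x \<in> cball 0 (R + 2) \<Longrightarrow> y \<in> cball 0 (R + 2) \<Longrightarrow> dist y x < d \<Longrightarrow> dist (v y) (v x) < \<eta>"
    unfolding uniformly_continuous_on_def using \<eta> by metis
  have uc: "norm (v t - v (t - y)) \<le> \<eta> * indicator (cball 0 (R + 1)) t" if y: "norm y < d" "norm y \<le> 1" for t y
  proof (cases "t \<in> cball 0 (R + 1)")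
    case True
    then have "norm t \<le> R + 1" by simp
    moreover have "norm (t - y) \<le> norm t + norm y" by (rule norm_triangle_ineq4)
    ultimately have "dist (v t) (v (t - y)) < \<eta>"
      using y by (intro d(2)) (auto simp: dist_norm norm_minus_commute)
    with True show ?thesis by (simp add: dist_norm)
  next
    case False
    then have "R + 1 < norm t" by simp
    moreover have "norm t \<le> norm (t - y) + norm y" by (metis diff_add_cancel norm_triangle_ineq)
    ultimately have "R < norm t" "R < norm (t - y)" using y by auto
    then have "v t = 0" "v (t - y) = 0" using supp by auto
    then show ?thesis using \<eta> by simp
  qed
  define R' where "R' = max 1 (1 / d)"
  show ?thesis
  proof (rule that)
    show "0 < R'" by (simp add: R'_def)
    fix w :: 'a assume w: "R' \<le> norm w"
    have w1: "1 \<le> norm w" "1 / d \<le> norm w" using w by (auto simp: R'_def)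
    define y where "y = (1 / (2 * (norm w)\<^sup>2)) *\<^sub>R w"
    have ny: "norm y = 1 / (2 * norm w)" using w1 by (simp add: y_def power2_eq_square)
    have "1 \<le> d * norm w" using w1(2) d(1) by (simp add: field_simps)
    then have "1 / (2 * norm w) < d" using w1 by (subst pos_divide_less_eq) (auto simp: mult_ac)
    then have y: "norm y < d" "norm y \<le> 1" using w1 unfolding ny by (auto simp: divide_le_eq)
    have wy: "w \<bullet> y = 1 / 2" using w1 by (auto simp: y_def power2_norm_eq_inner[symmetric])
    have "fourier (\<lambda>t. v (t - y)) w = - fourier v w"
      unfolding fourier_translate wy by (simp add: complex_eq_iff)
    moreover have "fourier (\<lambda>t. v t + (- 1) * v (t - y)) w = fourier v w + fourier (\<lambda>t. (- 1) * v (t - y)) w"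
      using integrable_lborel_translate[OF int, of "- y"] by (intro fourier_add int) auto
    ultimately have "2 * fourier v w = fourier (\<lambda>t. v t - v (t - y)) w"
      unfolding fourier_cmult by simp
    then have "2 * norm (fourier v w) = norm (fourier (\<lambda>t. v t - v (t - y)) w)"
      by (metis norm_mult norm_numeral)
    also have "\<dots> \<le> (LBINT t. norm (v t - v (t - y)))"
      by (rule norm_fourier_le)
    also have "\<dots> \<le> (LBINT t. \<eta> * indicator (cball (0::'a) (R + 1)) t)"
    proof (rule Bochner_Integration.integral_mono)
      show "integrable lborel (\<lambda>t. norm (v t - v (t - y)))"
        using int integrable_lborel_translate[OF int, of "- y"] by auto
      show "integrable lborel (\<lambda>t::'a. \<eta> * indicator (cball 0 (R + 1)) t :: real)"
        by (intro integrable_mult_right integrable_real_indicator) (auto simp: emeasure_lborel_cball_less_top)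
    qed (rule uc[OF y])
    also have "\<dots> = \<eta> * M" by (simp add: M_def)
    also have "\<dots> \<le> \<epsilon>" using e M by (simp add: \<eta>_def field_simps)
    finally show "norm (fourier v w) \<le> \<epsilon>" using norm_ge_zero[of "fourier v w"] by linarith
  qed
qed

text \<open>The double-angle formula splits \<open>- cos^2 / 2\<close> into \<open>- 1/4\<close> and
  second harmonics with coefficient \<open>- 1/8\<close>; hence the constant
  \<open>3/4\<close>.\<close>

lemma exp_i_cos_quadratic:
  fixes t :: "'a::euclidean_space"
  shows "(\<Sum>j<3. (\<i> * complex_of_real (cos (2 * pi * (l \<bullet> t)))) ^ j / fact j)
    = (\<Sum>k\<in>{-2..2::int}. (if k = 0 then 3 / 4 else if \<bar>k\<bar> = 1 then \<i> / 2 else - 1 / 8)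
         * cis (2 * pi * ((of_int k *\<^sub>R l) \<bullet> t)))"
proof -
  let ?x = "2 * pi * (l \<bullet> t)"
  have set: "{-2..2::int} = {-2, -1, 0, 1, 2}" by auto
  have A: "(\<Sum>j<3. (\<i> * complex_of_real (cos ?x)) ^ j / fact j) = 1 + \<i> * cos ?x - (cos ?x)\<^sup>2 / 2"
    by (simp add: numeral_3_eq_3 power2_eq_square algebra_simps fact_numeral)
  have B: "(\<Sum>k\<in>{-2..2::int}. (if k = 0 then 3 / 4 else if \<bar>k\<bar> = 1 then \<i> / 2 else - 1 / 8)
         * cis (2 * pi * ((of_int k *\<^sub>R l) \<bullet> t)))
     = 3 / 4 + \<i> / 2 * (cis ?x + cis (- ?x)) - 1 / 8 * (cis (2 * ?x) + cis (- (2 * ?x)))"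
    unfolding set by (simp add: algebra_simps)
  have C: "cis ?x + cis (- ?x) = 2 * cos ?x" by (simp add: complex_eq_iff)
  have D: "cis (2 * ?x) + cis (- (2 * ?x)) = 4 * (cos ?x)\<^sup>2 - 2"
    using cos_double_cos[of ?x] by (simp add: complex_eq_iff)
  show ?thesis unfolding A B C D by (simp add: field_simps)
qed

lemma trig_series_cos: "trig_series 1 (\<lambda>t. complex_of_real (cos (2 * pi * (l \<bullet> t))))"
proof -
  have "trig_series (norm (1/2::complex) + norm (1/2::complex)) (\<lambda>t. 1/2 * cis (2 * pi * (l \<bullet> t)) + 1/2 * cis (2 * pi * ((- l) \<bullet> t)))"
    by (intro trig_series_add trig_series_monomial)
  moreover have "(\<lambda>t. 1/2 * cis (2 * pi * (l \<bullet> t)) + 1/2 * cis (2 * pi * ((- l) \<bullet> t)))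
      = (\<lambda>t. complex_of_real (cos (2 * pi * (l \<bullet> t))))"
    by (simp add: complex_eq_iff fun_eq_iff)
  ultimately show ?thesis by (simp add: norm_divide)
qed

text \<open>To second order, \<open>exp (i cos x)\<close> is \<open>3/4 + (i/2) (z + 1/z) - (1/8) (z\<^sup>2 + 1/z\<^sup>2)\<close> with \<open>z = exp (i x)\<close>, and
  the remainder has Wiener norm at most \<open>e - 5/2 < 22/100\<close>. A large frequency makes the translates of the
  transform essentially disjoint, so the supremum shrinks by a factor close to \<open>3/4 + 22/100 < 49/50\<close>.\<close>

lemma flat_spectrum_step:
  fixes v :: "'a::euclidean_space \<Rightarrow> complex"
  assumes v: "continuous_on UNIV v" and supp: "\<And>t. t \<notin> cball 0 R \<Longrightarrow> v t = 0"
    and S: "\<And>w. norm (fourier v w) \<le> S" "0 < S"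
  obtains h where "continuous_on UNIV h" "trig_series 1 (\<lambda>t. complex_of_real (h t))"
    "\<And>w. norm (fourier (\<lambda>t. v t * cis (h t)) w) \<le> 49 / 50 * S"
proof -
  have int: "integrable lborel v"
    by (rule integrable_continuous_compact_support[OF v supp])
  \<comment> \<open>The moduli of the five coefficients add up to 2, so the far translates
    contribute at most \<open>2 * S / 200\<close>. In total
    \<open>3/4 + 22/100 + 1/100 = 49/50\<close>.\<close>
  obtain R' where R': "0 < R'" "\<And>w. R' \<le> norm w \<Longrightarrow> norm (fourier v w) \<le> S / 200"
    using riemann_lebesgue[OF v supp, where \<epsilon>="S / 200"] S(2) by auto
  obtain e :: 'a where e: "e \<in> Basis" using nonempty_Basis by blast
  \<comment> \<open>With spacing \<open>2 * R'\<close>, a point \<open>w\<close> is closer than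
    \<open>R'\<close> to at most one multiple of \<open>l\<close>.\<close>
  define l where "l = (2 * R') *\<^sub>R e"
  have nl: "norm l = 2 * R'" using R'(1) e by (simp add: l_def)
  define h where "h = (\<lambda>t. cos (2 * pi * (l \<bullet> t)))"
  define c :: "int \<Rightarrow> complex" where "c = (\<lambda>k. if k = 0 then 3 / 4 else if \<bar>k\<bar> = 1 then \<i> / 2 else - 1 / 8)"
  define r where "r = (\<lambda>t. exp (\<i> * h t) - (\<Sum>j<3. (\<i> * complex_of_real (h t)) ^ j / fact j))"
  have ih: "trig_series 1 (\<lambda>t. \<i> * complex_of_real (h t))"
    using trig_series_cmult[OF trig_series_cos, of \<i> l] by (simp add: h_def)
  have "exp (1::real) - (\<Sum>j<3. 1 ^ j / fact j) \<le> 22 / 100"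
    using e_less_272 by (simp add: numeral_3_eq_3 fact_numeral)
  then have r: "trig_series (22 / 100) r"
    using trig_series_mono[OF trig_series_exp_tail[OF ih, of 3]] unfolding r_def by simp
  have split: "v t * cis (h t) = (\<Sum>k\<in>{-2..2}. v t * (c k * cis (2 * pi * ((of_int k *\<^sub>R l) \<bullet> t)))) + v t * r t" for t
    unfolding r_def h_def exp_i_cos_quadratic c_def cis_conv_exp
    by (simp add: ring_distribs sum_distrib_left)
  have intk: "integrable lborel (\<lambda>t. v t * (c k * cis (2 * pi * ((of_int k *\<^sub>R l) \<bullet> t))))" for k
    by (rule integrable_mult_bounded[OF int, where K="norm (c k)"]) (auto simp: norm_mult)
  have intr: "integrable lborel (\<lambda>t. v t * r t)"
    using trig_series_measurable[OF r] by (intro integrable_mult_bounded[OF int _ trig_series_bounded[OF r]]) auto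
  have F: "fourier (\<lambda>t. v t * cis (h t)) w = (\<Sum>k\<in>{-2..2}. c k * fourier v (w - of_int k *\<^sub>R l)) + fourier (\<lambda>t. v t * r t) w" for w
  proof -
    have "fourier (\<lambda>t. \<Sum>k\<in>A. v t * (c k * cis (2 * pi * ((of_int k *\<^sub>R l) \<bullet> t)))) w
      = (\<Sum>k\<in>A. c k * fourier v (w - of_int k *\<^sub>R l))" if "finite A" for A
      using that
    proof (induction A rule: finite_induct)
      case (insert k A)
      have "fourier (\<lambda>t. v t * (c k * cis (2 * pi * ((of_int k *\<^sub>R l) \<bullet> t)))) w
         = c k * fourier v (w - of_int k *\<^sub>R l)"
        unfolding fourier_modulate[symmetric] fourier_cmult[symmetric] by (simp add: mult_ac)
      with insert show ?case
        by (simp add: fourier_add intk Bochner_Integration.integrable_sum del: inner_scaleR_left)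
    qed (simp add: fourier_def)
    then show ?thesis
      unfolding split by (simp add: fourier_add intk intr Bochner_Integration.integrable_sum del: inner_scaleR_left)
  qed
  show ?thesis
  proof (rule that[of h])
    show "continuous_on UNIV h" unfolding h_def by (intro continuous_intros)
    show "trig_series 1 (\<lambda>t. complex_of_real (h t))" unfolding h_def by (rule trig_series_cos)
    fix w
    have tail: "norm (fourier (\<lambda>t. v t * r t) w) \<le> 22 / 100 * S"
      by (rule norm_fourier_trig_series_le[OF int r S(1)])
    \<comment> \<open>The index of the only translate that may be large at \<open>w\<close>; if
      there is none, 0 serves as a dummy.\<close>
    obtain \<kappa> :: int where \<kappa>: "\<And>k. k \<noteq> \<kappa> \<Longrightarrow> R' \<le> norm (w - of_int k *\<^sub>R l)"
    proof (cases "\<exists>k::int. norm (w - of_int k *\<^sub>R l) < R'")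
      case True
      then obtain \<kappa> :: int where k: "norm (w - of_int \<kappa> *\<^sub>R l) < R'" by blast
      have "R' \<le> norm (w - of_int k *\<^sub>R l)" if "k \<noteq> \<kappa>" for k
      proof -
        have "1 \<le> \<bar>real_of_int (k - \<kappa>)\<bar>" using that by linarith
        then have "2 * R' \<le> norm (of_int (k - \<kappa>) *\<^sub>R l)"
          using R'(1) by (simp add: nl)
        also have "of_int (k - \<kappa>) *\<^sub>R l = (w - of_int \<kappa> *\<^sub>R l) - (w - of_int k *\<^sub>R l)"
          by (simp add: scaleR_diff_left)
        also have "norm \<dots> \<le> norm (w - of_int \<kappa> *\<^sub>R l) + norm (w - of_int k *\<^sub>R l)"
          by (rule norm_triangle_ineq4)
        finally show ?thesis using k by linarith
      qed
      then show ?thesis by (rule that)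
    next
      case False
      then show ?thesis by (intro that[of 0]) (meson not_less)
    qed
    have set: "{-2..2::int} = {-2, -1, 0, 1, 2}" by auto
    have "norm (\<Sum>k\<in>{-2..2}. c k * fourier v (w - of_int k *\<^sub>R l))
        \<le> (\<Sum>k\<in>{-2..2}. norm (c k) * (S / 200) + (if k = \<kappa> then 3 / 4 * S else 0))"
    proof (rule sum_norm_le)
      fix k :: int
      have c: "norm (c k) \<le> 3 / 4" by (simp add: c_def norm_divide)
      show "norm (c k * fourier v (w - of_int k *\<^sub>R l)) \<le> norm (c k) * (S / 200) + (if k = \<kappa> then 3 / 4 * S else 0)"
      proof (cases "k = \<kappa>")
        case True
        have "norm (c k * fourier v (w - of_int k *\<^sub>R l)) \<le> 3 / 4 * S"
          unfolding norm_mult by (intro mult_mono c S) auto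
        moreover have "0 \<le> norm (c k) * (S / 200)" using S(2) by simp
        ultimately show ?thesis using True by auto
      next
        case False
        then show ?thesis using mult_left_mono[OF R'(2)[OF \<kappa>[OF False]] norm_ge_zero[of "c k"]] by (simp add: norm_mult)
      qed
    qed
    also have "\<dots> \<le> 2 * (S / 200) + 3 / 4 * S"
    proof -
      have "(\<Sum>k\<in>{-2..2}. norm (c k) * (S / 200)) = 2 * (S / 200)"
        unfolding set by (simp add: c_def norm_divide)
      moreover have "(\<Sum>k\<in>{-2..2}. (if k = \<kappa> then 3 / 4 * S else 0)) \<le> 3 / 4 * S"
        using S(2) by (subst sum.delta) auto
      ultimately show ?thesis by (simp add: sum.distrib)
    qed
    finally have "norm (fourier (\<lambda>t. v t * cis (h t)) w) \<le> 2 * (S / 200) + 3 / 4 * S + 22 / 100 * S"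
      unfolding F using tail by (intro order_trans[OF norm_triangle_ineq] add_mono) auto
    then show "norm (fourier (\<lambda>t. v t * cis (h t)) w) \<le> 49 / 50 * S" by simp
  qed
qed

text \<open>The product of \<open>v\<close> with the phase found so far is again continuous with the
  same support, so the step applies to it with a smaller supremum. Each new frequency depends on the
  product already built, and each cosine adds 1 to the Wiener norm of the phase.\<close>

lemma flat_spectrum:
  fixes v :: "'a::euclidean_space \<Rightarrow> complex"
  assumes v: "continuous_on UNIV v" and supp: "\<And>t. t \<notin> cball 0 R \<Longrightarrow> v t = 0"
    and S: "\<And>w. norm (fourier v w) \<le> S" "0 < S"
  obtains h where "continuous_on UNIV h" "trig_series (real n) (\<lambda>t. complex_of_real (h t))"
    "\<And>w. norm (fourier (\<lambda>t. v t * cis (h t)) w) \<le> (49 / 50) ^ n * S"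
proof -
  have "\<exists>h. continuous_on UNIV h \<and> trig_series (real n) (\<lambda>t. complex_of_real (h t)) \<and>
    (\<forall>w. norm (fourier (\<lambda>t. v t * cis (h t)) w) \<le> (49 / 50) ^ n * S)"
  proof (induction n)
    case 0
    show ?case using S trig_series_zero by (intro exI[of _ "\<lambda>_. 0"]) auto
  next
    case (Suc n)
    then obtain h where h: "continuous_on UNIV h" "trig_series (real n) (\<lambda>t. complex_of_real (h t))"
      "\<And>w. norm (fourier (\<lambda>t. v t * cis (h t)) w) \<le> (49 / 50) ^ n * S" by blast
    obtain k where k: "continuous_on UNIV k" "trig_series 1 (\<lambda>t. complex_of_real (k t))"
      "\<And>w. norm (fourier (\<lambda>t. v t * cis (h t) * cis (k t)) w) \<le> 49 / 50 * ((49 / 50) ^ n * S)"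
    proof (rule flat_spectrum_step[of "\<lambda>t. v t * cis (h t)" R "(49 / 50) ^ n * S"])
      show "continuous_on UNIV (\<lambda>t. v t * cis (h t))" by (intro continuous_intros v h)
    qed (use supp h(3) S(2) in auto)
    show ?case
    proof (intro exI[of _ "\<lambda>t. h t + k t"] conjI allI)
      show "continuous_on UNIV (\<lambda>t. h t + k t)" by (intro continuous_intros h k)
      show "trig_series (real (Suc n)) (\<lambda>t. complex_of_real (h t + k t))"
        using trig_series_add[OF h(2) k(2)] by (simp add: add.commute)
      show "norm (fourier (\<lambda>t. v t * cis (h t + k t)) w) \<le> (49 / 50) ^ Suc n * S" for w
        using k(3)[of w] by (simp add: mult.assoc cis_mult)
    qed
  qed
  then show ?thesis using that by blast
qed

subsection \<open>Decay of short-time Fourier transforms\<close>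

text \<open>Differentiability along the lines in direction \<open>b\<close>. This suits integration
  by parts in one direction and reduces the product rule to functions of a real variable.\<close>

definition has_partial :: "'a::euclidean_space \<Rightarrow> ('a \<Rightarrow> complex) \<Rightarrow> ('a \<Rightarrow> complex) \<Rightarrow> bool" where
  "has_partial b f f' \<longleftrightarrow> (\<forall>t. ((\<lambda>s. f (t + s *\<^sub>R b)) has_vector_derivative f' t) (at 0))"

lemma has_partial_line:
  assumes "has_partial b f f'"
  shows "((\<lambda>s. f (t + s *\<^sub>R b)) has_vector_derivative f' (t + s *\<^sub>R b)) (at s)"
proof -
  have 1: "((\<lambda>\<sigma>. \<sigma> - s) has_vector_derivative 1) (at s)"
    by (auto intro!: derivative_eq_intros)
  have "((\<lambda>\<sigma>. f (t + s *\<^sub>R b + \<sigma> *\<^sub>R b)) has_vector_derivative f' (t + s *\<^sub>R b)) (at (s - s))"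
    using assms by (simp add: has_partial_def)
  from vector_diff_chain_at[OF 1 this] show ?thesis
    by (simp add: o_def scaleR_left_diff_distrib add.assoc)
qed

lemma has_vector_derivative_quotient:
  fixes f :: "real \<Rightarrow> 'b::real_normed_vector"
  assumes "(f has_vector_derivative d) (at 0)"
  shows "((\<lambda>s. (f s - f 0) /\<^sub>R s) \<longlongrightarrow> d) (at 0)"
proof -
  have "((\<lambda>s. norm (f s - f 0 - s *\<^sub>R d) / norm s) \<longlongrightarrow> 0) (at 0)"
    using assms by (simp add: has_vector_derivative_def has_derivative_iff_norm)
  moreover have "eventually (\<lambda>s. norm (f s - f 0 - s *\<^sub>R d) / norm s = norm ((f s - f 0) /\<^sub>R s - d)) (at 0)"
  proof (rule eventually_mono[OF eventually_neq_at_within[of 0]])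
    fix s :: real assume s: "s \<noteq> 0"
    have "(f s - f 0) /\<^sub>R s - d = (f s - f 0 - s *\<^sub>R d) /\<^sub>R s"
      using s by (simp add: scaleR_diff_right)
    then show "norm (f s - f 0 - s *\<^sub>R d) / norm s = norm ((f s - f 0) /\<^sub>R s - d)"
      by (simp add: divide_inverse mult.commute)
  qed
  ultimately have "((\<lambda>s. norm ((f s - f 0) /\<^sub>R s - d)) \<longlongrightarrow> 0) (at 0)"
    by (rule Lim_transform_eventually)
  then have "((\<lambda>s. (f s - f 0) /\<^sub>R s - d) \<longlongrightarrow> 0) (at 0)"
    by (rule tendsto_norm_zero_cancel)
  then show ?thesis by (rule LIM_zero_cancel)
qed

text \<open>Difference quotients take the place of integration by parts. By the translation rule the
  transform of the quotient with step \<open>h i\<close> is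
  \<open>(cis (2 * pi * (w \<bullet> b) * h i) - 1) / h i\<close> times that of \<open>v\<close>;
  the claim is the limit of this identity.\<close>

lemma fourier_partial:
  fixes v v' :: "'a::euclidean_space \<Rightarrow> complex"
  assumes d: "has_partial b v v'" and b: "norm b = 1"
    and m [measurable]: "v \<in> borel_measurable borel" "v' \<in> borel_measurable borel"
    and bd: "\<And>t. norm (v t) \<le> B" "\<And>t. norm (v' t) \<le> C"
    and supp: "\<And>t. t \<notin> cball 0 R \<Longrightarrow> v t = 0"
  shows "fourier v' w = \<i> * complex_of_real (2 * pi * (w \<bullet> b)) * fourier v w"
proof -
  have C: "0 \<le> C" using bd(2)[of 0] norm_ge_zero order_trans by blast
  have int: "integrable lborel v"
    by (rule integrable_bounded_support[OF m(1) bd(1) supp])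
  define h where "h = (\<lambda>i. inverse (real (Suc i)))"
  have h: "0 < h i" "h i \<le> 1" for i by (auto simp: h_def field_simps)
  have h0: "h \<longlonglongrightarrow> 0" unfolding h_def by (rule LIMSEQ_inverse_real_of_nat)
  have ha: "filterlim h (at 0) sequentially"
    using h0 h(1) by (auto simp: filterlim_at less_imp_neq[symmetric] intro!: always_eventually)
  let ?D = "\<lambda>i t. (v (t + h i *\<^sub>R b) - v t) /\<^sub>R h i"
  have lim: "(\<lambda>i. ?D i t) \<longlonglongrightarrow> v' t" for t
  proof -
    have "((\<lambda>s. (v (t + s *\<^sub>R b) - v t) /\<^sub>R s) \<longlongrightarrow> v' t) (at 0)"
      using has_vector_derivative_quotient[OF d[unfolded has_partial_def, rule_format, of t]] by simp
    from filterlim_compose[OF this ha] show ?thesis .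
  qed
  \<comment> \<open>The mean value inequality gives the bound inside the ball. Beyond radius
    \<open>R + 1\<close> both values of \<open>v\<close> vanish, since the steps have length at most
    1.\<close>
  have dom: "norm (?D i t) \<le> C * indicator (cball 0 (R + 1)) t" for i t
  proof (cases "t \<in> cball 0 (R + 1)")
    case True
    have "\<exists>x\<in>{0<..<h i}. norm (v (t + h i *\<^sub>R b) - v (t + 0 *\<^sub>R b)) \<le> norm ((h i - 0) *\<^sub>R v' (t + x *\<^sub>R b))"
    proof (rule mvt_general[OF h(1)])
      show "continuous_on {0..h i} (\<lambda>s. v (t + s *\<^sub>R b))"
        using has_partial_line[OF d] has_vector_derivative_continuous
        by (intro continuous_at_imp_continuous_on) blast
    qed (rule has_partial_line[OF d, unfolded has_vector_derivative_def])
    then obtain x where "norm (v (t + h i *\<^sub>R b) - v t) \<le> h i * norm (v' (t + x *\<^sub>R b))"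
      using h(1)[of i] by auto
    also have "\<dots> \<le> h i * C" using bd(2) h(1)[of i] by (intro mult_left_mono) auto
    finally have "inverse (h i) * norm (v (t + h i *\<^sub>R b) - v t) \<le> inverse (h i) * (h i * C)"
      using h(1)[of i] by (intro mult_left_mono) auto
    then have "\<bar>inverse (h i)\<bar> * norm (v (t + h i *\<^sub>R b) - v t) \<le> C"
      using h(1)[of i] by (simp add: mult.assoc[symmetric])
    then show ?thesis using True unfolding norm_scaleR by simp
  next
    case False
    then have "R + 1 < norm t" by simp
    moreover have "norm t \<le> norm (t + h i *\<^sub>R b) + norm (h i *\<^sub>R b)"
      by (metis add_diff_cancel_right' norm_triangle_ineq4)
    ultimately have "R < norm t" "R < norm (t + h i *\<^sub>R b)" using h[of i] b by auto
    then show ?thesis using supp False by simp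
  qed
  have "(\<lambda>i. fourier (?D i) w) \<longlonglongrightarrow> fourier v' w"
    unfolding fourier_def
  proof (rule integral_dominated_convergence[where w="\<lambda>t. C * indicator (cball 0 (R + 1)) t"])
    show "integrable lborel (\<lambda>t::'a. C * indicator (cball 0 (R + 1)) t)"
      by (intro integrable_mult_right integrable_real_indicator) (auto simp: emeasure_lborel_cball_less_top)
    show "AE t in lborel. (\<lambda>i. ?D i t * cis (- (2 * pi * (w \<bullet> t)))) \<longlonglongrightarrow> v' t * cis (- (2 * pi * (w \<bullet> t)))"
      by (intro AE_I2 tendsto_mult lim tendsto_const)
    show "AE t in lborel. norm (?D i t * cis (- (2 * pi * (w \<bullet> t)))) \<le> C * indicator (cball 0 (R + 1)) t" for i
      by (intro AE_I2) (simp only: norm_mult norm_cis mult_1_right dom)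
  qed measurable
  moreover have "fourier (?D i) w = (cis (2 * pi * (w \<bullet> b) * h i) - 1) /\<^sub>R h i * fourier v w" for i
  proof -
    have "fourier (\<lambda>t. v (t - (- (h i *\<^sub>R b)))) w = cis (2 * pi * (w \<bullet> b) * h i) * fourier v w"
      unfolding fourier_translate by (simp add: mult_ac)
    moreover have "fourier (?D i) w = fourier (\<lambda>t. complex_of_real (inverse (h i)) * (v (t + h i *\<^sub>R b) + (-1) * v t)) w"
      by (simp add: scaleR_conv_of_real)
    moreover have "\<dots> = complex_of_real (inverse (h i)) * (fourier (\<lambda>t. v (t - (- (h i *\<^sub>R b)))) w + (-1) * fourier v w)"
      unfolding fourier_cmult using integrable_lborel_translate[OF int, of "h i *\<^sub>R b"] int
      by (subst fourier_add) (auto simp: fourier_cmult[of "-1", simplified])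
    ultimately show ?thesis by (simp add: scaleR_conv_of_real algebra_simps)
  qed
  moreover have "(\<lambda>i. (cis (2 * pi * (w \<bullet> b) * h i) - 1) /\<^sub>R h i * fourier v w)
      \<longlonglongrightarrow> (\<i> * complex_of_real (2 * pi * (w \<bullet> b))) * fourier v w"
  proof (intro tendsto_mult tendsto_const)
    let ?k = "2 * pi * (w \<bullet> b)"
    have "((\<lambda>s. cis (?k * s)) has_vector_derivative \<i> * complex_of_real ?k) (at 0)"
    proof -
      have "((\<lambda>z. exp (\<i> * complex_of_real ?k * z)) has_field_derivative \<i> * complex_of_real ?k) (at (complex_of_real 0))"
        by (auto intro!: derivative_eq_intros)
      from has_vector_derivative_real_field[OF this] show ?thesis
        by (simp add: cis_conv_exp mult.assoc)
    qed
    then have "((\<lambda>s. (cis (?k * s) - 1) /\<^sub>R s) \<longlongrightarrow> \<i> * complex_of_real ?k) (at 0)"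
      using has_vector_derivative_quotient by fastforce
    from filterlim_compose[OF this ha] 
    show "(\<lambda>i. (cis (?k * h i) - 1) /\<^sub>R h i) \<longlonglongrightarrow> \<i> * complex_of_real ?k" .
  qed
  ultimately show ?thesis by (simp only:) (rule LIMSEQ_unique)
qed

text \<open>The first argument \<open>x\<close> of \<open>v\<close> is a parameter: the bounds are uniform in it.\<close>

fun partials_le :: "nat \<Rightarrow> 'a::euclidean_space \<Rightarrow> ('x \<Rightarrow> 'a \<Rightarrow> real) \<Rightarrow> ('x \<Rightarrow> 'a \<Rightarrow> complex) \<Rightarrow> bool" where
  "partials_le 0 b A v \<longleftrightarrow> (\<exists>C. \<forall>x t. norm (v x t) \<le> C * A x t) \<and> (\<forall>x. v x \<in> borel_measurable borel)"
| "partials_le (Suc K) b A v \<longleftrightarrow> partials_le 0 b A v \<and> (\<exists>v'. (\<forall>x. has_partial b (v x) (v' x)) \<and> partials_le K b A v')"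

lemma partials_le_imp_0: "partials_le K b A v \<Longrightarrow> partials_le 0 b A v"
  by (cases K) auto

lemma partials_le_Suc_imp: "partials_le (Suc K) b A v \<Longrightarrow> partials_le K b A v"
proof (induction K arbitrary: v)
  case (Suc K)
  then show ?case by (metis partials_le.simps(2))
qed simp

lemma partials_le_0_mono:
  assumes "partials_le 0 b A v" "\<And>x t. 0 \<le> A x t" "\<And>x t. A x t \<le> c * B x t"
  shows "partials_le 0 b B v"
proof -
  obtain C where C: "\<And>x t. norm (v x t) \<le> C * A x t" using assms(1) by auto
  have "norm (v x t) \<le> \<bar>C\<bar> * c * B x t" for x t
  proof -
    have "norm (v x t) \<le> \<bar>C\<bar> * A x t"
      by (rule order_trans[OF C]) (use assms(2) in \<open>simp add: mult_right_mono\<close>)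
    also have "\<dots> \<le> \<bar>C\<bar> * (c * B x t)" using assms(3) by (intro mult_left_mono) auto
    finally show ?thesis by (simp add: mult.assoc)
  qed
  with assms(1) show ?thesis by auto
qed

lemma partials_le_mono:
  assumes "partials_le K b A v" "\<And>x t. 0 \<le> A x t" "\<And>x t. A x t \<le> c * B x t"
  shows "partials_le K b B v"
  using assms(1)
proof (induction K arbitrary: v)
  case 0
  show ?case by (rule partials_le_0_mono[where A=A and c=c]) (use 0 assms in auto)
next
  case (Suc K)
  have "partials_le 0 b B v"
    by (rule partials_le_0_mono[where A=A and c=c, OF partials_le_imp_0[OF Suc.prems]]) (use assms in auto)
  with Suc show ?case unfolding partials_le.simps(2) by blast
qed

lemma partials_le_0_add:
  assumes "partials_le 0 b A u" "partials_le 0 b A v"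
  shows "partials_le 0 b A (\<lambda>x t. u x t + v x t)"
proof -
  obtain C D where C: "\<And>x t. norm (u x t) \<le> C * A x t" "\<And>x t. norm (v x t) \<le> D * A x t"
    using assms by auto
  have "norm (u x t + v x t) \<le> (C + D) * A x t" for x t
    using norm_triangle_ineq[of "u x t" "v x t"] C(1)[of x t] C(2)[of x t] by (simp add: ring_distribs)
  moreover have "(\<lambda>t. u x t + v x t) \<in> borel_measurable borel" for x
    using assms by (intro borel_measurable_add) auto
  ultimately show ?thesis unfolding partials_le.simps(1) by blast
qed

lemma partials_le_add:
  assumes "partials_le K b A u" "partials_le K b A v"
  shows "partials_le K b A (\<lambda>x t. u x t + v x t)"
  using assms
proof (induction K arbitrary: u v)
  case 0
  then show ?case by (rule partials_le_0_add)
next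
  case (Suc K)
  obtain u' v' where uv: "\<And>x. has_partial b (u x) (u' x)" "partials_le K b A u'"
      "\<And>x. has_partial b (v x) (v' x)" "partials_le K b A v'"
    using Suc.prems by auto
  have "has_partial b (\<lambda>t. u x t + v x t) (\<lambda>t. u' x t + v' x t)" for x
    using uv(1,3)[of x] unfolding has_partial_def by (auto intro: has_vector_derivative_add)
  moreover have "partials_le 0 b A (\<lambda>x t. u x t + v x t)"
    by (intro partials_le_0_add partials_le_imp_0[OF Suc.prems(1)] partials_le_imp_0[OF Suc.prems(2)])
  ultimately show ?case using Suc.IH[OF uv(2,4)] unfolding partials_le.simps(2)
    by (intro conjI exI[of _ "\<lambda>x t. u' x t + v' x t"]) auto
qed

lemma partials_le_0_mult:
  assumes "partials_le 0 b A u" "partials_le 0 b B v" "\<And>x t. 0 \<le> A x t"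
  shows "partials_le 0 b (\<lambda>x t. A x t * B x t) (\<lambda>x t. u x t * v x t)"
proof -
  obtain C D where C: "\<And>x t. norm (u x t) \<le> C * A x t" "\<And>x t. norm (v x t) \<le> D * B x t"
    using assms by auto
  have "norm (u x t * v x t) \<le> (C * D) * (A x t * B x t)" for x t
  proof -
    have "norm (u x t * v x t) \<le> (C * A x t) * (D * B x t)"
      unfolding norm_mult
      by (rule mult_mono[OF C]) (auto intro: order_trans[OF norm_ge_zero C(1)])
    then show ?thesis by (simp add: mult_ac)
  qed
  moreover have "(\<lambda>t. u x t * v x t) \<in> borel_measurable borel" for x
    using assms by (intro borel_measurable_times) auto
  ultimately show ?thesis unfolding partials_le.simps(1) by blast
qed

text \<open>By the product rule every derivative of the product is a sum of products of one
  derivative of each factor, and each of these lies under the same envelope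
  \<open>A * B\<close>.\<close>

lemma partials_le_mult:
  assumes "partials_le K b A u" "partials_le K b B v" "\<And>x t. 0 \<le> A x t"
  shows "partials_le K b (\<lambda>x t. A x t * B x t) (\<lambda>x t. u x t * v x t)"
  using assms(1,2)
proof (induction K arbitrary: u v)
  case 0
  then show ?case using partials_le_0_mult assms(3) by blast
next
  case (Suc K)
  obtain u' v' where uv: "\<And>x. has_partial b (u x) (u' x)" "partials_le K b A u'"
      "\<And>x. has_partial b (v x) (v' x)" "partials_le K b B v'"
    using Suc.prems by auto
  have "has_partial b (\<lambda>t. u x t * v x t) (\<lambda>t. u x t * v' x t + u' x t * v x t)" for x
    unfolding has_partial_def
  proof
    fix t
    show "((\<lambda>s. u x (t + s *\<^sub>R b) * v x (t + s *\<^sub>R b)) has_vector_derivative u x t * v' x t + u' x t * v x t) (at 0)"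
      using has_vector_derivative_mult[OF uv(1)[of x, unfolded has_partial_def, rule_format, of t] uv(3)[of x, unfolded has_partial_def, rule_format, of t]]
      by simp
  qed
  moreover have "partials_le K b (\<lambda>x t. A x t * B x t) (\<lambda>x t. u x t * v' x t + u' x t * v x t)"
    by (rule partials_le_add[OF Suc.IH[OF partials_le_Suc_imp[OF Suc.prems(1)] uv(4)] Suc.IH[OF uv(2) partials_le_Suc_imp[OF Suc.prems(2)]]])
  moreover have "partials_le 0 b (\<lambda>x t. A x t * B x t) (\<lambda>x t. u x t * v x t)"
    by (intro partials_le_0_mult assms(3) partials_le_imp_0[OF Suc.prems(1)] partials_le_imp_0[OF Suc.prems(2)])
  ultimately show ?case unfolding partials_le.simps(2)
    by (intro conjI exI[of _ "\<lambda>x t. u x t * v' x t + u' x t * v x t"]) auto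
qed

lemma partials_le_const: "partials_le K b (\<lambda>(_::'x) _. 1) (\<lambda>(_::'x) _. c)"
proof (induction K arbitrary: c)
  case 0
  show ?case by (auto intro!: exI[of _ "norm c"])
next
  case (Suc K)
  have "has_partial b (\<lambda>_. c) (\<lambda>_. 0)" by (simp add: has_partial_def)
  moreover have "partials_le 0 b (\<lambda>(_::'x) _. 1) (\<lambda>(_::'x) _. c)" using partials_le_imp_0[OF Suc[of c]] by simp
  ultimately show ?case using Suc[of 0] unfolding partials_le.simps(2)
    by (intro conjI exI[of _ "\<lambda>(_::'x) _. 0"]) auto
qed

text \<open>The linear factor that appears when a radial bump is differentiated along
  \<open>b\<close>.\<close>

lemma partials_le_inner:
  assumes "norm b = 1"
  shows "partials_le K b (\<lambda>(_::'x) t. 1 + norm t) (\<lambda>(_::'x) t. complex_of_real (t \<bullet> b))"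
proof -
  have z: "partials_le 0 b (\<lambda>(_::'x) t. 1 + norm t) (\<lambda>(_::'x) t. complex_of_real (t \<bullet> b))"
  proof -
    have "norm (complex_of_real (t \<bullet> b)) \<le> 1 * (1 + norm t)" for t
      using Cauchy_Schwarz_ineq2[of t b] assms by simp
    then show ?thesis unfolding partials_le.simps(1) by (intro conjI allI exI[of _ 1]) auto
  qed
  show ?thesis
  proof (cases K)
    case 0
    with z show ?thesis by simp
  next
    case (Suc k)
    have "has_partial b (\<lambda>t. complex_of_real (t \<bullet> b)) (\<lambda>_. 1)"
      unfolding has_partial_def
    proof
      fix t
      have "b \<bullet> b = 1" using assms by (simp add: power2_norm_eq_inner[symmetric])
      then show "((\<lambda>s. complex_of_real ((t + s *\<^sub>R b) \<bullet> b)) has_vector_derivative 1) (at 0)"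
        by (auto intro!: derivative_eq_intros simp: has_vector_derivative_def inner_add_left scaleR_conv_of_real fun_eq_iff)
    qed
    moreover have "partials_le k b (\<lambda>(_::'x) t. 1 + norm t) (\<lambda>(_::'x) _. 1)"
      by (rule partials_le_mono[OF partials_le_const, where c=1]) auto
    ultimately show ?thesis using z unfolding Suc partials_le.simps(2)
      by (intro conjI exI[of _ "\<lambda>(_::'x) _. 1"]) auto
  qed
qed

section \<open>Bumps given by truncated polynomials\<close>

lemma has_field_derivative_pos_power:
  assumes "2 \<le> n"
  shows "((\<lambda>y::real. max 0 y ^ n) has_field_derivative real n * max 0 y ^ (n - 1)) (at y)"
proof -
  consider "y < 0" | "y = 0" | "0 < y" by linarith
  then show ?thesis
  proof cases
    case 1
    have "((\<lambda>y::real. 0) has_field_derivative 0) (at y)" by simp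
    moreover have "eventually (\<lambda>x. 0 = max 0 x ^ n) (nhds y)"
      using eventually_nhds_in_open[of "{..<0}" y] 1 assms by (auto elim!: eventually_mono)
    ultimately have "((\<lambda>y::real. max 0 y ^ n) has_field_derivative 0) (at y)"
      by (subst (asm) DERIV_cong_ev[OF refl _ refl]) auto
    then show ?thesis using 1 assms by (simp add: power_0_left)
  next
    case 2
    \<comment> \<open>At the corner the difference quotient is at most
      \<open>\<bar>h\<bar> ^ (n - 1)\<close>, which tends to 0 because
      \<open>n \<ge> 2\<close>.\<close>
    have "((\<lambda>h::real. max 0 h ^ n / h) \<longlongrightarrow> 0) (at 0)"
    proof (rule Lim_null_comparison)
      have "((\<lambda>h::real. \<bar>h\<bar> ^ (n - 1)) \<longlongrightarrow> \<bar>0\<bar> ^ (n - 1)) (at 0)"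
        by (intro tendsto_intros)
      moreover have "\<bar>0::real\<bar> ^ (n - 1) = 0" using assms by (simp add: power_0_left)
      ultimately show "((\<lambda>h::real. \<bar>h\<bar> ^ (n - 1)) \<longlongrightarrow> 0) (at 0)" by metis
      show "\<forall>\<^sub>F h::real in at 0. norm (max 0 h ^ n / h) \<le> \<bar>h\<bar> ^ (n - 1)"
      proof (rule eventually_mono[OF eventually_neq_at_within[of 0]])
        fix h :: real assume "h \<noteq> 0"
        moreover have "max 0 h ^ n \<le> \<bar>h\<bar> ^ n" by (rule power_mono) auto
        moreover have "\<bar>h\<bar> ^ n = \<bar>h\<bar> ^ (n - 1) * \<bar>h\<bar>" using assms by (simp flip: power_Suc2)
        ultimately show "norm (max 0 h ^ n / h) \<le> \<bar>h\<bar> ^ (n - 1)"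
          by (simp add: divide_le_eq)
      qed
    qed
    then show ?thesis using 2 assms by (simp add: DERIV_def power_0_left)
  next
    case 3
    have "((\<lambda>y::real. y ^ n) has_field_derivative real n * y ^ (n - 1)) (at y)"
      by (auto intro!: derivative_eq_intros)
    moreover have "eventually (\<lambda>x. x ^ n = max 0 x ^ n) (nhds y)"
      using eventually_nhds_in_open[of "{0<..}" y] 3 by (auto elim!: eventually_mono)
    ultimately have "((\<lambda>y::real. max 0 y ^ n) has_field_derivative real n * y ^ (n - 1)) (at y)"
      by (subst (asm) DERIV_cong_ev[OF refl _ refl]) auto
    then show ?thesis using 3 by simp
  qed
qed

text \<open>A bump of finite smoothness, polynomial inside the ball of radius \<open>r\<close>:
  differentiation lowers the exponent, and an exponent above twice the dimension leaves enough
  derivatives for an integrable transform.\<close>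

definition bump :: "real \<Rightarrow> nat \<Rightarrow> 'a::euclidean_space \<Rightarrow> real" where
  "bump r n t = max 0 (r\<^sup>2 - (norm t)\<^sup>2) ^ n"

lemma bump_continuous: "continuous_on S (bump r n)"
  unfolding bump_def by (intro continuous_intros)

lemma bump_nonneg: "0 \<le> bump r n t"
  by (simp add: bump_def)

lemma bump_eq_0: "r \<le> norm t \<Longrightarrow> 0 \<le> r \<Longrightarrow> 0 < n \<Longrightarrow> bump r n t = 0"
  by (simp add: bump_def max_def)

lemma bump_pos: "norm t < r \<Longrightarrow> 0 < bump r n t"
  unfolding bump_def using power_strict_mono[of "norm t" r 2] by (simp add: max_def)

lemma bump_le_1: "0 \<le> r \<Longrightarrow> r \<le> 1 \<Longrightarrow> bump r n t \<le> 1"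
  unfolding bump_def by (rule power_le_one) (auto simp: power_le_one intro: order_trans[of _ "r\<^sup>2"])

text \<open>Differentiating \<open>bump r n\<close> gives \<open>bump r (n - 1)\<close> times a
  linear factor, so each derivative consumes one exponent; \<open>K < n\<close> keeps the last
  exponent positive, and a positive exponent makes the function vanish off the ball.\<close>

lemma partials_le_bump:
  assumes r: "0 < r" and b: "norm b = 1" and n: "K < n"
  shows "partials_le K b (\<lambda>(_::'x) t. indicator (cball 0 r) t) (\<lambda>(_::'x) t. complex_of_real (bump r n t))"
  using n
proof (induction K arbitrary: n)
  have z: "partials_le 0 b (\<lambda>(_::'x) t. indicator (cball 0 r) t) (\<lambda>(_::'x) t. complex_of_real (bump r n t))" if "0 < n" for n
  proof -
    have "bump r n t \<le> (r\<^sup>2) ^ n * indicator (cball 0 r) t" for t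
    proof (cases "norm t \<le> r")
      case True
      then show ?thesis unfolding bump_def by (auto intro!: power_mono)
    next
      case False
      then show ?thesis using that r by (simp add: bump_eq_0)
    qed
    then have "norm (complex_of_real (bump r n t)) \<le> (r\<^sup>2) ^ n * indicator (cball 0 r) t" for t
      using bump_nonneg[of r n t] by (simp only: norm_of_real abs_of_nonneg)
    moreover have "(\<lambda>t. complex_of_real (bump r n t)) \<in> borel_measurable borel"
      by (intro borel_measurable_continuous_onI continuous_intros bump_continuous)
    ultimately show ?thesis unfolding partials_le.simps(1) by blast
  qed
  {
    case 0
    then show ?case by (rule z)
  next
    case (Suc K)
    have "has_partial b (\<lambda>t. complex_of_real (bump r n t))
       (\<lambda>t. complex_of_real (bump r (n - 1) t) * (complex_of_real (- 2 * real n) * complex_of_real (t \<bullet> b)))"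
      unfolding has_partial_def
    proof
      fix t
      have "((\<lambda>s. r\<^sup>2 - (t + s *\<^sub>R b) \<bullet> (t + s *\<^sub>R b)) has_field_derivative - 2 * (t \<bullet> b)) (at 0)"
        unfolding has_field_derivative_def
        by (auto intro!: derivative_eq_intros simp: fun_eq_iff inner_commute)
      moreover have "((\<lambda>y::real. max 0 y ^ n) has_field_derivative real n * max 0 (r\<^sup>2 - (norm t)\<^sup>2) ^ (n - 1)) (at (r\<^sup>2 - (t + 0 *\<^sub>R b) \<bullet> (t + 0 *\<^sub>R b)))"
        using has_field_derivative_pos_power[of n "r\<^sup>2 - (norm t)\<^sup>2"] Suc.prems by (simp add: power2_norm_eq_inner)
      ultimately have "((\<lambda>s. bump r n (t + s *\<^sub>R b)) has_field_derivative real n * bump r (n - 1) t * (- 2 * (t \<bullet> b))) (at 0)"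
        using DERIV_chain2 unfolding bump_def power2_norm_eq_inner by fast
      from has_vector_derivative_of_real[OF this, where 'a=complex]
      show "((\<lambda>s. complex_of_real (bump r n (t + s *\<^sub>R b))) has_vector_derivative
         complex_of_real (bump r (n - 1) t) * (complex_of_real (- 2 * real n) * complex_of_real (t \<bullet> b))) (at 0)"
        by (simp add: mult_ac)
    qed
    \<comment> \<open>On the ball the linear factor is bounded by \<open>1 + r\<close>, so the
      envelope remains a multiple of the indicator.\<close>
    moreover have "partials_le K b (\<lambda>(_::'x) t. indicator (cball 0 r) t)
       (\<lambda>(_::'x) t. complex_of_real (bump r (n - 1) t) * (complex_of_real (- 2 * real n) * complex_of_real (t \<bullet> b)))"
    proof (rule partials_le_mono[where c="1 + r"])
      show "partials_le K b (\<lambda>(_::'x) t. indicator (cball 0 r) t * (1 * (1 + norm t)))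
       (\<lambda>(_::'x) t. complex_of_real (bump r (n - 1) t) * (complex_of_real (- 2 * real n) * complex_of_real (t \<bullet> b)))"
        by (rule partials_le_mult[OF Suc.IH partials_le_mult[OF partials_le_const partials_le_inner[OF b]]]) (use Suc.prems in auto)
    qed (use r in \<open>auto simp: indicator_def\<close>)
    ultimately show ?case
      unfolding partials_le.simps(2) using z[of n] Suc.prems
      by (intro conjI exI[of _ "\<lambda>(_::'x) t. complex_of_real (bump r (n - 1) t) * (complex_of_real (- 2 * real n) * complex_of_real (t \<bullet> b))"]) auto
  }
qed

section \<open>Schwartz windows and their translates\<close>

lemma schwartz_bound:
  assumes "g \<in> schwartz_space" "set bs \<subseteq> Basis"
  obtains C where "\<And>x. norm (iterated_partial bs g x) \<le> C * inverse ((1 + norm x) ^ M)"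
proof -
  have "bounded (range (\<lambda>x. of_real ((1 + norm x) ^ M) * iterated_partial bs g x))"
    using assms unfolding schwartz_space_def by blast
  then obtain C where "\<forall>x. norm (of_real ((1 + norm x) ^ M) * iterated_partial bs g x) \<le> C"
    unfolding bounded_iff by auto
  then have C: "(1 + norm x) ^ M * norm (iterated_partial bs g x) \<le> C" for x
    by (simp add: norm_mult norm_power del: of_real_power of_real_add)
  have pos: "0 < (1 + norm x) ^ M" for x :: 'a
    using norm_ge_zero[of x] by (intro zero_less_power) linarith
  have "norm (iterated_partial bs g x) \<le> C * inverse ((1 + norm x) ^ M)" for x
    using C[of x] pos[of x] by (simp add: field_simps)
  then show ?thesis by (rule that)
qed

lemma schwartz_continuous:
  assumes "g \<in> schwartz_space" "set bs \<subseteq> Basis"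
  shows "continuous_on UNIV (iterated_partial bs g)"
  using assms unfolding schwartz_space_def by (blast intro: differentiable_imp_continuous_on)

text \<open>The multi-index \<open>bs\<close> is general because a derivative along \<open>b\<close>
  prepends \<open>b\<close> to it. The bounds depend on \<open>t - x\<close> only and are thus
  uniform in the translation \<open>x\<close>.\<close>

lemma partials_le_schwartz_shift:
  assumes g: "g \<in> schwartz_space" and b: "b \<in> Basis" and bs: "set bs \<subseteq> Basis"
  shows "partials_le K b (\<lambda>x t. inverse ((1 + norm (t - x)) ^ M)) (\<lambda>x t. cnj (iterated_partial bs g (t - x)))"
  using bs
proof (induction K arbitrary: bs)
  have z: "partials_le 0 b (\<lambda>x t. inverse ((1 + norm (t - x)) ^ M)) (\<lambda>x t. cnj (iterated_partial bs g (t - x)))"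
    if bs: "set bs \<subseteq> Basis" for bs
  proof -
    obtain C where "\<And>x. norm (iterated_partial bs g x) \<le> C * inverse ((1 + norm x) ^ M)"
      using schwartz_bound[OF g bs] by blast
    then have "norm (cnj (iterated_partial bs g (t - x))) \<le> C * inverse ((1 + norm (t - x)) ^ M)" for x t
      by simp
    moreover have "(\<lambda>t. cnj (iterated_partial bs g (t - x))) \<in> borel_measurable borel" for x
      by (intro borel_measurable_continuous_onI continuous_intros
            continuous_on_compose2[OF schwartz_continuous[OF g bs]]) auto
    ultimately show ?thesis unfolding partials_le.simps(1) by blast
  qed
  {
    case 0
    then show ?case by (rule z)
  next
    case (Suc K)
    have "has_partial b (\<lambda>t. cnj (iterated_partial bs g (t - x))) (\<lambda>t. cnj (iterated_partial (b # bs) g (t - x)))" for x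
      unfolding has_partial_def
    proof
      fix t
      let ?f = "iterated_partial bs g"
      have "?f differentiable (at (t - x))"
        using g Suc.prems unfolding schwartz_space_def by (auto simp: differentiable_on_def)
      then have d: "(?f has_derivative frechet_derivative ?f (at (t - x))) (at (t - x))"
        by (simp add: frechet_derivative_works)
      have l: "((\<lambda>s. t + s *\<^sub>R b - x) has_derivative (\<lambda>s. s *\<^sub>R b)) (at 0)"
        by (auto intro!: derivative_eq_intros)
      have "((\<lambda>s. ?f (t + s *\<^sub>R b - x)) has_derivative (\<lambda>s. frechet_derivative ?f (at (t - x)) (s *\<^sub>R b))) (at 0)"
        by (rule has_derivative_compose[OF l]) (use d in simp)
      then have "((\<lambda>s. ?f (t + s *\<^sub>R b - x)) has_vector_derivative frechet_derivative ?f (at (t - x)) b) (at 0)"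
        using linear.scaleR[OF has_derivative_linear[OF d]] by (simp add: has_vector_derivative_def)
      then show "((\<lambda>s. cnj (?f (t + s *\<^sub>R b - x))) has_vector_derivative cnj (iterated_partial (b # bs) g (t - x))) (at 0)"
        by (simp add: has_vector_derivative_cnj iterated_partial_def partial_deriv_def)
    qed
    moreover have "partials_le K b (\<lambda>x t. inverse ((1 + norm (t - x)) ^ M)) (\<lambda>x t. cnj (iterated_partial (b # bs) g (t - x)))"
      using Suc b by auto
    ultimately show ?case
      unfolding partials_le.simps(2) using z[OF Suc.prems]
      by (intro conjI exI[of _ "\<lambda>x t. cnj (iterated_partial (b # bs) g (t - x))"]) auto
  }
qed


text \<open>\<open>K\<close> derivatives are traded for \<open>K\<close> factors
  \<open>w \<bullet> b\<close>, and the last transform is bounded by an \<open>L^1\<close> norm over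
  the ball. The factor \<open>2 * pi \<ge> 1\<close> gained at each exchange is dropped.\<close>

lemma fourier_decay_power:
  assumes b: "norm b = 1" and v: "partials_le K b (\<lambda>x t. indicator (cball 0 R) t * a x) v" and a: "\<And>x. 0 \<le> a x"
  obtains C where "0 \<le> C" "\<And>x w. \<bar>w \<bullet> b\<bar> ^ K * norm (fourier (v x) w) \<le> C * a x"
  using v
proof (induction K arbitrary: v thesis)
  let ?A = "\<lambda>x t. indicator (cball 0 R) t * a x"
  have bd: "\<exists>C\<ge>0. \<forall>x t. norm (v x t) \<le> C * ?A x t" if n0: "partials_le 0 b ?A v" for v
  proof -
    obtain C where C: "\<And>x t. norm (v x t) \<le> C * ?A x t" using n0 unfolding partials_le.simps(1) by blast
    have "norm (v x t) \<le> \<bar>C\<bar> * ?A x t" for x t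
      by (rule order_trans[OF C]) (use a in \<open>simp add: mult_right_mono\<close>)
    then show ?thesis by (intro exI[of _ "\<bar>C\<bar>"]) auto
  qed
  {
    case 0
    obtain C where C: "0 \<le> C" "\<And>x t. norm (v x t) \<le> C * ?A x t" using bd[OF 0(2)] by blast
    let ?M = "measure lborel (cball (0::'a) R)"
    have "norm (fourier (v x) w) \<le> C * ?M * a x" for x w
    proof -
      have i: "integrable lborel (\<lambda>t::'a. (C * a x) * indicator (cball 0 R) t)"
        by (intro integrable_mult_right integrable_real_indicator) (auto simp: emeasure_lborel_cball_less_top)
      have "(LBINT t. norm (v x t)) \<le> (LBINT t. (C * a x) * indicator (cball (0::'a) R) t)"
      proof (rule Bochner_Integration.integral_mono[OF _ i])
        have m: "v x \<in> borel_measurable borel" using 0(2) by simp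
        show "integrable lborel (\<lambda>t. norm (v x t))"
          by (rule Bochner_Integration.integrable_bound[OF i])
             (use m C in \<open>auto simp: mult_ac intro!: AE_I2 order_trans[OF C(2)] abs_ge_self\<close>)
      qed (use C in \<open>simp add: mult_ac\<close>)
      then show ?thesis
        by (intro order_trans[OF norm_fourier_le]) (simp add: mult_ac)
    qed
    then show ?case using C(1) by (intro 0(1)[of "C * ?M"]) auto
  next
    case (Suc K)
    obtain v' where v': "\<And>x. has_partial b (v x) (v' x)" "partials_le K b ?A v'" using Suc.prems(2) by auto
    obtain C where C: "0 \<le> C" "\<And>x t. norm (v x t) \<le> C * ?A x t"
      using bd[OF partials_le_imp_0[OF Suc.prems(2)]] by blast
    obtain D where D: "0 \<le> D" "\<And>x t. norm (v' x t) \<le> D * ?A x t"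
      using bd[OF partials_le_imp_0[OF v'(2)]] by blast
    obtain E where E: "0 \<le> E" "\<And>x w. \<bar>w \<bullet> b\<bar> ^ K * norm (fourier (v' x) w) \<le> E * a x"
      using Suc.IH[OF _ v'(2)] by blast
    have "\<bar>w \<bullet> b\<bar> ^ Suc K * norm (fourier (v x) w) \<le> E * a x" for x w
    proof -
      have "fourier (v' x) w = \<i> * complex_of_real (2 * pi * (w \<bullet> b)) * fourier (v x) w"
      proof (rule fourier_partial[OF v'(1) b])
        show "v x \<in> borel_measurable borel" "v' x \<in> borel_measurable borel"
          using partials_le_imp_0[OF Suc.prems(2)] partials_le_imp_0[OF v'(2)] by auto
        have i: "indicator (cball 0 R) t \<le> (1::real)" for t :: 'a by (rule indicator_le_1)
        show "norm (v x t) \<le> C * (1 * a x)" for t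
          by (rule order_trans[OF C(2)]) (intro mult_left_mono mult_right_mono i a C)
        show "norm (v' x t) \<le> D * (1 * a x)" for t
          by (rule order_trans[OF D(2)]) (intro mult_left_mono mult_right_mono i a D)
        show "v x t = 0" if "t \<notin> cball 0 R" for t
          using C(2)[of x t] that by (simp add: indicator_def)
      qed
      then have n: "norm (fourier (v' x) w) = (2 * pi) * \<bar>w \<bullet> b\<bar> * norm (fourier (v x) w)"
        by (simp add: norm_mult abs_mult)
      have "1 * (\<bar>w \<bullet> b\<bar> ^ Suc K * norm (fourier (v x) w)) \<le> (2 * pi) * (\<bar>w \<bullet> b\<bar> ^ Suc K * norm (fourier (v x) w))"
        using pi_ge_two by (intro mult_right_mono) auto
      also have "\<dots> = \<bar>w \<bullet> b\<bar> ^ K * norm (fourier (v' x) w)" unfolding n by (simp add: mult_ac)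
      also have "\<dots> \<le> E * a x" by (rule E)
      finally show ?thesis by simp
    qed
    then show ?case by (rule Suc.prems(1)[OF E(1)])
  }
qed

section \<open>Integrable polynomial weights in frequency and space\<close>

definition poly_weight :: "'a::euclidean_space \<Rightarrow> real" where
  "poly_weight w = (\<Prod>b\<in>Basis. inverse (1 + (w \<bullet> b)\<^sup>2))"

lemma one_plus_square_pos: "0 < 1 + (x::real)\<^sup>2"
  using zero_le_power2[of x] by linarith

lemma poly_weight_pos: "0 < poly_weight w"
  unfolding poly_weight_def by (intro prod_pos) (simp add: one_plus_square_pos)

lemma poly_weight_measurable [measurable]: "poly_weight \<in> borel_measurable borel"
  unfolding poly_weight_def by measurable

lemma poly_weight_le_1: "poly_weight w \<le> 1"
  unfolding poly_weight_def
  by (rule prod_le_1) (auto intro!: inverse_le_1_iff[THEN iffD2] simp: one_plus_square_pos less_imp_le)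

text \<open>The product form splits the integral into one-dimensional integrals of
  \<open>1 / (1 + x^2)\<close>.\<close>

lemma poly_weight_nn_integral: "(\<integral>\<^sup>+w. ennreal (poly_weight (w::'a::euclidean_space)) \<partial>lborel) < \<infinity>"
proof -
  have 1: "(\<integral>\<^sup>+x. ennreal (inverse (1 + (x::real)\<^sup>2)) \<partial>lborel) < \<top>"
  proof -
    have "integrable lborel (\<lambda>x::real. inverse (1 + x\<^sup>2))"
      using integrable_inverse_1_plus_square by (simp add: set_integrable_def)
    then have "(\<integral>\<^sup>+x. ennreal (norm (inverse (1 + (x::real)\<^sup>2))) \<partial>lborel) < \<infinity>"
      unfolding integrable_iff_bounded by blast
    then show ?thesis by (simp add: one_plus_square_pos less_imp_le)
  qed
  have "(\<integral>\<^sup>+w. ennreal (poly_weight (w::'a)) \<partial>lborel) = (\<integral>\<^sup>+w. (\<Prod>b\<in>Basis. ennreal (inverse (1 + (w \<bullet> b)\<^sup>2))) \<partial>(lborel::'a measure))"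
    unfolding poly_weight_def by (subst prod_ennreal) (auto simp: one_plus_square_pos less_imp_le)
  also have "\<dots> = (\<Prod>b\<in>(Basis::'a set). (\<integral>\<^sup>+x. ennreal (inverse (1 + x\<^sup>2)) \<partial>lborel))"
    by (rule nn_integral_lborel_prod[of "\<lambda>_ x. ennreal (inverse (1 + x\<^sup>2))"]) auto
  also have "\<dots> < \<top>"
    using 1 by (simp add: power_less_top_ennreal)
  finally show ?thesis by simp
qed

text \<open>With \<open>m\<close> the largest coordinate modulus, the product of the
  \<open>1 + (w \<bullet> b)^2\<close> is at most \<open>(1 + m^2)^d\<close>. For
  \<open>m \<le> 1\<close> this is at most \<open>2^d\<close>, otherwise at most
  \<open>2^d * m^(2 d)\<close>, where the decay in the direction of the largest coordinate
  applies.\<close>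

lemma le_poly_weight:
  fixes w :: "'a::euclidean_space"
  assumes y: "0 \<le> y" "y \<le> D" and d: "\<And>b. b \<in> Basis \<Longrightarrow> \<bar>w \<bullet> b\<bar> ^ (2 * DIM('a)) * y \<le> D"
  shows "y \<le> 2 ^ DIM('a) * D * poly_weight w"
proof -
  define m where "m = Max ((\<lambda>b. \<bar>w \<bullet> b\<bar>) ` Basis)"
  have fin: "finite ((\<lambda>b. \<bar>w \<bullet> b\<bar>) ` (Basis::'a set))" by simp
  have ne: "(\<lambda>b. \<bar>w \<bullet> b\<bar>) ` (Basis::'a set) \<noteq> {}" by simp
  have "m \<in> (\<lambda>b. \<bar>w \<bullet> b\<bar>) ` (Basis::'a set)"
    unfolding m_def by (rule Max_in[OF fin ne])
  then obtain b0 where b0: "b0 \<in> Basis" "m = \<bar>w \<bullet> b0\<bar>"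
    by (rule imageE)
  have le: "\<bar>w \<bullet> b\<bar> \<le> m" if "b \<in> Basis" for b
    unfolding m_def using that by (intro Max_ge) auto
  have m0: "0 \<le> m" using b0 by simp
  have D0: "0 \<le> D" using y by linarith
  have "y * (\<Prod>b\<in>(Basis::'a set). 1 + (w \<bullet> b)\<^sup>2) \<le> y * (1 + m\<^sup>2) ^ DIM('a)"
  proof (intro mult_left_mono y)
    have "(\<Prod>b\<in>(Basis::'a set). 1 + (w \<bullet> b)\<^sup>2) \<le> (\<Prod>b\<in>(Basis::'a set). 1 + m\<^sup>2)"
    proof (rule prod_mono)
      fix b :: 'a assume "b \<in> Basis"
      then have "\<bar>w \<bullet> b\<bar>\<^sup>2 \<le> m\<^sup>2" using le by (intro power_mono) auto
      then show "0 \<le> 1 + (w \<bullet> b)\<^sup>2 \<and> 1 + (w \<bullet> b)\<^sup>2 \<le> 1 + m\<^sup>2"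
        using one_plus_square_pos[of "w \<bullet> b"] by auto
    qed
    then show "(\<Prod>b\<in>(Basis::'a set). 1 + (w \<bullet> b)\<^sup>2) \<le> (1 + m\<^sup>2) ^ DIM('a)" by simp
  qed
  also have "\<dots> \<le> 2 ^ DIM('a) * D"
  proof (cases "m \<le> 1")
    case True
    then have "(1 + m\<^sup>2) ^ DIM('a) \<le> 2 ^ DIM('a)"
      using m0 power_le_one[of m 2] by (intro power_mono) auto
    then have "y * (1 + m\<^sup>2) ^ DIM('a) \<le> D * 2 ^ DIM('a)"
      using y D0 by (intro mult_mono) auto
    then show ?thesis by (simp add: mult.commute)
  next
    case False
    then have "1 \<le> m\<^sup>2" using power_mono[of 1 m 2] by simp
    then have "(1 + m\<^sup>2) ^ DIM('a) \<le> (2 * m\<^sup>2) ^ DIM('a)"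
      by (intro power_mono) auto
    then have "y * (1 + m\<^sup>2) ^ DIM('a) \<le> y * (2 * m\<^sup>2) ^ DIM('a)"
      using y by (intro mult_left_mono) auto
    also have "\<dots> = 2 ^ DIM('a) * (m ^ (2 * DIM('a)) * y)"
      unfolding power_mult_distrib power_mult[of m 2] by simp
    also have "\<dots> \<le> 2 ^ DIM('a) * D"
      using d[OF b0(1)] b0(2) by (intro mult_left_mono) auto
    finally show ?thesis .
  qed
  finally have "y * (\<Prod>b\<in>(Basis::'a set). 1 + (w \<bullet> b)\<^sup>2) * poly_weight w \<le> 2 ^ DIM('a) * D * poly_weight w"
    using poly_weight_pos[of w] by (intro mult_right_mono) auto
  moreover have "(\<Prod>b\<in>(Basis::'a set). 1 + (w \<bullet> b)\<^sup>2) * poly_weight w = 1"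
    unfolding poly_weight_def prod.distrib[symmetric]
    by (rule prod.neutral) (metis one_plus_square_pos order_less_irrefl right_inverse)
  ultimately show ?thesis by (simp add: mult.assoc)
qed

lemma fourier_decay:
  fixes v :: "'x \<Rightarrow> 'a::euclidean_space \<Rightarrow> complex"
  assumes v: "\<And>b. b \<in> Basis \<Longrightarrow> partials_le (2 * DIM('a)) b (\<lambda>x t. indicator (cball 0 R) t * a x) v"
    and a: "\<And>x. 0 \<le> a x"
  obtains C where "0 \<le> C" "\<And>x w. norm (fourier (v x) w) \<le> C * a x * poly_weight w"
proof -
  have nb: "norm b = 1" if "b \<in> Basis" for b :: 'a using that by simp
  have "\<exists>C\<ge>0. \<forall>x w. \<bar>w \<bullet> b\<bar> ^ (2 * DIM('a)) * norm (fourier (v x) w) \<le> C * a x" if "b \<in> Basis" for b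
    using fourier_decay_power[OF nb[OF that] v[OF that] a] by metis
  then obtain C where C: "\<And>b. b \<in> Basis \<Longrightarrow> 0 \<le> C b"
      "\<And>b x w. b \<in> Basis \<Longrightarrow> \<bar>w \<bullet> b\<bar> ^ (2 * DIM('a)) * norm (fourier (v x) w) \<le> C b * a x"
    by metis
  obtain b0 :: 'a where b0: "b0 \<in> Basis" using nonempty_Basis by blast
  \<comment> \<open>The order-zero estimate is for frequencies with small coordinates, where the
    powers \<open>\<bar>w \<bullet> b\<bar> ^ (2 * DIM('a))\<close> give no information.\<close>
  have n0: "partials_le 0 b0 (\<lambda>x t. indicator (cball 0 R) t * a x) v" using partials_le_imp_0[OF v[OF b0]] .
  obtain C0 where C0: "0 \<le> C0" "\<And>x w. \<bar>w \<bullet> b0\<bar> ^ 0 * norm (fourier (v x) w) \<le> C0 * a x"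
  proof (rule fourier_decay_power[OF nb[OF b0] n0 a])
    fix C assume "0 \<le> C" "\<And>x w. \<bar>w \<bullet> b0\<bar> ^ 0 * norm (fourier (v x) w) \<le> C * a x"
    then show thesis by (rule that)
  qed
  define D where "D = C0 + (\<Sum>b\<in>Basis. C b)"
  have "C b \<le> (\<Sum>b\<in>Basis. C b)" if "b \<in> Basis" for b
    using C(1) that by (intro member_le_sum) auto
  then have D: "C0 \<le> D" "\<And>b. b \<in> Basis \<Longrightarrow> C b \<le> D"
    using C0(1) C(1) by (auto simp: D_def sum_nonneg add_increasing)
  show ?thesis
  proof (rule that[of "2 ^ DIM('a) * D"])
    show "0 \<le> 2 ^ DIM('a) * D" using D C0 by simp
    show "norm (fourier (v x) w) \<le> 2 ^ DIM('a) * D * a x * poly_weight w" for x w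
      using le_poly_weight[of "norm (fourier (v x) w)" "D * a x" w]
        order_trans[OF C0(2)[of w x] mult_right_mono[OF D(1) a[of x]]]
        order_trans[OF C(2) mult_right_mono[OF D(2) a[of x]]]
      by (simp add: mult.assoc)
  qed
qed

text \<open>The weight for the position \<open>x\<close> of the window. It is radial, unlike
  \<open>poly_weight\<close>, so that it behaves well under translation; it is integrable by
  comparison with \<open>poly_weight\<close>.\<close>

definition weight :: "'a::euclidean_space \<Rightarrow> real" where
  "weight x = inverse ((1 + norm x) ^ (2 * DIM('a)))"

lemma weight_pos: "0 < weight x"
  unfolding weight_def by (intro positive_imp_inverse_positive zero_less_power) (simp add: add_pos_nonneg)

lemma weight_measurable [measurable]: "weight \<in> borel_measurable borel"
  unfolding weight_def by measurable

lemma weight_le_1: "weight x \<le> 1"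
  unfolding weight_def by (intro inverse_le_1_iff[THEN iffD2] disjI2 one_le_power) simp

lemma weight_le_poly_weight: "weight x \<le> poly_weight (x::'a::euclidean_space)"
proof -
  have "(\<Prod>b\<in>(Basis::'a set). 1 + (x \<bullet> b)\<^sup>2) \<le> (\<Prod>b\<in>(Basis::'a set). (1 + norm x)\<^sup>2)"
  proof (rule prod_mono)
    fix b :: 'a assume "b \<in> Basis"
    then have "\<bar>x \<bullet> b\<bar>\<^sup>2 \<le> (norm x)\<^sup>2" using Basis_le_norm by (intro power_mono) auto
    then show "0 \<le> 1 + (x \<bullet> b)\<^sup>2 \<and> 1 + (x \<bullet> b)\<^sup>2 \<le> (1 + norm x)\<^sup>2"
      using one_plus_square_pos[of "x \<bullet> b"] by (auto simp: power2_sum intro: add_increasing2)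
  qed
  also have "\<dots> = (1 + norm x) ^ (2 * DIM('a))" by (simp add: power_mult)
  finally have "inverse ((1 + norm x) ^ (2 * DIM('a))) \<le> inverse (\<Prod>b\<in>(Basis::'a set). 1 + (x \<bullet> b)\<^sup>2)"
    by (intro le_imp_inverse_le prod_pos) (auto simp: one_plus_square_pos)
  then show ?thesis
    using prod_inversef[of "\<lambda>b. 1 + (x \<bullet> b)\<^sup>2" Basis] by (simp add: weight_def poly_weight_def o_def)
qed

lemma weight_nn_integral: "(\<integral>\<^sup>+x. ennreal (weight (x::'a::euclidean_space)) \<partial>lborel) < \<infinity>"
  by (rule order.strict_trans1[OF nn_integral_mono poly_weight_nn_integral])
     (auto intro: ennreal_leI weight_le_poly_weight)

text \<open>Peetre's inequality \<open>1 + norm x \<le> (1 + norm (x - y)) * (1 + norm y)\<close>,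
  raised to the power \<open>2 * DIM('a)\<close>.\<close>

lemma weight_shift: "weight (x - y) \<le> (1 + norm y) ^ (2 * DIM('a)) * weight (x::'a::euclidean_space)"
proof -
  have "0 \<le> norm (x - y) * norm y" by (rule mult_nonneg_nonneg) auto
  moreover have "norm x \<le> norm (x - y) + norm y"
    using norm_triangle_ineq[of "x - y" y] by simp
  ultimately have "1 + norm x \<le> (1 + norm (x - y)) * (1 + norm y)"
    unfolding ring_distribs by linarith
  then have "(1 + norm x) ^ (2 * DIM('a)) \<le> (1 + norm (x - y)) ^ (2 * DIM('a)) * (1 + norm y) ^ (2 * DIM('a))"
    unfolding power_mult_distrib[symmetric] by (intro power_mono) auto
  moreover have "0 < (1 + norm (x - y)) ^ (2 * DIM('a))" "0 < (1 + norm x) ^ (2 * DIM('a))"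
    by (auto intro!: zero_less_power simp: add_pos_nonneg)
  ultimately show ?thesis
    unfolding weight_def by (simp add: field_simps)
qed

text \<open>On the support of the bump \<open>norm t \<le> r\<close>, so
  \<open>weight (t - x)\<close> is at most a constant times \<open>weight x\<close>. The decay in
  \<open>x\<close> therefore factors out of the decay in \<open>w\<close>, and a product majorant
  treats both orders of the mixed norm alike.\<close>

lemma stft_bump_decay:
  fixes g :: "'a::euclidean_space \<Rightarrow> complex"
  assumes g: "g \<in> schwartz_space" and r: "0 < r" and n: "2 * DIM('a) < n"
  obtains C where "0 \<le> C"
    "\<And>x w. norm (fourier (\<lambda>t. bump r n t * cnj (g (t - x))) w) \<le> C * weight x * poly_weight w"
proof (rule fourier_decay[of r "weight" "\<lambda>x t. complex_of_real (bump r n t) * cnj (g (t - x))"])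
  fix b :: 'a assume b: "b \<in> Basis"
  show "partials_le (2 * DIM('a)) b (\<lambda>x t. indicator (cball 0 r) t * weight x) (\<lambda>x t. complex_of_real (bump r n t) * cnj (g (t - x)))"
  proof (rule partials_le_mono[where c="(1 + r) ^ (2 * DIM('a))"])
    show "partials_le (2 * DIM('a)) b (\<lambda>x t. indicator (cball 0 r) t * weight (t - x)) (\<lambda>x t. complex_of_real (bump r n t) * cnj (g (t - x)))"
      using b partials_le_schwartz_shift[OF g b, of "[]" "2 * DIM('a)" "2 * DIM('a)"]
      by (intro partials_le_mult partials_le_bump r n) (auto simp: weight_def iterated_partial_def)
    show "0 \<le> indicator (cball 0 r) t * weight (t - x)" for x t :: 'a
      using weight_pos[of "t - x"] by simp
    show "indicator (cball 0 r) t * weight (t - x) \<le> (1 + r) ^ (2 * DIM('a)) * (indicator (cball 0 r) t * weight x)" for x t :: 'a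
    proof (cases "norm t \<le> r")
      case True
      have "weight (t - x) = weight (x - t)" by (simp add: weight_def norm_minus_commute)
      also have "\<dots> \<le> (1 + norm t) ^ (2 * DIM('a)) * weight x" by (rule weight_shift)
      also have "\<dots> \<le> (1 + r) ^ (2 * DIM('a)) * weight x"
        using True weight_pos[of x] by (intro mult_right_mono power_mono) auto
      finally show ?thesis using True by simp
    qed simp
  qed
qed (use that in \<open>simp_all add: weight_pos less_imp_le\<close>)

lemma fourier_bump_decay:
  assumes r: "0 < r" and n: "2 * DIM('a) < n"
  obtains C where "0 \<le> C"
    "\<And>w. norm (fourier (\<lambda>t::'a::euclidean_space. complex_of_real (bump r n t)) w) \<le> C * poly_weight w"
proof (rule fourier_decay[of r "\<lambda>_::unit. 1" "\<lambda>_ t::'a. complex_of_real (bump r n t)"])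
  fix b :: 'a assume "b \<in> Basis"
  then show "partials_le (2 * DIM('a)) b (\<lambda>(_::unit) t. indicator (cball 0 r) t * 1) (\<lambda>_ t. complex_of_real (bump r n t))"
    using partials_le_bump[OF r _ n, of b] by simp
qed (use that in auto)

subsection \<open>Fourier inversion\<close>

lemma fourier_cnj: "fourier (\<lambda>w. cnj (f w)) t = cnj (fourier f (- t))"
  unfolding fourier_def by (subst Bochner_Integration.integral_cnj[symmetric]) (simp add: cis_cnj)

lemma fourier_measurable [measurable]:
  assumes "v \<in> borel_measurable borel" shows "fourier v \<in> borel_measurable borel"
proof -
  note assms[measurable]
  have "(\<lambda>w. LBINT t. v t * cis (- (2 * pi * (w \<bullet> t)))) \<in> borel_measurable lborel"
    by measurable
  then show ?thesis unfolding fourier_def by simp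
qed

text \<open>The hypothesis of Fubini's theorem in the form in which the exchanges of Bochner
  integrals below meet it: a product majorant.\<close>

lemma integrable_pair_dominated:
  fixes f :: "'a::euclidean_space \<Rightarrow> 'c::euclidean_space \<Rightarrow> complex"
  assumes m: "(\<lambda>(x, y). f x y) \<in> borel_measurable (borel \<Otimes>\<^sub>M borel)"
    and le: "\<And>x y. norm (f x y) \<le> a x * b y" and a: "integrable lborel a" and b: "integrable lborel b"
  shows "integrable (lborel \<Otimes>\<^sub>M lborel) (\<lambda>(x, y). f x y)"
proof -
  have inner: "integrable lborel (f x)" for x
  proof (rule Bochner_Integration.integrable_bound[OF integrable_mult_right[OF b, of "a x"]])
    show "f x \<in> borel_measurable lborel"
      using measurable_compose[of "\<lambda>y. (x, y)" borel "borel \<Otimes>\<^sub>M borel", OF _ m] by simp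
  qed (intro AE_I2 order_trans[OF le], simp)
  show ?thesis
  proof (rule lborel_pair.Fubini_integrable)
    show m': "(\<lambda>(x, y). f x y) \<in> borel_measurable (lborel \<Otimes>\<^sub>M lborel)"
      using m by (simp cong: measurable_cong_sets sets_pair_measure_cong)
    show "integrable lborel (\<lambda>x. LBINT y. norm (case (x, y) of (x, y) \<Rightarrow> f x y))"
    proof (rule Bochner_Integration.integrable_bound)
      show "integrable lborel (\<lambda>x. a x * (LBINT y. b y))" using a by simp
      have "(LBINT y. norm (f x y)) \<le> (LBINT y. a x * b y)" for x
        by (rule Bochner_Integration.integral_mono[OF integrable_norm[OF inner] integrable_mult_right[OF b] le])
      then show "AE x in lborel. norm (LBINT y. norm (case (x, y) of (x, y) \<Rightarrow> f x y)) \<le> norm (a x * (LBINT y. b y))"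
        by (intro AE_I2) (simp add: order_trans[OF _ abs_ge_self])
      show "(\<lambda>x. LBINT y. norm (case (x, y) of (x, y) \<Rightarrow> f x y)) \<in> borel_measurable lborel"
        using m' by (intro lborel.borel_measurable_lebesgue_integral) (simp add: case_prod_unfold)
    qed
  qed (use inner in simp)
qed

lemma fourier_multiplication:
  fixes a b :: "'a::euclidean_space \<Rightarrow> complex"
  assumes a: "integrable lborel a" and b: "integrable lborel b"
  shows "(LBINT t. a t * fourier b t) = (LBINT w. b w * fourier a w)"
proof -
  have [measurable]: "a \<in> borel_measurable borel" "b \<in> borel_measurable borel"
    using borel_measurable_integrable[OF a] borel_measurable_integrable[OF b] by auto
  let ?f = "\<lambda>(t::'a, w::'a). a t * b w * cis (- (2 * pi * (t \<bullet> w)))"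
  have int: "integrable (lborel \<Otimes>\<^sub>M lborel) ?f"
    by (rule integrable_pair_dominated[OF _ _ integrable_norm[OF a] integrable_norm[OF b]])
       (simp_all add: norm_mult, measurable)
  have "(LBINT t. a t * fourier b t) = (LBINT t. LBINT w. a t * b w * cis (- (2 * pi * (t \<bullet> w))))"
    unfolding fourier_def by (simp flip: integral_mult_right_zero add: mult.assoc)
  also have "\<dots> = (LBINT w. LBINT t. a t * b w * cis (- (2 * pi * (t \<bullet> w))))"
    using lborel_pair.Fubini_integral[of "\<lambda>t w. a t * b w * cis (- (2 * pi * (t \<bullet> w)))"] int
    by (simp add: case_prod_unfold)
  also have "\<dots> = (LBINT w. b w * fourier a w)"
    unfolding fourier_def by (simp flip: integral_mult_right_zero add: mult_ac inner_commute)
  finally show ?thesis .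
qed

section \<open>Gaussians and their transforms\<close>

lemma integral_lborel_affine:
  fixes f :: "'a::euclidean_space \<Rightarrow> 'b::{banach, second_countable_topology}"
  assumes c: "c \<noteq> 0" and [measurable]: "f \<in> borel_measurable borel"
  shows "(LBINT x. f x) = \<bar>c\<bar> ^ DIM('a) *\<^sub>R (LBINT x. f (t + c *\<^sub>R x))"
proof -
  have "(LBINT x. f x) = (\<integral>x. f x \<partial>density (distr lborel borel (\<lambda>x::'a. t + c *\<^sub>R x)) (\<lambda>_. \<bar>c\<bar> ^ DIM('a)))"
    by (subst lborel_affine[OF c, of t]) simp
  also have "\<dots> = (\<integral>x. \<bar>c\<bar> ^ DIM('a) *\<^sub>R f x \<partial>distr lborel borel (\<lambda>x::'a. t + c *\<^sub>R x))"
    by (subst integral_density) auto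
  also have "\<dots> = (LBINT x. \<bar>c\<bar> ^ DIM('a) *\<^sub>R f (t + c *\<^sub>R x))"
    by (subst integral_distr) auto
  finally show ?thesis by simp
qed

lemma integral_lborel_prod:
  fixes f :: "'a::euclidean_space \<Rightarrow> real \<Rightarrow> complex"
  assumes "\<And>b. b \<in> Basis \<Longrightarrow> integrable lborel (f b)"
  shows "(\<integral>x. (\<Prod>b\<in>Basis. f b (x \<bullet> b)) \<partial>(lborel :: 'a measure)) = (\<Prod>b\<in>Basis. LBINT s. f b s)"
proof -
  interpret product_sigma_finite "\<lambda>_::'a. lborel :: real measure" ..
  have [measurable]: "\<And>b. b \<in> Basis \<Longrightarrow> f b \<in> borel_measurable borel"
    using assms borel_measurable_integrable by fastforce
  have "(\<integral>x. (\<Prod>b\<in>Basis. f b (x \<bullet> b)) \<partial>(lborel :: 'a measure))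
     = (\<integral>x. (\<Prod>b\<in>Basis. f b (x \<bullet> b)) \<partial>distr (\<Pi>\<^sub>M b\<in>(Basis :: 'a set). lborel) borel (\<lambda>f. \<Sum>b\<in>Basis. f b *\<^sub>R b))"
    by (subst lborel_eq) simp
  also have "\<dots> = (\<integral>y. (\<Prod>b\<in>Basis. f b ((\<Sum>b\<in>Basis. y b *\<^sub>R b) \<bullet> b)) \<partial>(\<Pi>\<^sub>M b\<in>(Basis :: 'a set). lborel))"
    by (subst integral_distr) auto
  also have "\<dots> = (\<integral>y. (\<Prod>b\<in>Basis. f b (y b)) \<partial>(\<Pi>\<^sub>M b\<in>(Basis :: 'a set). lborel))"
    by (intro Bochner_Integration.integral_cong prod.cong refl) simp
  also have "\<dots> = (\<Prod>b\<in>Basis. LBINT s. f b s)"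
    by (rule product_integral_prod) (use assms in auto)
  finally show ?thesis .
qed

text \<open>In this scaling it is a multiple of a product of standard normal densities, so the
  characteristic function of the normal distribution yields its transform.\<close>

definition gauss :: "'a::euclidean_space \<Rightarrow> real" where
  "gauss x = exp (- (norm x)\<^sup>2 / 2)"

lemma gauss_measurable [measurable]: "gauss \<in> borel_measurable borel"
  unfolding gauss_def by measurable

lemma std_normal_fourier:
  "(LBINT s. complex_of_real (std_normal_density s) * cis (s * z)) = complex_of_real (exp (- z\<^sup>2 / 2))"
proof -
  have "char std_normal_distribution z = (LBINT s. std_normal_density s *\<^sub>R iexp (z * s))"
    unfolding char_def by (subst integral_density) (auto simp: normal_density_nonneg)
  then show ?thesis
    unfolding char_std_normal_distribution
    by (simp add: cis_conv_exp scaleR_conv_of_real mult.commute)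
qed

lemma gauss_eq_prod:
  "gauss x = sqrt (2 * pi) ^ DIM('a) * (\<Prod>b\<in>Basis. std_normal_density (x \<bullet> b))" for x :: "'a::euclidean_space"
proof -
  have "(norm x)\<^sup>2 = (\<Sum>b\<in>Basis. (x \<bullet> b)\<^sup>2)"
    unfolding power2_norm_eq_inner by (subst euclidean_inner) (simp add: power2_eq_square)
  then have "gauss x = (\<Prod>b\<in>Basis. exp (- (x \<bullet> b)\<^sup>2 / 2))"
    by (simp add: gauss_def exp_sum[symmetric] sum_negf sum_divide_distrib)
  also have "\<dots> = (\<Prod>b\<in>(Basis::'a set). sqrt (2 * pi) * std_normal_density (x \<bullet> b))"
    by (intro prod.cong refl) (simp add: std_normal_density_def)
  finally show ?thesis by (simp add: prod.distrib)
qed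

lemma gauss_integral_cis:
  "(LBINT x. complex_of_real (gauss x) * cis (x \<bullet> z)) = sqrt (2 * pi) ^ DIM('a) * gauss (z::'a::euclidean_space)"
proof -
  have c: "cis (x \<bullet> z) = (\<Prod>b\<in>Basis. cis ((x \<bullet> b) * (z \<bullet> b)))" for x :: 'a
    unfolding cis_conv_exp
    by (subst euclidean_inner) (simp add: exp_sum[symmetric] sum_distrib_left)
  have "(LBINT x. complex_of_real (gauss x) * cis (x \<bullet> z))
    = (LBINT x. complex_of_real (sqrt (2 * pi) ^ DIM('a)) * (\<Prod>b\<in>Basis. complex_of_real (std_normal_density (x \<bullet> b)) * cis ((x \<bullet> b) * (z \<bullet> b))))"
    unfolding c gauss_eq_prod by (simp add: prod.distrib mult.assoc)
  also have "\<dots> = complex_of_real (sqrt (2 * pi) ^ DIM('a)) * (\<Prod>b\<in>(Basis::'a set). LBINT s. complex_of_real (std_normal_density s) * cis (s * (z \<bullet> b)))"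
    by (subst integral_mult_right_zero, subst integral_lborel_prod)
       (auto intro!: integrable_mult_bounded[where K=1])
  also have "(\<Prod>b\<in>(Basis::'a set). LBINT s. complex_of_real (std_normal_density s) * cis (s * (z \<bullet> b))) = gauss z"
  proof -
    have "(norm z)\<^sup>2 = (\<Sum>b\<in>Basis. (z \<bullet> b)\<^sup>2)"
      unfolding power2_norm_eq_inner by (subst euclidean_inner) (simp add: power2_eq_square)
    then show ?thesis
      unfolding std_normal_fourier of_real_prod[symmetric]
      by (simp add: gauss_def exp_sum[symmetric] sum_negf sum_divide_distrib)
  qed
  finally show ?thesis by simp
qed

lemma gauss_integrable: "integrable lborel (gauss :: 'a::euclidean_space \<Rightarrow> real)"
proof -
  have "(\<integral>\<^sup>+x. ennreal (norm (gauss (x::'a))) \<partial>lborel)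
     = (\<integral>\<^sup>+x. ennreal (sqrt (2 * pi) ^ DIM('a)) * (\<Prod>b\<in>Basis. ennreal (std_normal_density (x \<bullet> b))) \<partial>(lborel::'a measure))"
    by (intro nn_integral_cong)
       (simp add: gauss_eq_prod prod_ennreal normal_density_nonneg ennreal_mult[symmetric] prod_nonneg abs_mult)
  also have "\<dots> = ennreal (sqrt (2 * pi) ^ DIM('a)) * (\<Prod>b\<in>(Basis::'a set). \<integral>\<^sup>+s. ennreal (std_normal_density s) \<partial>lborel)"
    by (subst nn_integral_cmult, simp, subst nn_integral_lborel_prod) auto
  also have "\<dots> < \<infinity>"
    by (simp add: nn_integral_eq_integral[OF integrable_normal_density] ennreal_mult_less_top)
  finally show ?thesis unfolding integrable_iff_bounded by simp
qed

lemma fourier_gauss_scaled: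
  assumes d: "0 < \<delta>"
  shows "fourier (\<lambda>w. complex_of_real (gauss ((2 * pi * \<delta>) *\<^sub>R w))) (z::'a::euclidean_space)
    = complex_of_real (sqrt (2 * pi) ^ DIM('a) / (2 * pi * \<delta>) ^ DIM('a) * gauss (z /\<^sub>R \<delta>))"
proof -
  let ?c = "2 * pi * \<delta>"
  have c: "0 < ?c" using d by simp
  have "(LBINT x. complex_of_real (gauss x) * cis (x \<bullet> (- z /\<^sub>R \<delta>)))
     = \<bar>?c\<bar> ^ DIM('a) *\<^sub>R (LBINT w. complex_of_real (gauss (0 + ?c *\<^sub>R w)) * cis ((0 + ?c *\<^sub>R w) \<bullet> (- z /\<^sub>R \<delta>)))"
    by (rule integral_lborel_affine) (use c in auto)
  also have "(LBINT w. complex_of_real (gauss (0 + ?c *\<^sub>R w)) * cis ((0 + ?c *\<^sub>R w) \<bullet> (- z /\<^sub>R \<delta>)))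
     = fourier (\<lambda>w. complex_of_real (gauss (?c *\<^sub>R w))) z"
    unfolding fourier_def
  proof (intro Bochner_Integration.integral_cong refl)
    fix w
    have e: "(0 + ?c *\<^sub>R w) \<bullet> (- z /\<^sub>R \<delta>) = - (2 * pi * (z \<bullet> w))"
      using d by (simp add: inner_commute)
    show "complex_of_real (gauss (0 + ?c *\<^sub>R w)) * cis ((0 + ?c *\<^sub>R w) \<bullet> (- z /\<^sub>R \<delta>))
       = complex_of_real (gauss (?c *\<^sub>R w)) * cis (- (2 * pi * (z \<bullet> w)))"
      unfolding e by simp
  qed
  finally have eq: "?c ^ DIM('a) *\<^sub>R fourier (\<lambda>w. complex_of_real (gauss (?c *\<^sub>R w))) z = complex_of_real (sqrt (2 * pi) ^ DIM('a)) * gauss (z /\<^sub>R \<delta>)"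
    unfolding gauss_integral_cis using c by (simp add: gauss_def)
  have gen: "X *\<^sub>R F = Y \<Longrightarrow> X \<noteq> 0 \<Longrightarrow> F = Y / complex_of_real X" for X F Y
    by (auto simp: scaleR_conv_of_real)
  have "?c ^ DIM('a) \<noteq> 0" using c by (metis less_irrefl power_not_zero)
  from gen[OF eq this] show ?thesis by simp
qed

text \<open>If the scaled Gaussian were not integrable, its integral would be the default value 0,
  and the affine substitution would force the nonzero integral of \<open>gauss\<close> to
  vanish.\<close>

lemma gauss_scaled_integrable:
  assumes "c \<noteq> 0"
  shows "integrable lborel (\<lambda>x::'a::euclidean_space. gauss (c *\<^sub>R x))"
proof (rule ccontr)
  assume n: "\<not> integrable lborel (\<lambda>x::'a. gauss (c *\<^sub>R x))"
  have "(\<integral>x. gauss x \<partial>(lborel::'a measure)) = \<bar>c\<bar> ^ DIM('a) *\<^sub>R (\<integral>x. gauss (0 + c *\<^sub>R x) \<partial>(lborel::'a measure))"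
    by (rule integral_lborel_affine[OF assms]) auto
  also have "\<dots> = 0" using n by (simp add: not_integrable_integral_eq)
  finally have "(LBINT x. complex_of_real (gauss x) * cis (x \<bullet> (0::'a))) = 0"
    by simp
  then show False unfolding gauss_integral_cis by (simp add: gauss_def)
qed

text \<open>Gaussian regularisation: \<open>A i\<close> is the inversion integral with a Gaussian
  factor of width inverse to \<open>\<delta> i\<close>. It converges to the inversion integral by
  dominated convergence; by the multiplication formula it is also an average of \<open>v\<close>
  around \<open>t\<close> with a Gaussian weight of width \<open>\<delta> i\<close>, which converges
  to \<open>v t\<close>.\<close>

theorem fourier_inversion:
  fixes v :: "'a::euclidean_space \<Rightarrow> complex"
  assumes v: "integrable lborel v" "continuous_on UNIV v" "\<And>t. norm (v t) \<le> B"
    and V: "integrable lborel (fourier v)"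
  shows "fourier (fourier v) (- t) = v t"
proof -
  define \<delta> where "\<delta> = (\<lambda>i. inverse (real (Suc i)))"
  have \<delta>: "0 < \<delta> i" for i by (simp add: \<delta>_def)
  have \<delta>0: "\<delta> \<longlonglongrightarrow> 0" unfolding \<delta>_def by (rule LIMSEQ_inverse_real_of_nat)
  have vm [measurable]: "v \<in> borel_measurable borel" by (rule borel_measurable_continuous_onI[OF v(2)])
  let ?D = "DIM('a)"
  define A where "A = (\<lambda>i. LBINT w. fourier v w * (complex_of_real (gauss ((2 * pi * \<delta> i) *\<^sub>R w)) * cis (2 * pi * (t \<bullet> w))))"
  have g1: "norm (gauss x) \<le> 1" for x :: 'a by (simp add: gauss_def)
  have "A \<longlonglongrightarrow> (LBINT w. fourier v w * (1 * cis (2 * pi * (t \<bullet> w))))"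
    unfolding A_def
  proof (rule integral_dominated_convergence[where w="\<lambda>w. norm (fourier v w)"])
    show "AE w in lborel. (\<lambda>i. fourier v w * (complex_of_real (gauss ((2 * pi * \<delta> i) *\<^sub>R w)) * cis (2 * pi * (t \<bullet> w))))
        \<longlonglongrightarrow> fourier v w * (1 * cis (2 * pi * (t \<bullet> w)))"
    proof (intro AE_I2 tendsto_mult tendsto_const)
      fix w :: 'a
      have "(\<lambda>i. complex_of_real (exp (- (norm ((2 * pi * \<delta> i) *\<^sub>R w))\<^sup>2 / 2))) \<longlonglongrightarrow> complex_of_real (exp (- (norm ((2 * pi * 0) *\<^sub>R w))\<^sup>2 / 2))"
        by (intro tendsto_intros \<delta>0) auto
      then show "(\<lambda>i. complex_of_real (gauss ((2 * pi * \<delta> i) *\<^sub>R w))) \<longlonglongrightarrow> 1"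
        by (simp add: gauss_def)
    qed
    show "AE w in lborel. norm (fourier v w * (complex_of_real (gauss ((2 * pi * \<delta> i) *\<^sub>R w)) * cis (2 * pi * (t \<bullet> w)))) \<le> norm (fourier v w)" for i
      using g1 by (intro AE_I2) (simp add: norm_mult mult_left_le)
  qed (use V in \<open>auto intro: integrable_norm\<close>)
  moreover have "(LBINT w. fourier v w * (1 * cis (2 * pi * (t \<bullet> w)))) = fourier (fourier v) (- t)"
    by (simp add: fourier_def[of "fourier v"])
  moreover have "A i = (LBINT x. v (t + \<delta> i *\<^sub>R x) * complex_of_real (gauss x / sqrt (2 * pi) ^ ?D))" for i
  proof -
    define K where "K = sqrt (2 * pi) ^ ?D / (2 * pi * \<delta> i) ^ ?D"
    define H where "H = (\<lambda>s. v s * complex_of_real (K * gauss ((s - t) /\<^sub>R \<delta> i)))"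
    let ?g = "\<lambda>w. complex_of_real (gauss ((2 * pi * \<delta> i) *\<^sub>R (w::'a)))"
    let ?B = "\<lambda>w. ?g w * cis (2 * pi * (t \<bullet> w))"
    have gi: "integrable lborel ?g"
      using gauss_scaled_integrable[of "2 * pi * \<delta> i", where 'a='a] \<delta>[of i] by auto
    have "integrable lborel ?B"
      by (rule integrable_mult_bounded[OF gi, where K=1]) auto
    then have "A i = (LBINT s. v s * fourier ?B s)"
      unfolding A_def using fourier_multiplication[OF v(1), of ?B] by (simp add: mult.commute)
    also have "\<dots> = (LBINT s. H s)"
      unfolding fourier_modulate fourier_gauss_scaled[OF \<delta>] H_def K_def by (simp only:)
    also have "\<dots> = \<bar>\<delta> i\<bar> ^ ?D *\<^sub>R (LBINT x. H (t + \<delta> i *\<^sub>R x))"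
    proof (rule integral_lborel_affine)
      show "\<delta> i \<noteq> 0" using \<delta>[of i] by simp
      show "H \<in> borel_measurable borel" unfolding H_def by measurable
    qed
    finally have A1: "A i = (LBINT x. \<bar>\<delta> i\<bar> ^ ?D *\<^sub>R H (t + \<delta> i *\<^sub>R x))"
      unfolding integral_scaleR_right .
    \<comment> \<open>With \<open>c = sqrt (2 * pi) ^ d\<close> the constant \<open>K\<close> is
      \<open>c / (c^2 * \<delta> i ^ d)\<close>; the Jacobian \<open>\<delta> i ^ d\<close> leaves
      \<open>1 / c\<close>, which normalises the Gaussian.\<close>
    have A2: "\<bar>\<delta> i\<bar> ^ ?D *\<^sub>R H (t + \<delta> i *\<^sub>R x) = v (t + \<delta> i *\<^sub>R x) * complex_of_real (gauss x / sqrt (2 * pi) ^ ?D)" for x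
    proof -
      define c where "c = sqrt (2 * pi) ^ ?D"
      define e where "e = \<delta> i ^ ?D"
      have c: "c \<noteq> 0" "c * c = (2 * pi) ^ ?D"
        unfolding c_def by (simp, subst power_mult_distrib[symmetric], simp)
      have e: "e \<noteq> 0" "\<bar>\<delta> i\<bar> ^ ?D = e" using \<delta>[of i] by (auto simp: e_def)
      have "K = c / ((c * c) * e)"
        unfolding K_def c(2) c_def[symmetric] e_def power_mult_distrib[of "2 * pi" "\<delta> i"] ..
      then have "e * K = 1 / c" using c(1) e(1) by simp
      then have "\<bar>\<delta> i\<bar> ^ ?D * (K * gauss x) = gauss x / sqrt (2 * pi) ^ ?D"
        unfolding e(2) c_def[symmetric] by (simp add: mult.assoc[symmetric])
      moreover have "(t + \<delta> i *\<^sub>R x - t) /\<^sub>R \<delta> i = x" using \<delta>[of i] by simp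
      moreover have "\<bar>\<delta> i\<bar> ^ ?D *\<^sub>R (y * complex_of_real p) = y * complex_of_real (\<bar>\<delta> i\<bar> ^ ?D * p)" for p y
        by (simp add: scaleR_conv_of_real mult_ac)
      ultimately show ?thesis
        unfolding H_def by (simp only:)
    qed
    show ?thesis unfolding A1 A2 ..
  qed
  then have "A = (\<lambda>i. LBINT x. v (t + \<delta> i *\<^sub>R x) * complex_of_real (gauss x / sqrt (2 * pi) ^ ?D))" by blast
  moreover have "(\<lambda>i. LBINT x. v (t + \<delta> i *\<^sub>R x) * complex_of_real (gauss x / sqrt (2 * pi) ^ ?D))
      \<longlonglongrightarrow> (LBINT x. v t * complex_of_real (gauss (x::'a) / sqrt (2 * pi) ^ ?D))"
  proof (rule integral_dominated_convergence[where w="\<lambda>x::'a. B * (gauss x / sqrt (2 * pi) ^ ?D)"])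
    show "integrable lborel (\<lambda>x::'a. B * (gauss x / sqrt (2 * pi) ^ ?D))"
      using gauss_integrable[where 'a='a] by auto
    show "AE x in lborel. (\<lambda>i. v (t + \<delta> i *\<^sub>R x) * complex_of_real (gauss x / sqrt (2 * pi) ^ ?D)) \<longlonglongrightarrow> v t * complex_of_real (gauss x / sqrt (2 * pi) ^ ?D)"
    proof (intro AE_I2 tendsto_mult tendsto_const)
      fix x :: 'a
      have "(\<lambda>i. t + \<delta> i *\<^sub>R x) \<longlonglongrightarrow> t + 0 *\<^sub>R x" by (intro tendsto_intros \<delta>0)
      moreover have "isCont v t" using v(2) by (simp add: continuous_on_eq_continuous_at)
      ultimately show "(\<lambda>i. v (t + \<delta> i *\<^sub>R x)) \<longlonglongrightarrow> v t"
        using isCont_tendsto_compose[of t v "\<lambda>i. t + \<delta> i *\<^sub>R x"] by simp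
    qed
    show "AE x in lborel. norm (v (t + \<delta> i *\<^sub>R x) * complex_of_real (gauss x / sqrt (2 * pi) ^ ?D)) \<le> B * (gauss x / sqrt (2 * pi) ^ ?D)" for i
      by (intro AE_I2, unfold norm_mult, intro mult_mono v(3)) (auto simp: gauss_def norm_divide norm_power order_trans[OF norm_ge_zero v(3)])
  qed measurable
  moreover have "(LBINT x. v t * complex_of_real (gauss (x::'a) / sqrt (2 * pi) ^ ?D)) = v t"
    using gauss_integral_cis[of "0::'a"] by (simp add: gauss_def)
  ultimately show ?thesis by (simp only:) (rule LIMSEQ_unique)
qed

text \<open>Inversion expresses \<open>cnj (v t)\<close> as a transform, which the multiplication
  formula moves onto \<open>a\<close>. The regularity sits entirely on \<open>v\<close>, so that
  \<open>a\<close> can be a bounded function times a window.\<close>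

lemma fourier_plancherel:
  fixes v :: "'a::euclidean_space \<Rightarrow> complex"
  assumes v: "integrable lborel v" "continuous_on UNIV v" "\<And>t. norm (v t) \<le> B"
    and V: "integrable lborel (fourier v)" and a: "integrable lborel a"
  shows "(LBINT w. fourier a w * cnj (fourier v w)) = (LBINT t. a t * cnj (v t))"
proof -
  have "(LBINT t. a t * cnj (v t)) = (LBINT t. a t * fourier (\<lambda>w. cnj (fourier v w)) t)"
    unfolding fourier_cnj fourier_inversion[OF v V] ..
  also have "\<dots> = (LBINT w. cnj (fourier v w) * fourier a w)"
    by (rule fourier_multiplication[OF a]) (use V in simp)
  finally show ?thesis by (simp add: mult.commute)
qed

subsection \<open>Mixed norms\<close>

lemma ennreal_powr_measurable [measurable]:
  assumes [measurable]: "F \<in> borel_measurable M"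
  shows "(\<lambda>x. ennreal_powr (F x) r) \<in> borel_measurable M"
  unfolding ennreal_powr_def by measurable

lemma ennreal_powr_mono: "0 \<le> r \<Longrightarrow> x \<le> y \<Longrightarrow> ennreal_powr x r \<le> ennreal_powr y r"
  by (auto simp: ennreal_powr_def top_unique less_top intro!: ennreal_leI powr_mono2 enn2real_mono)

lemma ennreal_powr_ennreal [simp]: "0 \<le> x \<Longrightarrow> ennreal_powr (ennreal x) r = ennreal (x powr r)"
  by (simp add: ennreal_powr_def)

lemma ennreal_powr_top [simp]: "ennreal_powr \<top> r = \<top>"
  by (simp add: ennreal_powr_def)

lemma ennreal_powr_1 [simp]: "ennreal_powr x 1 = x"
  by (cases x) auto

lemma Lp_norm_mono:
  assumes "1 \<le> p" "\<And>x. F x \<le> F' x" "F \<in> borel_measurable borel"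
  shows "Lp_norm p F \<le> Lp_norm p F'"
proof (cases "p = \<infinity>")
  case True
  then show ?thesis using assms by (simp add: Lp_norm_def esssup_mono)
next
  case False
  then show ?thesis
    using assms(2) by (auto simp: Lp_norm_def intro!: ennreal_powr_mono nn_integral_mono)
qed

text \<open>A Young inequality without homogeneity suffices, as \<open>F\<close> can be normalised; this replaces the
  Hoelder inequality in both variables.\<close>

lemma nn_integral_le_Lp_norm_finite:
  fixes F k k1 :: "'a::euclidean_space \<Rightarrow> ennreal"
  assumes p: "1 \<le> p" "p \<noteq> \<infinity>" and [measurable]: "F \<in> borel_measurable borel" "k \<in> borel_measurable borel" "k1 \<in> borel_measurable borel"
    and young: "\<And>x a. 0 \<le> a \<Longrightarrow> ennreal a * k x \<le> k1 x + c * ennreal (a powr enn2real p)"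
    and k1: "(\<integral>\<^sup>+x. k1 x \<partial>lborel) \<le> C1" and C: "0 < C1 + c"
  shows "(\<integral>\<^sup>+x. F x * k x \<partial>lborel) \<le> (C1 + c) * Lp_norm p F"
proof -
  define r where "r = enn2real p"
  have r: "1 \<le> r" using enn2real_mono[of 1 p] p by (simp add: r_def less_top)
  define I where "I = (\<integral>\<^sup>+x. ennreal_powr (F x) r \<partial>lborel)"
  have N: "Lp_norm p F = ennreal_powr I (1 / r)"
    using p by (simp add: Lp_norm_def I_def r_def)
  consider "I = \<top>" | "I = 0" | i where "I = ennreal i" "0 < i"
    by (cases I) (auto simp: order_le_less)
  then show ?thesis
  proof cases
    \<comment> \<open>The constant has to be positive here, since
      \<open>0 * \<top> = 0\<close>.\<close>
    case 1
    then show ?thesis using C by (auto simp: N ennreal_mult_top)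
  next
    case 2
    then have "AE x in lborel. ennreal_powr (F x) r = 0"
      unfolding I_def by (subst (asm) nn_integral_0_iff_AE) auto
    then have "AE x in lborel. F x = 0"
    proof eventually_elim
      case (elim x)
      then show ?case by (cases "F x") (use r in auto)
    qed
    then have "(\<integral>\<^sup>+x. F x * k x \<partial>lborel) = 0"
      by (subst nn_integral_0_iff_AE) auto
    then show ?thesis by simp
  next
    case (3 i)
    \<comment> \<open>\<open>n\<close> is the \<open>L^p\<close> norm of \<open>F\<close>, so the
      power integral of \<open>F / n\<close> is 1 and the second term contributes exactly
      \<open>c\<close>.\<close>
    define n where "n = i powr (1 / r)"
    have n: "0 < n" "n powr r = i" using 3 r by (auto simp: n_def powr_powr)
    have "AE x in lborel. ennreal_powr (F x) r \<noteq> \<infinity>"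
      by (rule nn_integral_noteq_infinite) (use 3 in \<open>auto simp: I_def[symmetric]\<close>)
    then have "AE x in lborel. F x * k x \<le> ennreal n * (k1 x + c * (ennreal (1 / i) * ennreal_powr (F x) r))"
    proof eventually_elim
      case (elim x)
      then obtain a where a: "F x = ennreal a" "0 \<le> a" by (cases "F x") auto
      have "F x * k x = ennreal n * (ennreal (a / n) * k x)"
        using a n by (simp add: ennreal_mult[symmetric] mult.assoc[symmetric])
      also have "\<dots> \<le> ennreal n * (k1 x + c * ennreal ((a / n) powr r))"
        using a n young[of "a / n" x] by (intro mult_left_mono) (auto simp: r_def)
      also have "(a / n) powr r = 1 / i * a powr r"
        using a n by (simp add: powr_divide)
      finally show ?case using a 3 by (simp add: ennreal_mult[symmetric])
    qed
    then have "(\<integral>\<^sup>+x. F x * k x \<partial>lborel) \<le> (\<integral>\<^sup>+x. ennreal n * (k1 x + c * (ennreal (1 / i) * ennreal_powr (F x) r)) \<partial>lborel)"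
      by (rule nn_integral_mono_AE)
    also have "\<dots> = ennreal n * ((\<integral>\<^sup>+x. k1 x \<partial>lborel) + c * (ennreal (1 / i) * I))"
      by (simp add: nn_integral_cmult nn_integral_add I_def)
    also have "ennreal (1 / i) * I = 1"
      using 3 by (simp add: ennreal_mult[symmetric])
    also have "ennreal n * ((\<integral>\<^sup>+x. k1 x \<partial>lborel) + c * 1) \<le> ennreal n * (C1 + c)"
      by (intro mult_left_mono add_mono k1) auto
    also have "\<dots> = (C1 + c) * Lp_norm p F"
      using 3 by (simp add: N n_def mult.commute)
    finally show ?thesis .
  qed
qed

text \<open>For finite \<open>p\<close> the Young inequality is \<open>a \<le> 1 + a powr p\<close>
  on \<open>B\<close>, for which it is enough to distinguish \<open>a \<le> 1\<close> and
  \<open>a > 1\<close>.\<close>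

lemma nn_integral_indicator_le_Lp_norm:
  fixes F :: "'a::euclidean_space \<Rightarrow> ennreal"
  assumes p: "1 \<le> p" and F [measurable]: "F \<in> borel_measurable borel" "B \<in> sets borel"
  shows "(\<integral>\<^sup>+x. F x * indicator B x \<partial>lborel) \<le> (emeasure lborel B + 1) * Lp_norm p F"
proof (cases "p = \<infinity>")
  case True
  have "AE x in lborel. F x \<le> esssup lborel F" by (rule esssup_AE)
  then have "(\<integral>\<^sup>+x. F x * indicator B x \<partial>lborel) \<le> (\<integral>\<^sup>+x. esssup lborel F * indicator B x \<partial>lborel)"
    by (intro nn_integral_mono_AE) (auto elim!: eventually_mono intro: mult_right_mono)
  also have "\<dots> = emeasure lborel B * Lp_norm p F"
    using True by (simp add: nn_integral_cmult Lp_norm_def mult.commute)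
  also have "\<dots> \<le> (emeasure lborel B + 1) * Lp_norm p F"
    by (intro mult_right_mono) auto
  finally show ?thesis .
next
  case False
  show ?thesis
  proof (rule nn_integral_le_Lp_norm_finite[OF p False F(1), of _ "indicator B"])
    have r: "1 \<le> enn2real p" using enn2real_mono[of 1 p] p False by (simp add: less_top)
    show "ennreal a * indicator B x \<le> indicator B x + 1 * ennreal (a powr enn2real p)" if "0 \<le> a" for a x
    proof (cases "a \<le> 1")
      case True
      then show ?thesis by (auto simp: indicator_def ennreal_le_1 intro: add_increasing2)
    next
      case False
      then have "a powr 1 \<le> a powr enn2real p" using r by (intro powr_mono) auto
      then have "ennreal a \<le> ennreal (a powr enn2real p)" using that False by (intro ennreal_leI) simp
      then show ?thesis by (auto simp: indicator_def intro: add_increasing)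
    qed
    show "0 < emeasure lborel B + 1" by (simp add: add_nonneg_pos)
  qed auto
qed

text \<open>This stands in for Hoelder's inequality with the conjugate exponent and interpolates
  between the \<open>L^2\<close> bound \<open>E\<close> and the sup bound \<open>s\<close>. Where
  \<open>a * T \<le> y\<close>, one has \<open>a * y \<le> y^2 / T\<close>; elsewhere
  \<open>y = y^(r - 1) * y^(2 - r) \<le> (T * a)^(r - 1) * s^(2 - r)\<close>, with \<open>r\<close>
  the real value of \<open>q\<close>. The threshold \<open>T\<close> stays free to balance the two
  terms.\<close>

lemma nn_integral_product_le_Lp_norm:
  fixes F :: "'a::euclidean_space \<Rightarrow> ennreal" and y :: "'a \<Rightarrow> real"
  assumes q: "1 \<le> q" "q < 2" and F: "F \<in> borel_measurable borel" and y [measurable]: "y \<in> borel_measurable borel"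
    and ys: "\<And>x. 0 \<le> y x" "\<And>x. y x \<le> s" "0 < s" and E: "(\<integral>\<^sup>+x. ennreal ((y x)\<^sup>2) \<partial>lborel) \<le> ennreal E" "0 < E" and T: "0 < T"
  shows "(\<integral>\<^sup>+x. F x * ennreal (y x) \<partial>lborel)
    \<le> ennreal (E / T + T powr (enn2real q - 1) * s powr (2 - enn2real q)) * Lp_norm q F"
proof -
  define r where "r = enn2real q"
  have qfin: "q \<noteq> \<infinity>" using q(2) by auto
  have r: "1 \<le> r" "r < 2"
  proof -
    show "1 \<le> r" using enn2real_mono[of 1 q] q qfin by (simp add: r_def less_top)
    show "r < 2" using q qfin unfolding r_def by (cases q) (auto simp: ennreal_less_iff)
  qed
  let ?c = "T powr (r - 1) * s powr (2 - r)"
  have pos: "0 \<le> E / T" "0 \<le> ?c" "0 < E / T" using E T ys by auto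
  have "(\<integral>\<^sup>+x. F x * ennreal (y x) \<partial>lborel) \<le> (ennreal (E / T) + ennreal ?c) * Lp_norm q F"
  proof (rule nn_integral_le_Lp_norm_finite[OF q(1) qfin F, of _ "\<lambda>x. ennreal (1 / T) * ennreal ((y x)\<^sup>2)"])
    have "(\<integral>\<^sup>+x. ennreal (1 / T) * ennreal ((y x)\<^sup>2) \<partial>lborel) \<le> ennreal (1 / T) * ennreal E"
      by (subst nn_integral_cmult) (auto intro: mult_left_mono E)
    then show "(\<integral>\<^sup>+x. ennreal (1 / T) * ennreal ((y x)\<^sup>2) \<partial>lborel) \<le> ennreal (E / T)"
      using T E by (simp flip: ennreal_mult)
    show "ennreal a * ennreal (y x) \<le> ennreal (1 / T) * ennreal ((y x)\<^sup>2) + ennreal ?c * ennreal (a powr enn2real q)"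
      if a: "0 \<le> a" for a x
    proof -
      have "a * y x \<le> 1 / T * (y x)\<^sup>2 + ?c * a powr r"
      proof (cases "a * T \<le> y x")
        case True
        then have "a * y x \<le> y x / T * y x"
          using T ys by (intro mult_right_mono) (auto simp: field_simps)
        then show ?thesis using pos by (simp add: power2_eq_square add_increasing2)
      next
        case False
        then have trig_series: "0 < a" using a ys(1)[of x] by (cases "a = 0") auto
        have "y x \<le> T powr (r - 1) * a powr (r - 1) * s powr (2 - r)"
        proof (cases "y x = 0")
          case False
          then have yp: "0 < y x" using ys(1)[of x] by simp
          have "y x = y x powr (r - 1) * y x powr (2 - r)"
            using yp by (simp flip: powr_add)
          also have "\<dots> \<le> (T * a) powr (r - 1) * s powr (2 - r)"
            using r yp ys \<open>\<not> a * T \<le> y x\<close> by (intro mult_mono powr_mono2) (auto simp: mult.commute)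
          finally show ?thesis using T trig_series by (simp add: powr_mult)
        qed simp
        then have "a * y x \<le> a * (T powr (r - 1) * a powr (r - 1) * s powr (2 - r))"
          using a by (rule mult_left_mono)
        also have "\<dots> = ?c * a powr r"
          using trig_series by (simp add: powr_diff)
        finally show ?thesis using T by (simp add: add_increasing)
      qed
      then have "ennreal (a * y x) \<le> ennreal (1 / T * (y x)\<^sup>2 + ?c * a powr r)"
        by (rule ennreal_leI)
      also have "\<dots> = ennreal (1 / T * (y x)\<^sup>2) + ennreal (?c * a powr r)"
        using T by (intro ennreal_plus) auto
      also have "\<dots> = ennreal (1 / T) * ennreal ((y x)\<^sup>2) + ennreal ?c * ennreal (a powr r)"
        using T ennreal_mult[of "1 / T" "(y x)\<^sup>2"] by (simp add: ennreal_mult)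
      finally show ?thesis
        using a ys(1)[of x] by (simp add: ennreal_mult r_def)
    qed
    show "0 < ennreal (E / T) + ennreal ?c"
      using pos by (auto simp: zero_less_iff_neq_zero)
  qed auto
  then show ?thesis using pos by (simp add: r_def)
qed

subsection \<open>Bounded functions as tempered distributions\<close>

lemma weight_integrable: "integrable lborel (weight :: 'a::euclidean_space \<Rightarrow> real)"
proof -
  have "\<bar>weight x\<bar> = weight x" for x :: 'a using weight_pos[of x] by simp
  then show ?thesis
    using weight_nn_integral[where 'a='a] by (simp add: integrable_iff_bounded)
qed

text \<open>The empty multi-index contributes one summand of the seminorm and the others are
  nonnegative. Membership in the Schwartz space bounds the ranges, which gives the suprema their
  meaning.\<close>

lemma schwartz_le_seminorm:
  fixes \<phi> :: "'a::euclidean_space \<Rightarrow> complex"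
  assumes \<phi>: "\<phi> \<in> schwartz_space"
  shows "norm (\<phi> x) \<le> schwartz_seminorm (2 * DIM('a)) \<phi> * weight x"
proof -
  let ?N = "2 * DIM('a)"
  let ?s = "\<lambda>bs. SUP x. (1 + norm x) ^ ?N * cmod (iterated_partial bs \<phi> x)"
  have bdd: "bdd_above (range (\<lambda>x. (1 + norm x) ^ ?N * cmod (iterated_partial bs \<phi> x)))"
    if bs: "set bs \<subseteq> Basis" for bs
  proof -
    obtain C where C: "\<And>x. norm (iterated_partial bs \<phi> x) \<le> C * inverse ((1 + norm x) ^ ?N)"
      using schwartz_bound[OF \<phi> bs] by blast
    have "(1 + norm x) ^ ?N * cmod (iterated_partial bs \<phi> x) \<le> C" for x
    proof -
      have "0 < (1 + norm x) ^ ?N" by (intro zero_less_power) (simp add: add_pos_nonneg)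
      then show ?thesis using C[of x] by (simp add: field_simps)
    qed
    then show ?thesis by (intro bdd_aboveI[of _ C]) auto
  qed
  have fin: "finite {bs. set bs \<subseteq> (Basis :: 'a set) \<and> length bs \<le> ?N}"
    by (rule finite_lists_length_le) simp
  have "(1 + norm x) ^ ?N * cmod (\<phi> x) \<le> ?s []"
    using cSUP_upper[OF UNIV_I bdd[of "[]"], of x] by (simp add: iterated_partial_def)
  also have "?s [] \<le> schwartz_seminorm ?N \<phi>"
    unfolding schwartz_seminorm_def
  proof (rule member_le_sum[OF _ _ fin])
    fix bs assume "bs \<in> {bs. set bs \<subseteq> (Basis :: 'a set) \<and> length bs \<le> ?N} - {[]}"
    then have "set bs \<subseteq> Basis" by auto
    then have "(1 + norm (0::'a)) ^ ?N * cmod (iterated_partial bs \<phi> 0) \<le> ?s bs"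
      by (intro cSUP_upper bdd) auto
    then show "0 \<le> ?s bs" by (rule order_trans[rotated]) simp
  qed auto
  finally have *: "(1 + norm x) ^ ?N * cmod (\<phi> x) \<le> schwartz_seminorm ?N \<phi>" .
  have "0 < (1 + norm x) ^ ?N" by (intro zero_less_power) (simp add: add_pos_nonneg)
  with * show ?thesis unfolding weight_def by (simp add: field_simps)
qed

lemma schwartz_measurable:
  assumes "\<phi> \<in> schwartz_space" shows "\<phi> \<in> borel_measurable borel"
  using schwartz_continuous[OF assms, of "[]"]
  by (intro borel_measurable_continuous_onI) (simp add: iterated_partial_def)

lemma schwartz_integrable:
  fixes \<phi> :: "'a::euclidean_space \<Rightarrow> complex"
  assumes "\<phi> \<in> schwartz_space" shows "integrable lborel \<phi>"
proof (rule Bochner_Integration.integrable_bound)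
  show "integrable lborel (\<lambda>x::'a. schwartz_seminorm (2 * DIM('a)) \<phi> * weight x)"
    using weight_integrable by auto
  show "AE x in lborel. norm (\<phi> x) \<le> norm (schwartz_seminorm (2 * DIM('a)) \<phi> * weight x)"
    by (intro AE_I2 order_trans[OF schwartz_le_seminorm[OF assms]]) simp
qed (use schwartz_measurable[OF assms] in simp)

lemma tempered_function_bounded:
  fixes f :: "'a::euclidean_space \<Rightarrow> complex"
  assumes f: "f \<in> borel_measurable borel" "\<And>x. norm (f x) \<le> B"
  shows "tempered_function f"
proof -
  have B: "0 \<le> B" using order_trans[OF norm_ge_zero f(2)] .
  have int: "integrable lborel (\<lambda>x. f x * \<phi> x)" if "\<phi> \<in> schwartz_space" for \<phi>
    using integrable_mult_bounded[OF schwartz_integrable[OF that], of f B] f by (simp add: mult.commute)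
  let ?W = "\<integral>x. weight x \<partial>(lborel :: 'a measure)"
  have bound: "cmod (dist_of f \<phi>) \<le> (B * ?W) * schwartz_seminorm (2 * DIM('a)) \<phi>" if \<phi>: "\<phi> \<in> schwartz_space" for \<phi>
  proof -
    have "cmod (dist_of f \<phi>) \<le> (LBINT x. norm (f x * \<phi> x))"
      unfolding dist_of_def by (rule integral_norm_bound)
    also have "\<dots> \<le> (LBINT x. (B * schwartz_seminorm (2 * DIM('a)) \<phi>) * weight (x::'a))"
    proof (rule Bochner_Integration.integral_mono)
      show "integrable lborel (\<lambda>x::'a. (B * schwartz_seminorm (2 * DIM('a)) \<phi>) * weight x)"
        using weight_integrable by auto
      show "norm (f x * \<phi> x) \<le> (B * schwartz_seminorm (2 * DIM('a)) \<phi>) * weight x" for x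
        unfolding norm_mult mult.assoc
        by (intro mult_mono f schwartz_le_seminorm \<phi> B) auto
    qed (use int[OF \<phi>] in auto)
    finally show ?thesis by (simp add: mult_ac)
  qed
  have "dist_of f \<in> tempered_distributions"
    unfolding tempered_distributions_def
  proof (intro CollectI conjI ballI allI)
    show "dist_of f (\<lambda>x. \<phi> x + \<psi> x) = dist_of f \<phi> + dist_of f \<psi>"
      if "\<phi> \<in> schwartz_space" "\<psi> \<in> schwartz_space" for \<phi> \<psi>
      unfolding dist_of_def ring_distribs by (intro Bochner_Integration.integral_add int that)
    show "dist_of f (\<lambda>x. c * \<phi> x) = c * dist_of f \<phi>" for c \<phi>
      unfolding dist_of_def by (simp add: mult.left_commute[of _ c])
    show "\<exists>C N. \<forall>\<phi>\<in>schwartz_space. cmod (dist_of f \<phi>) \<le> C * schwartz_seminorm N \<phi>"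
      using bound by blast
  qed
  with int show ?thesis by (simp add: tempered_function_def)
qed

lemma cnj_measurable [measurable]: "cnj \<in> borel_measurable borel"
  by (intro borel_measurable_continuous_onI continuous_intros)

lemma stft_dist_of: "stft g (dist_of f) x w = fourier (\<lambda>t. f t * cnj (g (t - x))) w"
  unfolding stft_def dist_of_def fourier_def cis_conv_exp
  by (intro Bochner_Integration.integral_cong) (auto simp: mult_ac)

lemma stft_measurable:
  assumes [measurable]: "f \<in> borel_measurable borel" "g \<in> borel_measurable borel"
  shows "(\<lambda>(x, w). stft g (dist_of f) x w) \<in> borel_measurable (borel \<Otimes>\<^sub>M borel)"
proof -
  have "(\<lambda>p. LBINT t. f t * cnj (g (t - fst p)) * cis (- (2 * pi * (snd p \<bullet> t)))) \<in> borel_measurable (borel \<Otimes>\<^sub>M borel)"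
    by measurable
  then show ?thesis
    unfolding stft_dist_of fourier_def by (simp add: case_prod_unfold)
qed

lemma Lp_norm_1: "Lp_norm 1 F = (\<integral>\<^sup>+x. F x \<partial>lborel)"
  by (simp add: Lp_norm_def)

text \<open>As \<open>weight \<le> 1\<close>, its \<open>r\<close>-th power is at most
  \<open>weight\<close> for \<open>r \<ge> 1\<close>, so one constant serves all \<open>p\<close>.
  The added 1 makes the base at least 1, which yields
  \<open>W0 \<le> (W0 + 1) powr r\<close>.\<close>

lemma Lp_norm_weight:
  assumes p: "1 \<le> p"
  shows "Lp_norm p (\<lambda>x::'a::euclidean_space. ennreal (weight x) * c) \<le> ((\<integral>\<^sup>+x. ennreal (weight (x::'a)) \<partial>lborel) + 1) * c"
    (is "_ \<le> (?W + 1) * c")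
proof (cases "p = \<infinity>")
  case True
  have "ennreal (weight x) * c \<le> c" for x :: 'a
    using mult_right_mono[of "ennreal (weight x)" 1 c] weight_le_1[of x] by simp
  then have "esssup lborel (\<lambda>x::'a. ennreal (weight x) * c) \<le> c"
    by (intro esssup_I AE_I2) auto
  also have "\<dots> \<le> (?W + 1) * c"
    using mult_right_mono[of 1 "?W + 1" c] by simp
  finally show ?thesis using True by (simp add: Lp_norm_def)
next
  case False
  define r where "r = enn2real p"
  have r: "1 \<le> r" using enn2real_mono[of 1 p] p False by (simp add: r_def less_top)
  show ?thesis
  proof (cases c)
    case top
    then show ?thesis by (simp add: ennreal_mult_top)
  next
    case (real a)
    obtain W0 where W0: "?W = ennreal W0" "0 \<le> W0"
      using weight_nn_integral[where 'a='a] by (cases ?W) auto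
    have "(\<integral>\<^sup>+x. ennreal_powr (ennreal (weight (x::'a)) * c) r \<partial>lborel) \<le> (\<integral>\<^sup>+x. ennreal (a powr r) * ennreal (weight (x::'a)) \<partial>lborel)"
    proof (rule nn_integral_mono)
      fix x :: 'a
      have "weight x powr r \<le> weight x powr 1"
        using weight_pos[of x] weight_le_1[of x] r by (intro powr_mono') auto
      then have "(weight x * a) powr r \<le> a powr r * weight x"
        using weight_pos[of x] real mult_left_mono[of "weight x powr r" "weight x" "a powr r"]
        by (simp add: powr_mult mult.commute)
      then show "ennreal_powr (ennreal (weight x) * c) r \<le> ennreal (a powr r) * ennreal (weight x)"
        using weight_pos[of x] real by (simp add: less_imp_le flip: ennreal_mult)
    qed
    also have "\<dots> = ennreal (a powr r * W0)"
      using W0 by (simp add: nn_integral_cmult ennreal_mult)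
    also have "\<dots> \<le> ennreal ((a * (W0 + 1)) powr r)"
    proof (rule ennreal_leI)
      have "W0 \<le> (W0 + 1) powr 1" using W0 by simp
      also have "\<dots> \<le> (W0 + 1) powr r" using W0 r by (intro powr_mono) auto
      finally show "a powr r * W0 \<le> (a * (W0 + 1)) powr r"
        using real W0 by (simp add: powr_mult mult_left_mono)
    qed
    finally have "ennreal_powr (\<integral>\<^sup>+x. ennreal_powr (ennreal (weight (x::'a)) * c) r \<partial>lborel) (1 / r)
      \<le> ennreal_powr (ennreal ((a * (W0 + 1)) powr r)) (1 / r)"
      using r by (intro ennreal_powr_mono) auto
    also have "\<dots> = ennreal (a * (W0 + 1))"
      using real W0 r by (simp add: powr_powr)
    also have "\<dots> = (?W + 1) * c"
      using real W0 by (simp add: ennreal_mult mult.commute ennreal_plus)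
    finally show ?thesis using False by (simp add: Lp_norm_def r_def)
  qed
qed

text \<open>The majorant factors, so each of the two norms meets \<open>weight x\<close> and
  \<open>H w\<close> separately, and finiteness reduces to \<open>Lp_norm_weight\<close> and the
  integral of \<open>H\<close>.\<close>

lemma dist_of_in_spaces:
  fixes f g :: "'a::euclidean_space \<Rightarrow> complex"
  assumes f: "tempered_function f" "f \<in> borel_measurable borel" and g: "g \<in> borel_measurable borel" and p: "1 \<le> p"
    and H: "H \<in> borel_measurable borel" "(\<integral>\<^sup>+w. H w \<partial>lborel) < \<infinity>"
    and dom: "\<And>x w. ennreal (norm (stft g (dist_of f) x w)) \<le> ennreal (weight x) * H w"
  shows "dist_of f \<in> wiener_amalgam_space g p 1" "dist_of f \<in> modulation_space g p 1"
proof -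
  let ?V = "\<lambda>x w. ennreal (cmod (stft g (dist_of f) x w))"
  let ?W = "(\<integral>\<^sup>+x. ennreal (weight (x::'a)) \<partial>lborel)"
  note stft_measurable[OF f(2) g, measurable] H(1)[measurable]
  have [measurable]: "(\<lambda>x. stft g (dist_of f) x w) \<in> borel_measurable borel" for w
    using measurable_compose[of "\<lambda>x. (x, w)" borel "borel \<Otimes>\<^sub>M borel", OF _ stft_measurable[OF f(2) g]] by simp
  have [measurable]: "(\<lambda>(x, w). ?V x w) \<in> borel_measurable (borel \<Otimes>\<^sub>M borel)"
    using stft_measurable[OF f(2) g] by (simp add: case_prod_unfold)
  have W: "?W + 1 < \<top>" using weight_nn_integral[where 'a='a] by simp
  have td: "dist_of f \<in> tempered_distributions" using f(1) by (simp add: tempered_function_def)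
  have "modulation_norm g p 1 (dist_of f) \<le> (\<integral>\<^sup>+w. (?W + 1) * H w \<partial>lborel)"
    unfolding modulation_norm_def Lp_norm_1
  proof (rule nn_integral_mono)
    fix w
    have "Lp_norm p (\<lambda>x. ?V x w) \<le> Lp_norm p (\<lambda>x::'a. ennreal (weight x) * H w)"
      by (intro Lp_norm_mono p dom) measurable
    also have "\<dots> \<le> (?W + 1) * H w" by (rule Lp_norm_weight[OF p])
    finally show "Lp_norm p (\<lambda>x. ?V x w) \<le> (?W + 1) * H w" .
  qed
  also have "\<dots> < \<infinity>"
    using H W by (simp add: nn_integral_cmult ennreal_mult_less_top)
  finally show "dist_of f \<in> modulation_space g p 1"
    using td by (simp add: modulation_space_def)
  have "wiener_amalgam_norm g p 1 (dist_of f) \<le> Lp_norm p (\<lambda>x::'a. ennreal (weight x) * (\<integral>\<^sup>+w. H w \<partial>lborel))"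
    unfolding wiener_amalgam_norm_def Lp_norm_1
  proof (rule Lp_norm_mono[OF p])
    show "(\<integral>\<^sup>+w. ?V x w \<partial>lborel) \<le> ennreal (weight x) * (\<integral>\<^sup>+w. H w \<partial>lborel)" for x
      by (subst nn_integral_cmult[symmetric]) (auto intro: nn_integral_mono dom)
    show "(\<lambda>x. \<integral>\<^sup>+w. ?V x w \<partial>lborel) \<in> borel_measurable borel" by measurable
  qed
  also have "\<dots> \<le> (?W + 1) * (\<integral>\<^sup>+w. H w \<partial>lborel)" by (rule Lp_norm_weight[OF p])
  also have "\<dots> < \<infinity>"
    using H W by (simp add: ennreal_mult_less_top)
  finally show "dist_of f \<in> wiener_amalgam_space g p 1"
    using td by (simp add: wiener_amalgam_space_def)
qed

subsection \<open>A lower bound for the mixed norms\<close>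

lemma norm_integral_le_nn_integral: "ennreal (norm (integral\<^sup>L M f)) \<le> (\<integral>\<^sup>+x. ennreal (norm (f x)) \<partial>M)"
  by (cases "integrable M f") (auto simp: not_integrable_integral_eq intro: integral_norm_bound_ennreal)

text \<open>Plancherel is applied at each window position \<open>x\<close> and the result is
  integrated over a ball of positions, because a norm that integrates in \<open>x\<close> does not
  control a single \<open>x\<close>. On the left the windows combine into one averaged window
  multiplying \<open>u\<close>.\<close>

lemma stft_pairing:
  fixes u g \<psi> :: "'a::euclidean_space \<Rightarrow> complex"
  assumes u: "u \<in> borel_measurable borel" "\<And>t. norm (u t) \<le> U"
    and g: "g \<in> schwartz_space"
    and \<psi>: "integrable lborel \<psi>" "continuous_on UNIV \<psi>" "\<And>t. norm (\<psi> t) \<le> B" "integrable lborel (fourier \<psi>)"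
  shows "ennreal (norm (LBINT t. u t * (LBINT x. indicator (ball c r) x * cnj (g (t - x))) * cnj (\<psi> t)))
    \<le> (\<integral>\<^sup>+x. (\<integral>\<^sup>+w. ennreal (norm (stft g (dist_of u) x w)) * ennreal (norm (fourier \<psi> w)) \<partial>lborel) * indicator (ball c r) x \<partial>lborel)"
proof -
  have [measurable]: "ball c r \<in> sets borel" by simp
  have gm [measurable]: "g \<in> borel_measurable borel" by (rule schwartz_measurable[OF g])
  have [measurable]: "\<psi> \<in> borel_measurable borel" "u \<in> borel_measurable borel"
    using borel_measurable_integrable[OF \<psi>(1)] u by auto
  obtain Cg where Cg: "\<And>x. norm (g x) \<le> Cg"
    using schwartz_bound[OF g, of "[]" 0] by (auto simp: iterated_partial_def)
  have gi: "integrable lborel (\<lambda>t. g (t - x))" for x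
    using integrable_lborel_translate[OF schwartz_integrable[OF g], of "- x"] by simp
  let ?f = "\<lambda>t x. u t * (indicator (ball c r) x * cnj (g (t - x))) * cnj (\<psi> t)"
  have ind: "integrable lborel (\<lambda>x. U * (Cg * indicator (ball c r) x) :: real)"
    using emeasure_bounded_finite[OF bounded_ball[of c r]]
    by (intro integrable_mult_right integrable_real_indicator) auto
  have U: "0 \<le> U" using order_trans[OF norm_ge_zero u(2)] .
  have int: "integrable (lborel \<Otimes>\<^sub>M lborel) (\<lambda>(t, x). ?f t x)"
  proof (rule integrable_pair_dominated[OF _ _ integrable_norm[OF \<psi>(1)] ind])
    show "norm (?f t x) \<le> norm (\<psi> t) * (U * (Cg * indicator (ball c r) x))" for t x
    proof -
      have "norm (indicator (ball c r) x * cnj (g (t - x))) \<le> Cg * indicator (ball c r) x"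
        using Cg[of "t - x"] by (simp add: norm_mult indicator_def)
      then have "norm (u t * (indicator (ball c r) x * cnj (g (t - x)))) \<le> U * (Cg * indicator (ball c r) x)"
        unfolding norm_mult[of "u t"] using U by (intro mult_mono u(2)) auto
      then show ?thesis by (simp add: norm_mult mult_right_mono mult.commute[of "norm (\<psi> t)"])
    qed
  qed measurable
  have "(LBINT t. u t * (LBINT x. indicator (ball c r) x * cnj (g (t - x))) * cnj (\<psi> t))
     = (LBINT t. LBINT x. ?f t x)"
    by (simp only: integral_mult_right_zero integral_mult_left_zero)
  also have "\<dots> = (LBINT x. LBINT t. ?f t x)"
    using lborel_pair.Fubini_integral[OF int] by simp
  also have "\<dots> = (LBINT x. indicator (ball c r) x * (LBINT w. stft g (dist_of u) x w * cnj (fourier \<psi> w)))"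
  proof (rule Bochner_Integration.integral_cong[OF refl])
    fix x
    have "integrable lborel (\<lambda>t. cnj (g (t - x)) * u t)"
      by (rule integrable_mult_bounded[OF _ _ u(2)]) (use gi in auto)
    then have a: "integrable lborel (\<lambda>t. u t * cnj (g (t - x)))" by (simp add: mult.commute)
    have "(LBINT t. ?f t x) = (LBINT t. indicator (ball c r) x * (u t * cnj (g (t - x)) * cnj (\<psi> t)))"
      by (simp add: mult_ac)
    also have "\<dots> = indicator (ball c r) x * (LBINT t. u t * cnj (g (t - x)) * cnj (\<psi> t))"
      by (rule integral_mult_right_zero)
    also have "(LBINT t. u t * cnj (g (t - x)) * cnj (\<psi> t)) = (LBINT w. stft g (dist_of u) x w * cnj (fourier \<psi> w))"
      unfolding stft_dist_of by (rule fourier_plancherel[OF \<psi> a, symmetric])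
    finally show "(LBINT t. ?f t x) = indicator (ball c r) x * (LBINT w. stft g (dist_of u) x w * cnj (fourier \<psi> w))" .
  qed
  finally have eq: "(LBINT t. u t * (LBINT x. indicator (ball c r) x * cnj (g (t - x))) * cnj (\<psi> t))
    = (LBINT x. indicator (ball c r) x * (LBINT w. stft g (dist_of u) x w * cnj (fourier \<psi> w)))" .
  show ?thesis
    unfolding eq
  proof (rule order_trans[OF norm_integral_le_nn_integral nn_integral_mono])
    fix x
    have "ennreal (norm (LBINT w. stft g (dist_of u) x w * cnj (fourier \<psi> w)))
      \<le> (\<integral>\<^sup>+w. ennreal (norm (stft g (dist_of u) x w)) * ennreal (norm (fourier \<psi> w)) \<partial>lborel)"
      using norm_integral_le_nn_integral[of lborel "\<lambda>w. stft g (dist_of u) x w * cnj (fourier \<psi> w)"]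
      by (simp add: norm_mult ennreal_mult)
    then show "ennreal (norm (indicator (ball c r) x * (LBINT w. stft g (dist_of u) x w * cnj (fourier \<psi> w))))
      \<le> (\<integral>\<^sup>+w. ennreal (norm (stft g (dist_of u) x w)) * ennreal (norm (fourier \<psi> w)) \<partial>lborel) * indicator (ball c r) x"
      by (simp add: norm_mult indicator_def)
  qed
qed

lemma ennreal_scale_le_iff:
  assumes "0 < c" shows "ennreal (1 / c) * a \<le> b \<longleftrightarrow> a \<le> ennreal c * b"
proof
  have 1: "ennreal c * ennreal (1 / c) = 1" "ennreal (1 / c) * ennreal c = 1"
    using assms by (simp_all flip: ennreal_mult)
  show "a \<le> ennreal c * b" if "ennreal (1 / c) * a \<le> b"
    using mult_left_mono[OF that, of "ennreal c"] unfolding mult.assoc[symmetric] 1 by simp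
  show "ennreal (1 / c) * a \<le> b" if "a \<le> ennreal c * b"
    using mult_left_mono[OF that, of "ennreal (1 / c)"] unfolding mult.assoc[symmetric] 1 by simp
qed

text \<open>The two one-variable estimates are composed. Dividing by the inner constant first makes
  the inner integral a measurable function that lies below the inner norm, so monotonicity of
  \<open>Lp_norm\<close> applies directly.\<close>

lemma pairing_le_norms:
  fixes V :: "'a::euclidean_space \<Rightarrow> 'a \<Rightarrow> ennreal" and y :: "'a \<Rightarrow> real" and z :: 'a and r :: real
  assumes p: "1 \<le> p" and q: "1 \<le> q" "q < 2"
    and V [measurable]: "(\<lambda>(x, w). V x w) \<in> borel_measurable (borel \<Otimes>\<^sub>M borel)"
    and y [measurable]: "y \<in> borel_measurable borel"
    and ys: "\<And>x. 0 \<le> y x" "\<And>x. y x \<le> s" "0 < s" and E: "(\<integral>\<^sup>+x. ennreal ((y x)\<^sup>2) \<partial>lborel) \<le> ennreal E" "0 < E" and T: "0 < T"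
  defines "d \<equiv> E / T + T powr (enn2real q - 1) * s powr (2 - enn2real q)"
  defines "c \<equiv> measure lborel (ball z r) + 1"
  defines "X \<equiv> (\<integral>\<^sup>+x. (\<integral>\<^sup>+w. V x w * ennreal (y w) \<partial>lborel) * indicator (ball z r) x \<partial>lborel)"
  shows "X \<le> ennreal (c * d) * Lp_norm q (\<lambda>w. Lp_norm p (\<lambda>x. V x w))"
    and "X \<le> ennreal (c * d) * Lp_norm p (\<lambda>x. Lp_norm q (\<lambda>w. V x w))"
proof -
  have c: "0 < c" unfolding c_def using measure_nonneg[of lborel "ball z r"] by linarith
  have d: "0 < d" unfolding d_def using E T ys by (intro add_pos_nonneg) auto
  have ce: "emeasure lborel (ball z r) + 1 = ennreal c"
    unfolding c_def using emeasure_bounded_finite[OF bounded_ball[of z r]]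
    by (simp add: emeasure_eq_ennreal_measure)
  have [measurable]: "(\<lambda>x. V x w) \<in> borel_measurable borel" for w
    using measurable_compose[of "\<lambda>x. (x, w)" borel "borel \<Otimes>\<^sub>M borel", OF _ V] by simp
  have [measurable]: "V x \<in> borel_measurable borel" for x
    using measurable_compose[of "\<lambda>w. (x, w)" borel "borel \<Otimes>\<^sub>M borel", OF _ V] by simp
  have B: "(\<integral>\<^sup>+x. F x * indicator (ball z r) x \<partial>lborel) \<le> ennreal c * Lp_norm p F" if "F \<in> borel_measurable borel" for F
    using nn_integral_indicator_le_Lp_norm[OF p that, of "ball z r"] by (simp add: ce)
  have Y: "(\<integral>\<^sup>+x. F x * ennreal (y x) \<partial>lborel) \<le> ennreal d * Lp_norm q F" if "F \<in> borel_measurable borel" for F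
    unfolding d_def by (rule nn_integral_product_le_Lp_norm[OF q that y ys E T])
  have [measurable]: "ball z r \<in> sets borel" by simp
  \<comment> \<open>In the modulation norm the inner variable is \<open>x\<close>, so Tonelli brings
    that integral inside; for the Wiener amalgam norm the order is already the right one.\<close>
  define a where "a = (\<lambda>w. \<integral>\<^sup>+x. V x w * indicator (ball z r) x \<partial>lborel)"
  have [measurable]: "a \<in> borel_measurable borel" unfolding a_def by measurable
  have "X = (\<integral>\<^sup>+x. \<integral>\<^sup>+w. V x w * ennreal (y w) * indicator (ball z r) x \<partial>lborel \<partial>lborel)"
    unfolding X_def by (simp add: nn_integral_multc)
  also have "\<dots> = (\<integral>\<^sup>+w. \<integral>\<^sup>+x. V x w * ennreal (y w) * indicator (ball z r) x \<partial>lborel \<partial>lborel)"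
    by (rule lborel_pair.Fubini') measurable
  also have "\<dots> = (\<integral>\<^sup>+w. \<integral>\<^sup>+x. V x w * indicator (ball z r) x * ennreal (y w) \<partial>lborel \<partial>lborel)"
    by (simp add: mult_ac)
  also have "\<dots> = (\<integral>\<^sup>+w. a w * ennreal (y w) \<partial>lborel)"
    unfolding a_def by (simp add: nn_integral_multc)
  finally have X: "X = (\<integral>\<^sup>+w. a w * ennreal (y w) \<partial>lborel)" .
  have "ennreal (1 / c) * X = (\<integral>\<^sup>+w. (ennreal (1 / c) * a w) * ennreal (y w) \<partial>lborel)"
    unfolding X by (subst nn_integral_cmult[symmetric]) (auto simp: mult.assoc)
  also have "\<dots> \<le> ennreal d * Lp_norm q (\<lambda>w. ennreal (1 / c) * a w)" by (rule Y) measurable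
  also have "\<dots> \<le> ennreal d * Lp_norm q (\<lambda>w. Lp_norm p (\<lambda>x. V x w))"
    using B unfolding a_def
    by (intro mult_left_mono Lp_norm_mono q) (auto simp: ennreal_scale_le_iff[OF c])
  finally show "X \<le> ennreal (c * d) * Lp_norm q (\<lambda>w. Lp_norm p (\<lambda>x. V x w))"
    using c d by (simp add: ennreal_scale_le_iff[OF c] ennreal_mult mult.assoc)
  define b where "b = (\<lambda>x. \<integral>\<^sup>+w. V x w * ennreal (y w) \<partial>lborel)"
  have [measurable]: "b \<in> borel_measurable borel" unfolding b_def by measurable
  have Xb: "X = (\<integral>\<^sup>+x. b x * indicator (ball z r) x \<partial>lborel)"
    by (simp only: X_def b_def)
  have "ennreal (1 / d) * X = (\<integral>\<^sup>+x. (ennreal (1 / d) * b x) * indicator (ball z r) x \<partial>lborel)"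
    unfolding Xb by (subst nn_integral_cmult[symmetric]) (auto simp: mult.assoc)
  also have "\<dots> \<le> ennreal c * Lp_norm p (\<lambda>x. ennreal (1 / d) * b x)" by (rule B) measurable
  also have "\<dots> \<le> ennreal c * Lp_norm p (\<lambda>x. Lp_norm q (\<lambda>w. V x w))"
    using Y unfolding b_def
    by (intro mult_left_mono Lp_norm_mono p) (auto simp: ennreal_scale_le_iff[OF d])
  finally have "X \<le> ennreal d * (ennreal c * Lp_norm p (\<lambda>x. Lp_norm q (\<lambda>w. V x w)))"
    by (simp only: ennreal_scale_le_iff[OF d])
  then show "X \<le> ennreal (c * d) * Lp_norm p (\<lambda>x. Lp_norm q (\<lambda>w. V x w))"
    using c d by (simp add: ennreal_mult mult_ac)
qed

subsection \<open>Fourier coefficients of powers of the sine\<close>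

text \<open>For odd \<open>n\<close> this is, up to a constant factor, the \<open>n\<close>-th Fourier coefficient of \<open>sin s |sin s|^(\<beta> - 1)\<close>.\<close>

definition sine_coeff :: "real \<Rightarrow> nat \<Rightarrow> real" where
  "sine_coeff \<beta> n = integral {0..pi} (\<lambda>s. sin s powr \<beta> * sin (real n * s))"

lemma continuous_on_sin_powr:
  "0 < \<beta> \<Longrightarrow> continuous_on {0..pi} (\<lambda>s. sin s powr \<beta>)"
  by (intro continuous_on_powr' continuous_intros) (auto simp: sin_ge_zero)

text \<open>The derivative of \<open>sin s powr (\<beta> + 1) * sin (n * s)\<close> integrates to 0
  over \<open>[0, pi]\<close>, and the addition formulas split it into the harmonics
  \<open>n + 1\<close> and \<open>n - 1\<close>.\<close>

lemma sine_coeff_rec: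
  assumes b: "0 < \<beta>" and n: "1 \<le> n"
  shows "(real n + \<beta> + 1) * sine_coeff \<beta> (n + 1) = (real n - \<beta> - 1) * sine_coeff \<beta> (n - 1)"
proof -
  let ?f = "\<lambda>s. sin s powr (\<beta> + 1) * sin (real n * s)"
  let ?I = "\<lambda>n s. sin s powr \<beta> * sin (real n * s)"
  let ?f' = "\<lambda>s. (1/2) * ((\<beta> + 1 + n) * ?I (n + 1) s + (\<beta> + 1 - n) * ?I (n - 1) s)"
  have int: "?I m integrable_on {0..pi}" for m
    by (intro integrable_continuous_real continuous_on_mult continuous_on_sin_powr b continuous_intros)
  \<comment> \<open>The derivative is computed in the open interval, where \<open>sin s > 0\<close>;
    at the end points continuity is enough.\<close>
  have "(?f' has_integral (?f pi - ?f 0)) {0..pi}"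
  proof (rule fundamental_theorem_of_calculus_interior)
    show "continuous_on {0..pi} ?f"
      using b by (intro continuous_on_mult continuous_on_sin_powr continuous_intros) auto
    fix s :: real assume s: "s \<in> {0<..<pi}"
    then have pos: "sin s > 0" by (simp add: sin_gt_zero)
    have "(?f has_real_derivative
        (\<beta> + 1) * sin s powr \<beta> * cos s * sin (real n * s) + sin s powr (\<beta> + 1) * (cos (real n * s) * real n)) (at s)"
      using pos by (auto intro!: derivative_eq_intros simp: powr_diff field_simps)
    moreover have "(\<beta> + 1) * sin s powr \<beta> * cos s * sin (real n * s) + sin s powr (\<beta> + 1) * (cos (real n * s) * real n) = ?f' s"
    proof -
      have a: "sin (real (n + 1) * s) = sin (real n * s) * cos s + cos (real n * s) * sin s"
        by (simp add: ring_distribs sin_add)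
      have c: "sin (real (n - 1) * s) = sin (real n * s) * cos s - cos (real n * s) * sin s"
        using n by (simp add: of_nat_diff left_diff_distrib sin_diff)
      have d: "sin s powr (\<beta> + 1) = sin s powr \<beta> * sin s"
        using pos by (simp add: powr_add)
      show ?thesis unfolding a c d by (simp add: algebra_simps)
    qed
    ultimately show "(?f has_vector_derivative ?f' s) (at s)"
      by (simp add: has_real_derivative_iff_has_vector_derivative)
  qed simp
  then have "integral {0..pi} ?f' = ?f pi - ?f 0"
    by (rule integral_unique)
  then have "integral {0..pi} ?f' = 0"
    by (simp only: sin_pi sin_zero powr_0 mult_zero_left diff_self)
  moreover have "integral {0..pi} ?f' = (1/2) * ((\<beta> + 1 + n) * sine_coeff \<beta> (n + 1) + (\<beta> + 1 - n) * sine_coeff \<beta> (n - 1))"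
    unfolding sine_coeff_def
    by (simp only: integral_mult_right integral_add integrable_on_mult_right int)
  ultimately show ?thesis by (simp add: algebra_simps)
qed

lemma sine_coeff_1_pos:
  assumes "0 < \<beta>" shows "0 < sine_coeff \<beta> 1"
proof -
  let ?f = "\<lambda>s. sin s powr \<beta> * sin (real 1 * s)"
  have c: "continuous_on {0..pi} ?f"
    by (intro continuous_on_mult continuous_on_sin_powr assms continuous_intros)
  have nn: "\<And>s. s \<in> {0..pi} \<Longrightarrow> 0 \<le> ?f s"
    by (rule mult_nonneg_nonneg) (simp_all add: sin_ge_zero)
  have "integral {0..pi} ?f \<noteq> 0"
  proof
    assume "integral {0..pi} ?f = 0"
    then have "\<forall>s\<in>{0..pi}. ?f s = 0"
      by (subst (asm) integral_eq_0_iff[OF c]) (use nn in simp_all)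
    then have "?f (pi/2) = 0" by (rule bspec) simp
    then show False by simp
  qed
  moreover have "0 \<le> integral {0..pi} ?f"
    by (intro integral_nonneg integrable_continuous_real c nn)
  ultimately show ?thesis by (simp add: sine_coeff_def)
qed

lemma sine_coeff_odd_rec:
  assumes "0 < \<alpha>"
  shows "(2 * real m + 4 + \<alpha>) * sine_coeff (1 + \<alpha>) (2 * Suc m + 1) = (2 * real m - \<alpha>) * sine_coeff (1 + \<alpha>) (2 * m + 1)"
  using sine_coeff_rec[of "1 + \<alpha>" "2 * m + 2"] assms by (simp add: algebra_simps)

lemma sine_coeff_odd_nonzero:
  assumes "\<alpha> \<in> {0<..} - {2 * real n | n. n \<ge> 1}"
  shows "sine_coeff (1 + \<alpha>) (2 * m + 1) \<noteq> 0"
proof (induction m)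
  case 0
  then show ?case using sine_coeff_1_pos[of "1 + \<alpha>"] assms by auto
next
  case (Suc m)
  \<comment> \<open>The factor in the recursion vanishes only for an even integer
    \<open>\<alpha>\<close>; the case \<open>m = 0\<close> is excluded by
    \<open>0 < \<alpha>\<close>.\<close>
  have "2 * real m \<noteq> \<alpha>"
    using assms by (cases "m = 0") auto
  then show ?case using sine_coeff_odd_rec[of \<alpha> m] assms Suc by auto
qed

text \<open>The ratio in \<open>sine_coeff_odd_rec\<close> tends to 1, so from some
  \<open>m0\<close> on its modulus is at least \<open>r\<close>. A step costs the coefficient at
  most a factor \<open>r\<close> but advances \<open>n\<close> by 2, so the target shrinks by
  \<open>r^2\<close>; the spare factor \<open>r\<close> per step eventually beats
  \<open>D\<close>.\<close>

lemma sine_coeff_subexponential: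
  assumes \<alpha>: "\<alpha> \<in> {0<..} - {2 * real n | n. n \<ge> 1}" and r: "0 < r" "r < 1"
  obtains n where "odd n" "D * r ^ n < \<bar>sine_coeff (1 + \<alpha>) n\<bar>"
proof -
  let ?J = "\<lambda>m. \<bar>sine_coeff (1 + \<alpha>) (2 * m + 1)\<bar>"
  have a0: "0 < \<alpha>" using \<alpha> by auto
  \<comment> \<open>The threshold solves
    \<open>r * (2 * m + 4 + \<alpha>) \<le> 2 * m - \<alpha>\<close> for \<open>m\<close>.\<close>
  obtain m0 :: nat where m0: "real m0 \<ge> (\<alpha> + r * (4 + \<alpha>)) / (2 * (1 - r))"
    using real_arch_simple by blast
  have step: "r * ?J m \<le> ?J (Suc m)" if "m0 \<le> m" for m
  proof -
    have "(\<alpha> + r * (4 + \<alpha>)) / (2 * (1 - r)) \<le> real m"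
      by (rule order_trans[OF m0]) (use that in simp)
    then have "\<alpha> + r * (4 + \<alpha>) \<le> real m * (2 * (1 - r))"
      using r by (subst (asm) pos_divide_le_eq) auto
    then have m: "r * (2 * real m + 4 + \<alpha>) \<le> 2 * real m - \<alpha>"
      by (simp add: algebra_simps)
    have "0 \<le> 2 * real m - \<alpha>" using r a0 by (intro order_trans[OF _ m]) auto
    then have "r * (2 * real m + 4 + \<alpha>) * ?J m \<le> \<bar>2 * real m - \<alpha>\<bar> * ?J m"
      using m by (intro mult_right_mono) auto
    also have "\<dots> = (2 * real m + 4 + \<alpha>) * ?J (Suc m)"
    proof -
      have "(2 * real m + 4 + \<alpha>) * ?J (Suc m) = \<bar>(2 * real m + 4 + \<alpha>) * sine_coeff (1 + \<alpha>) (2 * Suc m + 1)\<bar>"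
        using a0 by (simp add: abs_mult)
      then show ?thesis unfolding sine_coeff_odd_rec[OF a0] abs_mult by simp
    qed
    finally have "(2 * real m + 4 + \<alpha>) * (r * ?J m) \<le> (2 * real m + 4 + \<alpha>) * ?J (Suc m)"
      by (simp add: mult_ac)
    then show ?thesis using a0 by (subst (asm) mult_le_cancel_left_pos) auto
  qed
  have low: "r ^ k * ?J m0 \<le> ?J (m0 + k)" for k
  proof (induction k)
    case (Suc k)
    have "r ^ Suc k * ?J m0 \<le> r * ?J (m0 + k)"
      using mult_left_mono[OF Suc, of r] r by (simp add: mult_ac)
    also have "\<dots> \<le> ?J (m0 + Suc k)" using step[of "m0 + k"] by simp
    finally show ?case .
  qed simp
  have "(\<lambda>k. D * r ^ (2 * m0 + 1) * r ^ k) \<longlonglongrightarrow> D * r ^ (2 * m0 + 1) * 0"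
    using r by (intro tendsto_intros LIMSEQ_power_zero) auto
  then have "eventually (\<lambda>k. D * r ^ (2 * m0 + 1) * r ^ k < ?J m0) sequentially"
    using sine_coeff_odd_nonzero[OF \<alpha>, of m0] by (intro order_tendstoD(2)) auto
  then obtain k where k: "D * r ^ (2 * m0 + 1) * r ^ k < ?J m0"
    by (auto simp: eventually_sequentially)
  have "D * r ^ (2 * (m0 + k) + 1) = r ^ k * (D * r ^ (2 * m0 + 1) * r ^ k)"
    by (simp add: power_add power_mult power2_eq_square power_mult_distrib mult_ac)
  also have "\<dots> < r ^ k * ?J m0"
    using k r by (intro mult_strict_left_mono) auto
  also have "\<dots> \<le> ?J (m0 + k)" by (rule low)
  finally show ?thesis
    by (intro that[of "2 * (m0 + k) + 1"]) auto
qed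

text \<open>For an antiderivative \<open>Q\<close>, the difference \<open>Q (k + T) - Q k\<close>
  has derivative \<open>P (k + T) - P k = 0\<close> in \<open>k\<close> and is therefore
  constant.\<close>

lemma integral_periodic_shift:
  fixes P :: "real \<Rightarrow> complex"
  assumes P: "continuous_on UNIV P" and per: "\<And>x. P (x + T) = P x" and T: "0 \<le> T"
  shows "integral {0..T} (\<lambda>s. P (h + s)) = integral {0..T} P"
proof -
  \<comment> \<open>The margins keep \<open>k\<close> and \<open>k + T\<close> in the open interval
    where \<open>Q\<close> is differentiable, for all \<open>k\<close> in a neighbourhood of the
    segment from \<open>- \<bar>h\<bar>\<close> to \<open>\<bar>h\<bar>\<close>.\<close>
  define a where "a = - \<bar>h\<bar> - 1"
  define b where "b = \<bar>h\<bar> + T + 1"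
  obtain Q where Q: "\<And>x. x \<in> {a..b} \<Longrightarrow> (Q has_vector_derivative P x) (at x within {a..b})"
    using antiderivative_continuous[of a b P] continuous_on_subset[OF P] by auto
  have Q': "(Q has_vector_derivative P x) (at x)" if "a < x" "x < b" for x
    using Q[of x] at_within_interior[of x "{a..b}"] that by auto
  have Qs: "((\<lambda>s. Q (s + k)) has_vector_derivative P (x + k)) (at x)" if "a < x + k" "x + k < b" for x k
  proof -
    have "((\<lambda>s. s + k) has_vector_derivative 1) (at x)"
      by (auto intro!: derivative_eq_intros)
    from vector_diff_chain_at[OF this Q'[OF that]] show ?thesis by (simp add: o_def)
  qed
  have shift: "integral {0..T} (\<lambda>s. P (k + s)) = Q (k + T) - Q k" if "\<bar>k\<bar> \<le> \<bar>h\<bar>" for k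
  proof (rule integral_unique)
    have "((\<lambda>s. P (s + k)) has_integral Q (T + k) - Q (0 + k)) {0..T}"
    proof (rule fundamental_theorem_of_calculus[OF T])
      fix s assume s: "s \<in> {0..T}"
      show "((\<lambda>s. Q (s + k)) has_vector_derivative P (s + k)) (at s within {0..T})"
        by (rule has_vector_derivative_at_within, rule Qs)
           (use s that T in \<open>auto simp: a_def b_def\<close>)
    qed
    then show "((\<lambda>s. P (k + s)) has_integral Q (k + T) - Q k) {0..T}"
      by (simp add: add.commute)
  qed
  have "Q (h + T) - Q (h + 0) = Q (0 + T) - Q (0 + 0)"
  proof (rule has_derivative_zero_unique_connected[of "{-\<bar>h\<bar>-1/2<..<\<bar>h\<bar>+1/2}" "\<lambda>k. Q (k + T) - Q (k + 0)"])
    fix x assume x: "x \<in> {-\<bar>h\<bar>-1/2<..<\<bar>h\<bar>+1/2}"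
    have "((\<lambda>k. Q (k + T) - Q (k + 0)) has_vector_derivative P (x + T) - P (x + 0)) (at x)"
      by (intro has_vector_derivative_diff Qs) (use x T in \<open>auto simp: a_def b_def\<close>)
    then show "((\<lambda>k. Q (k + T) - Q (k + 0)) has_derivative (\<lambda>k. 0)) (at x)"
      by (simp add: per has_vector_derivative_def)
  qed auto
  then show ?thesis using shift[of h] shift[of 0] by simp
qed

definition sin_pow :: "real \<Rightarrow> real \<Rightarrow> real" where
  "sin_pow \<alpha> s = sin s * \<bar>sin s\<bar> powr \<alpha>"

lemma sin_pow_continuous: "0 < \<alpha> \<Longrightarrow> continuous_on S (sin_pow \<alpha>)"
  unfolding sin_pow_def
  by (intro continuous_intros continuous_on_powr') auto

lemma sin_pow_bounded: "0 < \<alpha> \<Longrightarrow> \<bar>sin_pow \<alpha> s\<bar> \<le> 1"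
  unfolding sin_pow_def abs_mult
  using mult_mono[of "\<bar>sin s\<bar>" 1 "\<bar>sin s\<bar> powr \<alpha>" 1] powr_mono2[of \<alpha> "\<bar>sin s\<bar>" 1] by simp

lemma sin_pow_add_pi: "sin_pow \<alpha> (s + pi) = - sin_pow \<alpha> s"
  by (simp add: sin_pow_def)

text \<open>This is \<open>2 * pi\<close> times the usual Fourier coefficient of
  \<open>sin_pow \<alpha>\<close>, the function called \<open>G\<close> in the overview.\<close>

definition sin_pow_coeff :: "real \<Rightarrow> nat \<Rightarrow> complex" where
  "sin_pow_coeff \<alpha> n = integral {0..2 * pi} (\<lambda>s. sin_pow \<alpha> s * cis (- (real n * s)))"

text \<open>Over a full period the shift by \<open>h\<close> can be moved from the function into the
  character, where it becomes a unimodular factor.\<close>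

lemma sin_pow_coeff_modulated:
  assumes "0 < \<alpha>"
  shows "integral {0..2 * pi} (\<lambda>s. sin_pow \<alpha> (h + s) * cis (- (real n * s))) = cis (real n * h) * sin_pow_coeff \<alpha> n"
proof -
  define P where "P = (\<lambda>s. complex_of_real (sin_pow \<alpha> s) * cis (- (real n * s)))"
  have "integral {0..2 * pi} (\<lambda>s. P (h + s)) = integral {0..2 * pi} P"
  proof (rule integral_periodic_shift)
    show "continuous_on UNIV P"
      unfolding P_def by (intro continuous_intros sin_pow_continuous assms)
    have "cis (- (real n * (x + 2 * pi))) = cis (- (real n * x))" for x
    proof -
      have "cis (- (real n * (x + 2 * pi))) = cis (- (real n * x)) * cis (2 * pi * real_of_int (- int n))"
        by (simp add: cis_mult algebra_simps)
      then show ?thesis by (subst (asm) cis_multiple_2pi) auto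
    qed
    then show "P (x + 2 * pi) = P x" for x
      by (simp add: P_def sin_pow_def)
  qed simp
  moreover have "complex_of_real (sin_pow \<alpha> (h + s)) * cis (- (real n * s)) = cis (real n * h) * P (h + s)" for s
    by (simp add: P_def cis_mult algebra_simps)
  ultimately show ?thesis
    by (simp add: sin_pow_coeff_def P_def[symmetric] flip: P_def)
qed

text \<open>For odd \<open>n\<close> both factors of the integrand change sign under the shift by
  \<open>pi\<close>, so the two half periods contribute equally. On \<open>[0, pi]\<close>, where
  the sine is nonnegative, the imaginary part is minus the sine integral.\<close>

lemma sin_pow_coeff_ge:
  assumes "0 < \<alpha>" "odd n"
  shows "2 * \<bar>sine_coeff (1 + \<alpha>) n\<bar> \<le> norm (sin_pow_coeff \<alpha> n)"
proof -
  define P where "P = (\<lambda>s. complex_of_real (sin_pow \<alpha> s) * cis (- (real n * s)))"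
  have c: "continuous_on S P" for S
    unfolding P_def by (intro continuous_intros sin_pow_continuous assms)
  have cisn: "cis (- (real n * (s + pi))) = - cis (- (real n * s))" for s
  proof -
    have "cis (- (real n * (s + pi))) = cis (- (real n * s)) * cis (- (pi * real n))"
      by (simp add: cis_mult algebra_simps)
    moreover have "cis (- (pi * real n)) = - 1"
      using assms(2) by (simp add: complex_eq_iff mult.commute[of pi] cos_npi)
    ultimately show ?thesis by simp
  qed
  have "integral {pi..2 * pi} P = integral {0..pi} (\<lambda>s. P (s + pi))"
    using integral_shift_real_ivl[of pi pi "2 * pi" P] by simp
  also have "(\<lambda>s. P (s + pi)) = P"
    by (simp add: P_def sin_pow_add_pi cisn fun_eq_iff)
  finally have "sin_pow_coeff \<alpha> n = 2 * integral {0..pi} P"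
    using Henstock_Kurzweil_Integration.integral_combine[of 0 pi "2*pi" P] integrable_continuous_real[OF c]
    by (simp add: sin_pow_coeff_def P_def)
  moreover have "Im (integral {0..pi} P) = - sine_coeff (1 + \<alpha>) n"
  proof -
    have "Im (integral {0..pi} P) = integral {0..pi} (\<lambda>s. Im (P s))"
      using integral_linear[OF integrable_continuous_real[OF c] bounded_linear_Im] by (simp add: o_def)
    also have "\<dots> = integral {0..pi} (\<lambda>s. - (sin s powr (1 + \<alpha>) * sin (real n * s)))"
    proof (rule Henstock_Kurzweil_Integration.integral_cong)
      fix s assume "s \<in> {0..pi}"
      then have "0 \<le> sin s" by (simp add: sin_ge_zero)
      then show "Im (P s) = - (sin s powr (1 + \<alpha>) * sin (real n * s))"
        by (simp add: P_def sin_pow_def powr_add)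
    qed
    finally show ?thesis by (simp add: sine_coeff_def)
  qed
  ultimately show ?thesis
    using abs_Im_le_cmod[of "integral {0..pi} P"] by (simp add: norm_mult)
qed

subsection \<open>Pieces of large norm\<close>

lemma sin_pow_measurable: "0 < \<alpha> \<Longrightarrow> sin_pow \<alpha> \<in> borel_measurable borel"
  by (intro borel_measurable_continuous_onI sin_pow_continuous)

text \<open>Averaging over the phase \<open>s\<close> against \<open>cis (- n s)\<close> turns \<open>sin_pow \<alpha> (h t + s)\<close> into a multiple of \<open>cis (n h t)\<close>.\<close>

lemma exists_phase:
  fixes \<Theta> :: "'a::euclidean_space \<Rightarrow> complex" and h :: "'a \<Rightarrow> real"
  assumes \<alpha>: "0 < \<alpha>" and \<Theta>: "integrable lborel \<Theta>" and h [measurable]: "h \<in> borel_measurable borel"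
    and nz: "sin_pow_coeff \<alpha> n \<noteq> 0" "(LBINT t. \<Theta> t) \<noteq> 0"
  obtains s where "norm (sin_pow_coeff \<alpha> n) * norm (LBINT t. \<Theta> t)
    \<le> 4 * pi * norm (LBINT t. \<Theta> t * (complex_of_real (sin_pow \<alpha> (h t + s)) * cis (- (real n * h t))))"
proof (rule ccontr)
  define K where "K = norm (sin_pow_coeff \<alpha> n) * norm (LBINT t. \<Theta> t)"
  define P where "P = (\<lambda>s. LBINT t. \<Theta> t * (complex_of_real (sin_pow \<alpha> (h t + s)) * cis (- (real n * h t))))"
  have K: "0 < K" using nz by (simp add: K_def)
  assume not: "\<not> thesis"
  \<comment> \<open>\<open>4 * pi\<close> is twice the length of the period: integrating this bound
    over \<open>s\<close> yields \<open>K \<le> K / 2\<close>, a contradiction already from weak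
    inequalities between integrals.\<close>
  have Pb: "norm (P s) < K / (4 * pi)" for s
  proof (rule ccontr)
    assume "\<not> norm (P s) < K / (4 * pi)"
    then have "K / (4 * pi) \<le> norm (P s)" by (rule leI)
    then have "K \<le> norm (P s) * (4 * pi)" by (subst (asm) pos_divide_le_eq) auto
    then have "K \<le> 4 * pi * norm (P s)" by (simp only: mult.commute)
    from that[OF this[unfolded K_def P_def]] not show False by contradiction
  qed
  note sin_pow_measurable[OF \<alpha>, measurable]
  have [measurable]: "\<Theta> \<in> borel_measurable borel" using borel_measurable_integrable[OF \<Theta>] by simp
  let ?I = "{0..2 * pi}"
  let ?F = "\<lambda>t s. \<Theta> t * (indicator ?I s * (complex_of_real (sin_pow \<alpha> (h t + s)) * cis (- (real n * s)) * cis (- (real n * h t))))"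
  have fb: "norm (?F t s) \<le> norm (\<Theta> t) * indicator ?I s" for t s
    using sin_pow_bounded[OF \<alpha>, of "h t + s"] by (auto simp: norm_mult indicator_def mult_left_le)
  have ii: "integrable lborel (indicator ?I :: real \<Rightarrow> real)"
    by (intro integrable_real_indicator) auto
  have int: "integrable (lborel \<Otimes>\<^sub>M lborel) (\<lambda>(t, s). ?F t s)"
    by (rule integrable_pair_dominated[OF _ fb integrable_norm[OF \<Theta>] ii]) measurable
  have "(LBINT s. ?F t s) = \<Theta> t * sin_pow_coeff \<alpha> n" for t
  proof -
    have c: "continuous_on ?I (\<lambda>s. complex_of_real (sin_pow \<alpha> (h t + s)) * cis (- (real n * s)))"
      by (intro continuous_intros continuous_on_compose2[OF sin_pow_continuous[OF \<alpha>, of UNIV]]) auto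
    have "set_integrable lborel ?I (\<lambda>s. complex_of_real (sin_pow \<alpha> (h t + s)) * cis (- (real n * s)))"
      unfolding set_integrable_def by (rule borel_integrable_compact[OF _ c]) simp
    from set_borel_integral_eq_integral(2)[OF this]
    have "(LBINT s. indicator ?I s * (complex_of_real (sin_pow \<alpha> (h t + s)) * cis (- (real n * s)))) = cis (real n * h t) * sin_pow_coeff \<alpha> n"
      unfolding sin_pow_coeff_modulated[OF \<alpha>] by (simp add: set_lebesgue_integral_def scaleR_conv_of_real of_real_indicator)
    moreover have "?F t s = (\<Theta> t * cis (- (real n * h t))) * (indicator ?I s * (complex_of_real (sin_pow \<alpha> (h t + s)) * cis (- (real n * s))))" for s
      by (simp add: mult_ac)
    ultimately have "(LBINT s. ?F t s) = (\<Theta> t * cis (- (real n * h t))) * (cis (real n * h t) * sin_pow_coeff \<alpha> n)"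
      by (simp only: integral_mult_right_zero)
    also have "\<dots> = \<Theta> t * (cis (- (real n * h t)) * cis (real n * h t)) * sin_pow_coeff \<alpha> n" by (simp only: mult_ac)
    finally show ?thesis by (simp add: cis_mult)
  qed
  then have "(LBINT t. LBINT s. ?F t s) = (LBINT t. \<Theta> t) * sin_pow_coeff \<alpha> n"
    by (simp only: integral_mult_left_zero)
  then have Ks: "K = norm (LBINT s. LBINT t. ?F t s)"
    using lborel_pair.Fubini_integral[OF int] by (simp add: K_def norm_mult mult.commute)
  have FP: "(LBINT t. ?F t s) = (indicator ?I s * cis (- (real n * s))) * P s" for s
    unfolding P_def integral_mult_right_zero[symmetric] by (simp add: mult_ac)
  have "norm (LBINT s. (indicator ?I s * cis (- (real n * s))) * P s) \<le> (LBINT s. K / (4 * pi) * indicator ?I s)"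
  proof (rule Bochner_Integration.integral_norm_bound_integral)
    have le: "norm ((indicator ?I s * cis (- (real n * s))) * P s) \<le> K / (4 * pi) * indicator ?I s" for s
      using Pb[of s] by (auto simp: norm_mult indicator_def)
    then show "\<And>s. norm ((indicator ?I s * cis (- (real n * s))) * P s) \<le> K / (4 * pi) * indicator ?I s" .
    show ik: "integrable lborel (\<lambda>s. K / (4 * pi) * indicator ?I s :: real)"
      using ii by (rule integrable_mult_right)
    have "P \<in> borel_measurable borel"
    proof -
      have "(\<lambda>s. LBINT t. \<Theta> t * (complex_of_real (sin_pow \<alpha> (h t + s)) * cis (- (real n * h t)))) \<in> borel_measurable lborel"
        by measurable
      then show ?thesis by (simp add: P_def)
    qed
    then have [measurable]: "P \<in> borel_measurable borel" .
    show "integrable lborel (\<lambda>s. (indicator ?I s * cis (- (real n * s))) * P s)"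
    proof (rule Bochner_Integration.integrable_bound[OF ik])
      show "AE s in lborel. norm ((indicator ?I s * cis (- (real n * s))) * P s) \<le> norm (K / (4 * pi) * indicator ?I s :: real)"
        by (intro AE_I2 order_trans[OF le]) (simp only: real_norm_def abs_ge_self)
    qed measurable
  qed
  also have "\<dots> = K / 2" by simp
  finally have "K \<le> K / 2" unfolding Ks FP .
  then show False using K by simp
qed

section \<open>Windows averaged over a ball of positions\<close>

definition window_avg :: "('a::euclidean_space \<Rightarrow> complex) \<Rightarrow> 'a \<Rightarrow> real \<Rightarrow> 'a \<Rightarrow> complex" where
  "window_avg g c r t = (LBINT x. indicator (ball c r) x * cnj (g (t - x)))"

lemma window_avg_shift: "window_avg g (c + y) r t = window_avg g c r (t - y)"
proof -
  have "window_avg g (c + y) r t = (LBINT x. indicator (ball (c + y) r) (x + y) * cnj (g (t - (x + y))))"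
    unfolding window_avg_def by (rule integral_lborel_translate[symmetric])
  also have "\<dots> = window_avg g c r (t - y)"
    unfolding window_avg_def
    by (intro Bochner_Integration.integral_cong) (auto simp: indicator_def dist_norm algebra_simps)
  finally show ?thesis .
qed

lemma window_avg_measurable [measurable]:
  assumes [measurable]: "g \<in> borel_measurable borel"
  shows "window_avg g c r \<in> borel_measurable borel"
proof -
  have [measurable]: "ball c r \<in> sets borel" by simp
  have "(\<lambda>t. LBINT x. indicator (ball c r) x * cnj (g (t - x))) \<in> borel_measurable lborel"
    by measurable
  then show ?thesis unfolding window_avg_def by simp
qed

lemma integrable_indicator_ball: "integrable lborel (indicator (ball (c::'a::euclidean_space) r) :: 'a \<Rightarrow> real)"
  using emeasure_bounded_finite[OF bounded_ball[of c r]] by (intro integrable_real_indicator) auto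

lemma window_avg_integrable:
  fixes g :: "'a::euclidean_space \<Rightarrow> complex"
  assumes [measurable]: "g \<in> borel_measurable borel" and b: "\<And>x. norm (g x) \<le> C"
  shows "integrable lborel (\<lambda>x. indicator (ball c r) x * cnj (g (t - x)))"
    and "norm (window_avg g c r t) \<le> C * measure lborel (ball c r)"
proof -
  have [measurable]: "ball c r \<in> sets borel" by simp
  have le: "norm (indicator (ball c r) x * cnj (g (t - x))) \<le> C * indicator (ball c r) x" for x
    using b[of "t - x"] by (simp add: norm_mult indicator_def)
  show i: "integrable lborel (\<lambda>x. indicator (ball c r) x * cnj (g (t - x)))"
  proof (rule Bochner_Integration.integrable_bound[OF integrable_mult_right[OF integrable_indicator_ball[of c r], of C]])
    show "(\<lambda>x. indicator (ball c r) x * cnj (g (t - x))) \<in> borel_measurable lborel" by measurable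
  qed (intro AE_I2 order_trans[OF le], simp)
  have "norm (window_avg g c r t) \<le> (LBINT x. C * indicator (ball c r) x)"
    unfolding window_avg_def
    by (rule Bochner_Integration.integral_norm_bound_integral[OF i integrable_mult_right[OF integrable_indicator_ball] le])
  then show "norm (window_avg g c r t) \<le> C * measure lborel (ball c r)" by simp
qed

text \<open>Near \<open>y0\<close> the values of \<open>g\<close> stay in a half plane around
  \<open>g y0\<close>, so averaging them cannot cancel. The radius \<open>2 * r\<close> allows both
  \<open>t\<close> and the window position to vary by \<open>r\<close>; \<open>r \<le> 1\<close>
  keeps the bump at most 1.\<close>

lemma window_point:
  fixes g :: "'a::euclidean_space \<Rightarrow> complex"
  assumes g: "continuous_on UNIV g" "g \<noteq> (\<lambda>x. 0)"
  obtains y0 r where "0 < r" "r \<le> 1" "g y0 \<noteq> 0"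
    "\<And>z. norm (z - y0) < 2 * r \<Longrightarrow> (norm (g y0))\<^sup>2 / 2 \<le> Re (cnj (g z) * g y0)"
proof -
  obtain y0 where y0: "g y0 \<noteq> 0" using g(2) by auto
  let ?f = "\<lambda>z. Re (cnj (g z) * g y0)"
  have "g \<midarrow>y0\<rightarrow> g y0"
    using g(1) by (simp add: continuous_on_eq_continuous_at isCont_def)
  then have "?f \<midarrow>y0\<rightarrow> ?f y0"
    by (intro tendsto_Re tendsto_mult tendsto_cnj tendsto_const)
  moreover have f0: "?f y0 = (norm (g y0))\<^sup>2"
    by (simp only: cmod_power2) (simp add: power2_eq_square)
  ultimately have "eventually (\<lambda>z. (norm (g y0))\<^sup>2 / 2 < ?f z) (at y0)"
    using y0 by (intro order_tendstoD(1)) auto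
  then obtain \<rho> where \<rho>: "0 < \<rho>" "\<And>z. z \<noteq> y0 \<Longrightarrow> dist z y0 < \<rho> \<Longrightarrow> (norm (g y0))\<^sup>2 / 2 < ?f z"
    unfolding eventually_at by auto
  show ?thesis
  proof (rule that[of "min 1 (\<rho> / 2)" y0])
    fix z assume "norm (z - y0) < 2 * min 1 (\<rho> / 2)"
    then have "dist z y0 < \<rho>" by (auto simp: dist_norm)
    then show "(norm (g y0))\<^sup>2 / 2 \<le> ?f z"
      using \<rho>(2)[of z] f0 by (cases "z = y0") auto
  qed (use \<rho> y0 in auto)
qed

text \<open>With \<open>\<beta> = 1 + \<alpha>\<close> this is the amplitude of the nonlinear image,
  times the bump of the test function, times the averaged window. The centre \<open>- y0\<close>
  puts \<open>t - x\<close> near \<open>y0\<close>, where \<open>g\<close> does not vanish.\<close>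

definition pairing_density :: "('a::euclidean_space \<Rightarrow> complex) \<Rightarrow> 'a \<Rightarrow> real \<Rightarrow> nat \<Rightarrow> real \<Rightarrow> 'a \<Rightarrow> complex" where
  "pairing_density g y0 r N \<beta> t = complex_of_real (bump r N t powr \<beta> * bump r N t) * window_avg g (- y0) r t"

lemma bump_measurable [measurable]: "bump r N \<in> borel_measurable borel"
  by (intro borel_measurable_continuous_onI bump_continuous)

lemma pairing_density_integrable:
  fixes g :: "'a::euclidean_space \<Rightarrow> complex"
  assumes [measurable]: "g \<in> borel_measurable borel" and b: "\<And>x. norm (g x) \<le> C"
    and r: "0 < r" "r \<le> 1" and N: "0 < N" and \<beta>: "0 < \<beta>"
  shows "integrable lborel (pairing_density g y0 r N \<beta>)"
proof (rule integrable_bounded_support)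
  show "pairing_density g y0 r N \<beta> \<in> borel_measurable borel"
    unfolding pairing_density_def by measurable
  show "norm (pairing_density g y0 r N \<beta> t) \<le> 1 * (C * measure lborel (ball (- y0) r))" for t
  proof -
    have "bump r N t powr \<beta> \<le> 1"
      using bump_le_1[of r N t] bump_nonneg[of r N t] r \<beta> powr_mono2[of \<beta> "bump r N t" 1] by simp
    then have "bump r N t powr \<beta> * bump r N t \<le> 1 * 1"
      using bump_le_1[of r N t] bump_nonneg[of r N t] r by (intro mult_mono) auto
    moreover have "0 \<le> bump r N t powr \<beta> * bump r N t" using bump_nonneg[of r N t] by simp
    ultimately have "norm (complex_of_real (bump r N t powr \<beta> * bump r N t)) \<le> 1"
      by (simp only: norm_of_real abs_of_nonneg mult_1)
    then show ?thesis unfolding pairing_density_def norm_mult[of _ "window_avg g (- y0) r t"]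
      by (intro mult_mono window_avg_integrable(2)[OF _ b]) auto
  qed
  show "pairing_density g y0 r N \<beta> t = 0" if "t \<notin> cball 0 r" for t
    using that r N by (simp add: pairing_density_def bump_eq_0)
qed

text \<open>After multiplication by \<open>g y0\<close> the averaged window has positive real part
  on the ball of radius \<open>r\<close>, so nothing cancels. The ball of radius
  \<open>r / 2\<close>, where the bump is bounded below as well, makes the integral strictly
  positive.\<close>

lemma pairing_density_integral_nonzero:
  fixes g :: "'a::euclidean_space \<Rightarrow> complex"
  assumes gm: "g \<in> borel_measurable borel" and b: "\<And>x. norm (g x) \<le> C"
    and r: "0 < r" "r \<le> 1" and N: "0 < N" and \<beta>: "0 < \<beta>" and y0: "g y0 \<noteq> 0"
    and pt: "\<And>z. norm (z - y0) < 2 * r \<Longrightarrow> (norm (g y0))\<^sup>2 / 2 \<le> Re (cnj (g z) * g y0)"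
  shows "(LBINT t. pairing_density g y0 r N \<beta> t) \<noteq> 0"
proof -
  let ?B = "ball (- y0) r"
  let ?\<phi> = "bump r N :: 'a \<Rightarrow> real"
  \<comment> \<open>A lower bound for the bump on the half ball, since
    \<open>r^2 - (r / 2)^2 = 3 / 4 * r^2\<close>.\<close>
  define m where "m = (3 / 4 * r\<^sup>2) ^ N"
  define L where "L = (norm (g y0))\<^sup>2 / 2 * measure lborel ?B"
  have m: "0 < m" using r by (simp add: m_def)
  have L: "0 < L" using y0 r by (simp add: L_def content_ball_pos)
  have int: "integrable lborel (pairing_density g y0 r N \<beta>)"
    by (rule pairing_density_integrable[OF gm b r N \<beta>])
  have avg: "L \<le> Re (window_avg g (- y0) r t * g y0)" if t: "norm t < r" for t
  proof -
    have wi: "integrable lborel (\<lambda>x. indicator ?B x * cnj (g (t - x)))"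
      by (rule window_avg_integrable(1)[OF gm b])
    have "L = (LBINT x. (norm (g y0))\<^sup>2 / 2 * indicator ?B x)" by (simp add: L_def)
    also have "\<dots> \<le> (LBINT x. Re (indicator ?B x * cnj (g (t - x)) * g y0))"
    proof (rule Bochner_Integration.integral_mono)
      show "integrable lborel (\<lambda>x. (norm (g y0))\<^sup>2 / 2 * indicator ?B x)"
        by (rule integrable_mult_right[OF integrable_indicator_ball])
      show "integrable lborel (\<lambda>x. Re (indicator ?B x * cnj (g (t - x)) * g y0))"
        by (intro integrable_Re integrable_mult_left wi)
      show "(norm (g y0))\<^sup>2 / 2 * indicator ?B x \<le> Re (indicator ?B x * cnj (g (t - x)) * g y0)" for x
      proof (cases "x \<in> ?B")
        case True
        then have "norm (x + y0) < r" by (simp add: dist_norm norm_minus_commute[of "- y0" x])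
        moreover have "norm (t - x - y0) \<le> norm t + norm (x + y0)"
          using norm_triangle_ineq4[of t "x + y0"] by (simp add: diff_diff_eq)
        ultimately have "norm (t - x - y0) < 2 * r" using t by linarith
        from pt[OF this] True show ?thesis by simp
      qed simp
    qed
    also have "\<dots> = Re (LBINT x. indicator ?B x * cnj (g (t - x)) * g y0)"
      by (intro integral_Re integrable_mult_left wi)
    also have "\<dots> = Re (window_avg g (- y0) r t * g y0)"
      unfolding window_avg_def by (simp only: integral_mult_left_zero)
    finally show ?thesis .
  qed
  have "0 < m powr \<beta> * m * L * measure lborel (ball (0::'a) (r / 2))"
    using m L r by (simp add: content_ball_pos)
  also have "\<dots> = (LBINT t. m powr \<beta> * m * L * indicator (ball (0::'a) (r / 2)) t)"
    by simp
  also have "\<dots> \<le> (LBINT t. Re (pairing_density g y0 r N \<beta> t * g y0))"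
  proof (rule Bochner_Integration.integral_mono)
    show "integrable lborel (\<lambda>t. m powr \<beta> * m * L * indicator (ball (0::'a) (r / 2)) t)"
      by (rule integrable_mult_right[OF integrable_indicator_ball])
    show "integrable lborel (\<lambda>t. Re (pairing_density g y0 r N \<beta> t * g y0))"
      by (intro integrable_Re integrable_mult_left int)
    fix t :: 'a
    have e: "Re (pairing_density g y0 r N \<beta> t * g y0) = (?\<phi> t powr \<beta> * ?\<phi> t) * Re (window_avg g (- y0) r t * g y0)"
      unfolding pairing_density_def by (simp add: mult.assoc)
    have \<phi>0: "0 \<le> ?\<phi> t powr \<beta> * ?\<phi> t" using bump_nonneg[of r N t] by simp
    show "m powr \<beta> * m * L * indicator (ball (0::'a) (r / 2)) t \<le> Re (pairing_density g y0 r N \<beta> t * g y0)"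
    proof (cases "t \<in> ball 0 (r / 2)")
      case True
      then have nt: "norm t < r / 2" by simp
      then have "(norm t)\<^sup>2 \<le> (r / 2)\<^sup>2" by (intro power_mono) auto
      then have "3 / 4 * r\<^sup>2 \<le> max 0 (r\<^sup>2 - (norm t)\<^sup>2)" by (simp add: power_divide le_max_iff_disj)
      then have mb: "m \<le> ?\<phi> t" unfolding m_def bump_def using r by (intro power_mono) auto
      have "m powr \<beta> * m * L \<le> (?\<phi> t powr \<beta> * ?\<phi> t) * Re (window_avg g (- y0) r t * g y0)"
        using m mb L \<beta> nt r \<phi>0 by (intro mult_mono powr_mono2 avg) auto
      with True show ?thesis unfolding e by simp
    next
      case False
      have "0 \<le> (?\<phi> t powr \<beta> * ?\<phi> t) * Re (window_avg g (- y0) r t * g y0)"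
      proof (cases "norm t < r")
        case True
        then show ?thesis using avg[OF True] L by (intro mult_nonneg_nonneg[OF \<phi>0]) linarith
      next
        case False
        then show ?thesis using r N by (simp add: bump_eq_0)
      qed
      with False show ?thesis unfolding e by simp
    qed
  qed
  also have "\<dots> = Re ((LBINT t. pairing_density g y0 r N \<beta> t) * g y0)"
  proof -
    have "(LBINT t. Re (pairing_density g y0 r N \<beta> t * g y0)) = Re (LBINT t. pairing_density g y0 r N \<beta> t * g y0)"
      by (intro integral_Re integrable_mult_left int)
    then show ?thesis by (simp only: integral_mult_left_zero)
  qed
  finally show ?thesis by auto
qed

text \<open>The right-hand side of \<open>pairing_le_norms\<close> for \<open>s = (49/50)^n S\<close>, with \<open>T = 1/R\<close> chosen such that both
  summands decay like \<open>R\<close>.\<close>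

lemma rate_estimate:
  fixes q :: real and n :: nat
  assumes q: "1 \<le> q" "q < 2" and S: "0 < S" and E: "0 < E"
  defines "R \<equiv> ((49 / 50) powr ((2 - q) / 2)) ^ n"
  shows "E / inverse R + inverse R powr (q - 1) * ((49 / 50) ^ n * S) powr (2 - q) \<le> (E + S powr (2 - q)) * R"
proof -
  let ?\<rho> = "49 / 50 :: real"
  have R: "0 < R" "R \<le> 1"
  proof -
    show "0 < R" by (simp add: R_def)
    have "?\<rho> powr ((2 - q) / 2) \<le> 1 powr ((2 - q) / 2)" using q by (intro powr_mono2) auto
    then show "R \<le> 1" unfolding R_def by (intro power_le_one) auto
  qed
  have "(?\<rho> ^ n) powr (2 - q) = R\<^sup>2"
  proof -
    have "R\<^sup>2 = (?\<rho> powr ((2 - q) / 2) * ?\<rho> powr ((2 - q) / 2)) ^ n"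
      by (simp add: R_def power2_eq_square power_mult_distrib)
    also have "\<dots> = (?\<rho> powr (2 - q)) ^ n" by (simp flip: powr_add)
    also have "\<dots> = (?\<rho> ^ n) powr (2 - q)"
      by (simp add: powr_realpow[symmetric] powr_powr mult.commute)
    finally show ?thesis by simp
  qed
  then have "inverse R powr (q - 1) * (?\<rho> ^ n * S) powr (2 - q) = R powr (1 - q) * R powr 2 * S powr (2 - q)"
  proof -
    have "R powr (1 - q) = inverse (R powr (q - 1))" by (simp flip: powr_minus)
    then show ?thesis using \<open>(?\<rho> ^ n) powr (2 - q) = R\<^sup>2\<close> R S by (simp add: powr_mult inverse_powr)
  qed
  also have "R powr (1 - q) * R powr 2 = R powr (3 - q)" by (simp flip: powr_add)
  \<comment> \<open>As \<open>3 - q > 1\<close> and \<open>R \<le> 1\<close>, one full factor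
    \<open>R\<close> is retained.\<close>
  also have "R powr (3 - q) * S powr (2 - q) \<le> R powr 1 * S powr (2 - q)"
    using R q by (intro mult_right_mono powr_mono') auto
  finally have "inverse R powr (q - 1) * (?\<rho> ^ n * S) powr (2 - q) \<le> R * S powr (2 - q)"
    using R by (simp only: powr_one)
  moreover have "E / inverse R = E * R" by (simp only: divide_inverse inverse_inverse_eq)
  moreover have "(E + S powr (2 - q)) * R = E * R + R * S powr (2 - q)"
    by (simp only: distrib_right mult.commute[of R])
  ultimately show ?thesis by linarith
qed

text \<open>The phases are chosen before \<open>u\<close>, and the formula for \<open>u\<close> is
  prescribed only on \<open>ball y r\<close>: the test function lives there, so the whole glued
  function can be inserted later. The Wiener norm of \<open>h\<close> stays at most 1 however large
  \<open>D\<close> is; a large \<open>D\<close> is paid for by a high harmonic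
  \<open>n\<close>.\<close>

lemma norm_lower_bound_piece:
  fixes g :: "'a::euclidean_space \<Rightarrow> complex" and y :: 'a and \<alpha> \<gamma> :: real and p q :: ennreal
  assumes g: "g \<in> schwartz_space" and r: "0 < r" "r \<le> 1" and N: "2 * DIM('a) < N" and y0: "g y0 \<noteq> 0"
    and pt: "\<And>z. norm (z - y0) < 2 * r \<Longrightarrow> (norm (g y0))\<^sup>2 / 2 \<le> Re (cnj (g z) * g y0)"
    and \<alpha>: "\<alpha> \<in> {0<..} - {2 * real n | n. n \<ge> 1}" and p: "1 \<le> p" and q: "1 \<le> q" "q < 2"
    and D: "0 < D" and \<gamma>: "0 < \<gamma>"
  shows "\<exists>h s. continuous_on UNIV h \<and> trig_series 1 (\<lambda>t. complex_of_real (h t)) \<and>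
    (\<forall>u U. u \<in> borel_measurable borel \<longrightarrow> (\<forall>t. norm (u t) \<le> U) \<longrightarrow>
       (\<forall>t\<in>ball y r. u t = complex_of_real (\<gamma> * bump r N (t - y) powr (1 + \<alpha>) * sin_pow \<alpha> (h t + s))) \<longrightarrow>
       ennreal (\<gamma> * D) \<le> modulation_norm g p q (dist_of u) \<and> ennreal (\<gamma> * D) \<le> wiener_amalgam_norm g p q (dist_of u))"
proof -
  have \<alpha>0: "0 < \<alpha>" using \<alpha> by auto
  have N0: "0 < N" using N by simp
  define q' where "q' = enn2real q"
  have q': "1 \<le> q'" "q' < 2"
  proof -
    have "q \<noteq> \<infinity>" using q(2) by auto
    then show "1 \<le> q'" using enn2real_mono[of 1 q] q by (simp add: q'_def less_top)
    show "q' < 2" using q \<open>q \<noteq> \<infinity>\<close> unfolding q'_def by (cases q) (auto simp: ennreal_less_iff)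
  qed
  have gm [measurable]: "g \<in> borel_measurable borel" by (rule schwartz_measurable[OF g])
  obtain Cg where Cg: "\<And>x. norm (g x) \<le> Cg"
    using schwartz_bound[OF g, of "[]" 0] by (auto simp: iterated_partial_def)
  \<comment> \<open>The phase-free part of the pairing, moved to \<open>y\<close>: on the ball,
    \<open>u\<close> times the averaged window times the conjugate test function is
    \<open>\<gamma> * \<Theta>\<close> times an oscillating factor.\<close>
  define \<Theta> where "\<Theta> = (\<lambda>t. pairing_density g y0 r N (1 + \<alpha>) (t - y))"
  have \<Theta>i: "integrable lborel \<Theta>"
    unfolding \<Theta>_def
    using integrable_lborel_translate[OF pairing_density_integrable[OF gm Cg r N0, of "1 + \<alpha>" y0], of "- y"] \<alpha>0
    by simp
  define \<kappa> where "\<kappa> = norm (LBINT t. \<Theta> t)"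
  have \<Theta>0: "(LBINT t. \<Theta> t) \<noteq> 0"
    using integral_lborel_translate[of "pairing_density g y0 r N (1 + \<alpha>)" "- y"]
      pairing_density_integral_nonzero[OF gm Cg r N0 _ y0 pt, of "1 + \<alpha>"] \<alpha>0
    by (simp add: \<Theta>_def)
  then have \<kappa>: "0 < \<kappa>" by (simp add: \<kappa>_def)
  define v where "v = (\<lambda>t. complex_of_real (bump r N (t - y)))"
  have vc: "continuous_on UNIV v"
    unfolding v_def by (intro continuous_intros continuous_on_compose2[OF bump_continuous[of UNIV]]) auto
  have v0: "v t = 0" if "t \<notin> ball y r" for t
    using that r N0 by (simp add: v_def bump_eq_0 dist_norm norm_minus_commute)
  have vsupp: "v t = 0" if "t \<notin> cball 0 (norm y + r)" for t
  proof (rule v0)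
    show "t \<notin> ball y r"
      using that norm_triangle_ineq2[of t y] by (auto simp: dist_norm norm_minus_commute)
  qed
  have vb: "norm (v t) \<le> 1" for t
    using bump_le_1[of r N "t - y"] bump_nonneg[of r N "t - y"] r by (simp add: v_def)
  obtain C where C: "0 \<le> C" "\<And>w. norm (fourier (\<lambda>t::'a. complex_of_real (bump r N t)) w) \<le> C * poly_weight w"
    using fourier_bump_decay[OF r(1) N] by blast
  have Fv: "norm (fourier v w) \<le> C * poly_weight w" for w
    unfolding v_def fourier_translate[of "\<lambda>t. complex_of_real (bump r N t)"] using C(2)[of w] by (simp add: norm_mult)
  define S where "S = C + 1"
  have S: "0 < S" using C by (simp add: S_def)
  have FvS: "norm (fourier v w) \<le> S" for w
  proof -
    have "C * poly_weight w \<le> C * 1" using C poly_weight_le_1 by (intro mult_left_mono) auto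
    then show ?thesis using Fv[of w] by (simp add: S_def)
  qed
  \<comment> \<open>The phase of the test function is unimodular, so its \<open>L^2\<close> norm is
    that of \<open>v\<close> and \<open>E\<close> does not depend on \<open>n\<close>; adding 1
    makes \<open>E\<close> positive.\<close>
  define E where "E = (LBINT t. (norm (v t))\<^sup>2) + 1"
  have E: "0 < E" unfolding E_def by (intro add_nonneg_pos integral_nonneg_AE AE_I2) auto
  define c where "c = measure lborel (ball (y - y0) r) + 1"
  have c: "0 < c" unfolding c_def using measure_nonneg[of lborel "ball (y - y0) r"] by linarith
  define r0 where "r0 = (49 / 50 :: real) powr ((2 - q') / 2)"
  have r0: "0 < r0" "r0 < 1"
  proof -
    show "0 < r0" by (simp add: r0_def)
    have "(49 / 50 :: real) powr ((2 - q') / 2) < 1 powr ((2 - q') / 2)" using q' by (intro powr_less_mono2) auto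
    then show "r0 < 1" by (simp add: r0_def)
  qed
  define F where "F = E + S powr (2 - q')"
  have F: "0 < F" using E by (simp add: F_def add_pos_nonneg)
  \<comment> \<open>The factor \<open>2 * pi\<close> is \<open>4 * pi\<close> from
    \<open>exists_phase\<close> divided by 2 from \<open>sin_pow_coeff_ge\<close>. As
    \<open>c\<close>, \<open>F\<close> and \<open>\<kappa>\<close> do not involve the phase,
    \<open>n\<close> can be chosen after them.\<close>
  obtain n where n: "odd n" "(2 * pi * D * c * F / \<kappa>) * r0 ^ n < \<bar>sine_coeff (1 + \<alpha>) n\<bar>"
    using sine_coeff_subexponential[OF \<alpha> r0] by blast
  have n0: "0 < n" using n(1) by (cases n) auto
  define R where "R = r0 ^ n"
  have R: "0 < R" using r0 by (simp add: R_def)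
  have Gc: "2 * ((2 * pi * D * c * F / \<kappa>) * R) < norm (sin_pow_coeff \<alpha> n)"
    using sin_pow_coeff_ge[OF \<alpha>0 n(1)] n(2) by (simp add: R_def)
  have Gc0: "sin_pow_coeff \<alpha> n \<noteq> 0"
  proof -
    have "0 \<le> 2 * ((2 * pi * D * c * F / \<kappa>) * R)" using D c F \<kappa> R by simp
    then show ?thesis using Gc by auto
  qed
  obtain h0 where h0: "continuous_on UNIV h0" "trig_series (real n) (\<lambda>t. complex_of_real (h0 t))"
    "\<And>w. norm (fourier (\<lambda>t. v t * cis (h0 t)) w) \<le> (49 / 50) ^ n * S"
    using flat_spectrum[OF vc vsupp FvS S] by blast
  \<comment> \<open>The flat phase \<open>h0\<close> has Wiener norm \<open>n\<close>; it is the
    \<open>n\<close>-th harmonic of \<open>h\<close>, whose norm is 1.\<close>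
  define h where "h = (\<lambda>t. h0 t / real n)"
  have hn: "real n * h t = h0 t" for t using n0 by (simp add: h_def)
  have hc: "continuous_on UNIV h" unfolding h_def by (intro continuous_intros h0) (use n0 in auto)
  have hap: "trig_series 1 (\<lambda>t. complex_of_real (h t))"
    using trig_series_cmult[OF h0(2), of "1 / of_nat n"] n0 by (simp add: h_def norm_divide)
  have hm: "h \<in> borel_measurable borel" by (rule borel_measurable_continuous_onI[OF hc])
  obtain s where s: "norm (sin_pow_coeff \<alpha> n) * \<kappa>
      \<le> 4 * pi * norm (LBINT t. \<Theta> t * (complex_of_real (sin_pow \<alpha> (h t + s)) * cis (- (real n * h t))))"
    using exists_phase[OF \<alpha>0 \<Theta>i hm Gc0 \<Theta>0] unfolding \<kappa>_def by blast
  define P where "P = norm (LBINT t. \<Theta> t * (complex_of_real (sin_pow \<alpha> (h t + s)) * cis (- (real n * h t))))"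
  have P: "D * (c * (F * R)) \<le> P"
  proof -
    have "2 * ((2 * pi * D * c * F / \<kappa>) * R) * \<kappa> \<le> norm (sin_pow_coeff \<alpha> n) * \<kappa>"
      using Gc \<kappa> by (intro mult_right_mono) auto
    also have "\<dots> \<le> 4 * pi * P" using s by (simp add: P_def)
    finally have "4 * pi * (D * (c * (F * R))) \<le> 4 * pi * P" using \<kappa> by (simp add: mult_ac)
    then show ?thesis by simp
  qed
  define \<psi> where "\<psi> = (\<lambda>t. v t * cis (h0 t))"
  have \<psi>c: "continuous_on UNIV \<psi>" unfolding \<psi>_def by (intro continuous_intros vc h0)
  have \<psi>i: "integrable lborel \<psi>"
    by (rule integrable_continuous_compact_support[OF \<psi>c, of 0 "norm y + r"]) (use vsupp in \<open>auto simp: \<psi>_def\<close>)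
  have \<psi>b: "norm (\<psi> t) \<le> 1" for t using vb by (simp add: \<psi>_def norm_mult)
  have vi: "integrable lborel v"
    by (rule integrable_continuous_compact_support[OF vc vsupp])
  have F\<psi>m [measurable]: "fourier \<psi> \<in> borel_measurable borel"
    using borel_measurable_integrable[OF \<psi>i] by (intro fourier_measurable) simp
  \<comment> \<open>Plancherel for \<psi> requires an integrable transform. The factor
    \<open>cis (h0 t)\<close> is a trigonometric series of norm at most \<open>exp n\<close>; large
    as it is, this bound is finite for the fixed \<open>n\<close>.\<close>
  have F\<psi>i: "integrable lborel (fourier \<psi>)"
  proof -
    have b: "trig_series (exp (real n)) (\<lambda>t. cis (h0 t))"
      using trig_series_exp[OF trig_series_cmult[OF h0(2), of \<i>]] by (simp add: cis_conv_exp)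
    obtain H' where H': "(\<integral>\<^sup>+w. H' w \<partial>lborel) \<le> ennreal (exp (real n)) * (\<integral>\<^sup>+w. ennreal (C * poly_weight (w::'a)) \<partial>lborel)"
      "\<And>w. ennreal (norm (fourier \<psi> w)) \<le> H' w"
    proof (rule fourier_trig_series_dominated[of "\<lambda>_::unit. v" "exp (real n)" "\<lambda>t. cis (h0 t)" "\<lambda>w. ennreal (C * poly_weight w)" "\<lambda>_. 1"])
      show "ennreal (norm (fourier v w)) \<le> 1 * ennreal (C * poly_weight w)" for w
        using Fv by (simp add: ennreal_leI)
      fix H' :: "'a \<Rightarrow> ennreal"
      assume "(\<integral>\<^sup>+w. H' w \<partial>lborel) \<le> ennreal (exp (real n)) * (\<integral>\<^sup>+w. ennreal (C * poly_weight (w::'a)) \<partial>lborel)"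
        "\<And>x w. ennreal (norm (fourier (\<lambda>t. v t * cis (h0 t)) w)) \<le> 1 * H' w"
      then show thesis by (intro that[of H']) (auto simp: \<psi>_def)
    qed (use vi b in auto)
    have "(\<integral>\<^sup>+w. ennreal (norm (fourier \<psi> w)) \<partial>lborel) \<le> ennreal (exp (real n)) * (\<integral>\<^sup>+w. ennreal (C * poly_weight (w::'a)) \<partial>lborel)"
      by (rule order_trans[OF nn_integral_mono H'(1)]) (rule H'(2))
    also have "\<dots> = ennreal (exp (real n)) * (ennreal C * (\<integral>\<^sup>+w. ennreal (poly_weight (w::'a)) \<partial>lborel))"
      by (subst nn_integral_cmult[symmetric]) (simp_all add: ennreal_mult'[OF C(1)])
    also have "\<dots> < \<infinity>"
      using poly_weight_nn_integral[where 'a='a] by (simp add: ennreal_mult_less_top)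
    finally show ?thesis by (simp add: integrable_iff_bounded)
  qed
  have F\<psi>b: "norm (fourier \<psi> w) \<le> (49 / 50) ^ n * S" for w
    using h0(3)[of w] by (simp add: \<psi>_def)
  have E2: "(\<integral>\<^sup>+w. ennreal ((norm (fourier \<psi> w))\<^sup>2) \<partial>lborel) \<le> ennreal E"
  proof -
    have sq: "complex_of_real ((norm z)\<^sup>2) = z * cnj z" for z
      by (rule complex_norm_square)
    have "(LBINT w. complex_of_real ((norm (fourier \<psi> w))\<^sup>2)) = (LBINT t. complex_of_real ((norm (\<psi> t))\<^sup>2))"
      unfolding sq by (rule fourier_plancherel[OF \<psi>i \<psi>c \<psi>b F\<psi>i \<psi>i])
    then have "complex_of_real (LBINT w. (norm (fourier \<psi> w))\<^sup>2) = complex_of_real (LBINT t. (norm (\<psi> t))\<^sup>2)"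
      by (simp only: integral_complex_of_real)
    then have eq: "(LBINT w. (norm (fourier \<psi> w))\<^sup>2) = (LBINT t. (norm (v t))\<^sup>2)"
      by (simp only: of_real_eq_iff) (simp add: \<psi>_def norm_mult)
    have "integrable lborel (\<lambda>w. norm (fourier \<psi> w) * norm (fourier \<psi> w))"
      by (rule integrable_mult_bounded[of _ _ _ "(49 / 50) ^ n * S"]) (use F\<psi>i F\<psi>b in auto)
    then have i: "integrable lborel (\<lambda>w. (norm (fourier \<psi> w))\<^sup>2)" by (simp add: power2_eq_square)
    have "(\<integral>\<^sup>+w. ennreal ((norm (fourier \<psi> w))\<^sup>2) \<partial>lborel) = ennreal (LBINT t. (norm (v t))\<^sup>2)"
      unfolding eq[symmetric] by (rule nn_integral_eq_integral[OF i]) auto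
    also have "\<dots> \<le> ennreal E" by (rule ennreal_leI) (simp add: E_def)
    finally show ?thesis .
  qed
  show ?thesis
  proof (intro exI[of _ h] exI[of _ s] conjI hc hap allI impI)
    fix u :: "'a \<Rightarrow> complex" and U :: real
    assume um: "u \<in> borel_measurable borel" and "\<forall>t. norm (u t) \<le> U"
      and "\<forall>t\<in>ball y r. u t = complex_of_real (\<gamma> * bump r N (t - y) powr (1 + \<alpha>) * sin_pow \<alpha> (h t + s))"
    then have U: "norm (u t) \<le> U"
      and u: "t \<in> ball y r \<Longrightarrow> u t = complex_of_real (\<gamma> * bump r N (t - y) powr (1 + \<alpha>) * sin_pow \<alpha> (h t + s))" for t
      by blast+
    let ?V = "\<lambda>x w. ennreal (norm (stft g (dist_of u) x w))"
    define X where "X = (\<integral>\<^sup>+x. (\<integral>\<^sup>+w. ?V x w * ennreal (norm (fourier \<psi> w)) \<partial>lborel) * indicator (ball (y - y0) r) x \<partial>lborel)"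
    define d where "d = E / inverse R + inverse R powr (enn2real q - 1) * ((49 / 50) ^ n * S) powr (2 - enn2real q)"
    have d: "0 < d" "d \<le> F * R"
    proof -
      show "0 < d" unfolding d_def using E R by (intro add_pos_nonneg) auto
      show "d \<le> F * R"
        using rate_estimate[OF q' S E, of n] by (simp add: d_def F_def R_def r0_def q'_def)
    qed
    have Vm: "(\<lambda>(x, w). ?V x w) \<in> borel_measurable (borel \<Otimes>\<^sub>M borel)"
      using stft_measurable[OF um gm] by (simp add: case_prod_unfold)
    have XM: "X \<le> ennreal (c * d) * modulation_norm g p q (dist_of u)"
      "X \<le> ennreal (c * d) * wiener_amalgam_norm g p q (dist_of u)"
      unfolding X_def c_def d_def modulation_norm_def wiener_amalgam_norm_def
      using R S E E2 F\<psi>b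
      by (intro pairing_le_norms p q Vm; simp)+
    have "(LBINT t. u t * window_avg g (y - y0) r t * cnj (\<psi> t))
        = (LBINT t. complex_of_real \<gamma> * (\<Theta> t * (complex_of_real (sin_pow \<alpha> (h t + s)) * cis (- (real n * h t)))))"
    proof (rule Bochner_Integration.integral_cong[OF refl])
      fix t
      show "u t * window_avg g (y - y0) r t * cnj (\<psi> t)
        = complex_of_real \<gamma> * (\<Theta> t * (complex_of_real (sin_pow \<alpha> (h t + s)) * cis (- (real n * h t))))"
      proof (cases "t \<in> ball y r")
        case True
        have "window_avg g (y - y0) r t = window_avg g (- y0) r (t - y)"
          using window_avg_shift[of g "- y0" y r t] by simp
        then show ?thesis
          using u[OF True] by (simp add: \<psi>_def v_def \<Theta>_def pairing_density_def hn cis_cnj)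
      next
        case False
        then have "\<psi> t = 0" "bump r N (t - y) = 0" using v0[OF False] by (auto simp: \<psi>_def v_def)
        then show ?thesis by (simp add: \<Theta>_def pairing_density_def)
      qed
    qed
    then have "norm (LBINT t. u t * window_avg g (y - y0) r t * cnj (\<psi> t)) = \<gamma> * P"
      using \<gamma> by (simp only: integral_mult_right_zero norm_mult P_def norm_of_real abs_of_pos)
    then have PX: "ennreal (\<gamma> * P) \<le> X"
      using stft_pairing[OF um U g \<psi>i \<psi>c \<psi>b F\<psi>i, of "y - y0" r]
      by (simp add: X_def window_avg_def)
    have "c * d * (\<gamma> * D) \<le> \<gamma> * P"
    proof -
      have "c * d * (\<gamma> * D) \<le> c * (F * R) * (\<gamma> * D)"
        using c d \<gamma> D by (intro mult_right_mono mult_left_mono) auto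
      also have "\<dots> = \<gamma> * (D * (c * (F * R)))" by (simp add: mult_ac)
      also have "\<dots> \<le> \<gamma> * P" using P \<gamma> by (intro mult_left_mono) auto
      finally show ?thesis .
    qed
    then have "ennreal (c * d) * ennreal (\<gamma> * D) \<le> ennreal (\<gamma> * P)"
      using c d \<gamma> D by (simp flip: ennreal_mult add: ennreal_leI)
    then have cX: "ennreal (c * d) * ennreal (\<gamma> * D) \<le> X" using PX by (rule order_trans)
    have cd: "0 < c * d" using c d by simp
    then have "ennreal (c * d) \<noteq> 0" "ennreal (c * d) \<noteq> \<top>" by auto
    then have cancel: "ennreal (\<gamma> * D) \<le> b" if "ennreal (c * d) * ennreal (\<gamma> * D) \<le> ennreal (c * d) * b" for b
      using that by (subst (asm) ennreal_mult_le_mult_iff) auto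
    show "ennreal (\<gamma> * D) \<le> modulation_norm g p q (dist_of u)" "ennreal (\<gamma> * D) \<le> wiener_amalgam_norm g p q (dist_of u)"
      by (intro cancel order_trans[OF cX] XM)+
  qed
qed

subsection \<open>Gluing the pieces\<close>

text \<open>By Euler's formula, each exponential contributes \<open>exp K / 2\<close>. For
  \<open>K = 1\<close> every piece thus costs the same factor \<open>exp 1\<close>, whatever its
  phase.\<close>

lemma trig_series_sin:
  assumes "trig_series K (\<lambda>t. complex_of_real (h t))"
  shows "trig_series (exp K) (\<lambda>t. complex_of_real (sin (h t + s)))"
proof -
  have "trig_series (norm (- \<i> / 2 * cis s) * exp (norm \<i> * K) + norm (\<i> / 2 * cis (- s)) * exp (norm (- \<i>) * K))
    (\<lambda>t. (- \<i> / 2 * cis s) * exp (\<i> * complex_of_real (h t)) + (\<i> / 2 * cis (- s)) * exp (- \<i> * complex_of_real (h t)))"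
    by (intro trig_series_add trig_series_cmult trig_series_exp assms)
  moreover have "(- \<i> / 2 * cis s) * exp (\<i> * complex_of_real (h t)) + (\<i> / 2 * cis (- s)) * exp (- \<i> * complex_of_real (h t))
     = complex_of_real (sin (h t + s))" for t
  proof -
    have "exp (- \<i> * complex_of_real (h t)) = cis (- h t)" by (simp add: cis_conv_exp)
    moreover have "exp (\<i> * complex_of_real (h t)) = cis (h t)" by (simp add: cis_conv_exp)
    ultimately have eq: "(- \<i> / 2 * cis s) * exp (\<i> * complex_of_real (h t)) + (\<i> / 2 * cis (- s)) * exp (- \<i> * complex_of_real (h t))
      = - \<i> / 2 * cis (h t + s) + \<i> / 2 * cis (- (h t + s))"
      by (simp add: cis_mult mult.assoc add.commute)
    have "- \<i> / 2 * cis x + \<i> / 2 * cis (- x) = complex_of_real (sin x)" for x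
      by (simp add: complex_eq_iff)
    then show ?thesis unfolding eq .
  qed
  ultimately show ?thesis by (simp add: norm_mult norm_divide)
qed

text \<open>The transform is taken term by term in the series of pieces; the common factor
  \<open>k\<close> of the majorants will be the modulus of the window.\<close>

lemma fourier_suminf:
  fixes F :: "nat \<Rightarrow> 'a::euclidean_space \<Rightarrow> complex"
  assumes F: "\<And>j. integrable lborel (F j)" "\<And>j t. norm (F j t) \<le> M j * k t"
    and M: "summable M" and k: "integrable lborel k"
  shows "(\<lambda>j. fourier (F j) w) sums fourier (\<lambda>t. \<Sum>j. F j t) w"
    and "summable (\<lambda>j. norm (fourier (F j) w))"
proof -
  let ?F = "\<lambda>j t. F j t * cis (- (2 * pi * (w \<bullet> t)))"
  have le: "(LBINT t. norm (F j t)) \<le> M j * (LBINT t. k t)" for j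
  proof -
    have "(LBINT t. norm (F j t)) \<le> (LBINT t. M j * k t)"
      by (rule Bochner_Integration.integral_mono) (use F k in auto)
    then show ?thesis by simp
  qed
  have "(\<lambda>j. LBINT t. ?F j t) sums (LBINT t. (\<Sum>j. ?F j t))"
  proof (rule sums_integral)
    show "integrable lborel (?F j)" for j by (rule integrable_fourier_kernel[OF F(1)])
    show "AE t in lborel. summable (\<lambda>j. norm (?F j t))"
      using F(2) by (intro AE_I2 summable_comparison_test'[OF summable_mult2[OF M]]) (auto simp: norm_mult)
    show "summable (\<lambda>j. LBINT t. norm (?F j t))"
      by (rule summable_comparison_test'[OF summable_mult2[OF M, of "LBINT t. k t"]])
         (use le in \<open>simp add: norm_mult\<close>)
  qed
  moreover have "(\<Sum>j. ?F j t) = (\<Sum>j. F j t) * cis (- (2 * pi * (w \<bullet> t)))" for t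
  proof -
    have "summable (\<lambda>j. norm (F j t))"
      by (rule summable_comparison_test'[OF summable_mult2[OF M, of "k t"]]) (use F(2) in simp)
    then show ?thesis by (rule suminf_mult2[OF summable_norm_cancel, symmetric])
  qed
  ultimately show "(\<lambda>j. fourier (F j) w) sums fourier (\<lambda>t. \<Sum>j. F j t) w"
    by (simp add: fourier_def)
  show "summable (\<lambda>j. norm (fourier (F j) w))"
    by (rule summable_comparison_test'[OF summable_mult2[OF M, of "LBINT t. k t"]])
       (use order_trans[OF norm_fourier_le le] in simp)
qed

lemma ennreal_eq_top_if_unbounded:
  assumes "\<And>j::nat. ennreal (real j + 1) \<le> x"
  shows "x = \<top>"
proof (cases x)
  case (real a)
  obtain j :: nat where "a < real j" using reals_Archimedean2 by blast
  then show ?thesis using assms[of j] real by (simp add: ennreal_le_iff del: ennreal_plus)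
qed

text \<open>Up to a unimodular factor, moving the bump to \<open>y\<close> amounts to moving the
  window to \<open>x - y\<close>. The return to \<open>weight x\<close> costs the factor from
  \<open>weight_shift\<close>, which the amplitudes have to absorb.\<close>

lemma shifted_bump_domination:
  fixes g :: "'a::euclidean_space \<Rightarrow> complex"
  assumes C: "0 \<le> C" "\<And>x w. norm (fourier (\<lambda>t. bump r N t * cnj (g (t - x))) w) \<le> C * weight x * poly_weight w"
  shows "norm (fourier (\<lambda>t. bump r N (t - y) * cnj (g (t - x))) w)
    \<le> weight x * ((C * (1 + norm y) ^ (2 * DIM('a))) * poly_weight w)"
proof -
  have "(\<lambda>t. complex_of_real (bump r N (t - y)) * cnj (g (t - x)))
      = (\<lambda>t. (\<lambda>t. complex_of_real (bump r N t) * cnj (g (t - (x - y)))) (t - y))"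
    by (simp add: algebra_simps)
  then have "norm (fourier (\<lambda>t. bump r N (t - y) * cnj (g (t - x))) w)
      = norm (fourier (\<lambda>t. bump r N t * cnj (g (t - (x - y)))) w)"
    using fourier_translate[of "\<lambda>t. complex_of_real (bump r N t) * cnj (g (t - (x - y)))" y w]
    by (simp add: norm_mult)
  also have "\<dots> \<le> C * weight (x - y) * poly_weight w" by (rule C)
  also have "\<dots> \<le> C * ((1 + norm y) ^ (2 * DIM('a)) * weight x) * poly_weight w"
    using C(1) poly_weight_pos[of w] by (intro mult_right_mono mult_left_mono weight_shift) auto
  finally show ?thesis by (simp add: mult_ac)
qed

lemma power_nonlinearity_real:
  assumes "0 < a"
  shows "complex_of_real (a * sin \<theta>) * complex_of_real (cmod (complex_of_real (a * sin \<theta>)) powr \<alpha>)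
    = complex_of_real (a powr (1 + \<alpha>) * sin_pow \<alpha> \<theta>)"
proof -
  have "cmod (complex_of_real (a * sin \<theta>)) = a * \<bar>sin \<theta>\<bar>" using assms by (simp only: norm_of_real abs_mult abs_of_pos)
  moreover have "a powr (1 + \<alpha>) = a * a powr \<alpha>" using assms by (simp add: powr_add)
  ultimately show ?thesis using assms unfolding sin_pow_def by (simp add: powr_mult mult_ac)
qed

lemma counterexample:
  fixes g :: "'a::euclidean_space \<Rightarrow> complex" and p q :: ennreal and \<alpha> :: real
  assumes g: "g \<in> schwartz_space" "g \<noteq> (\<lambda>x. 0)" and p: "1 \<le> p" and q: "1 \<le> q" "q < 2"
    and \<alpha>: "\<alpha> \<in> {0<..} - {2 * real n | n. n \<ge> 1}"
  obtains f :: "'a \<Rightarrow> complex" where "continuous_on UNIV f" "tempered_function f"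
    "dist_of f \<in> wiener_amalgam_space g p 1" "dist_of f \<in> modulation_space g p 1"
    "tempered_function (power_nonlinearity \<alpha> f)"
    "dist_of (power_nonlinearity \<alpha> f) \<notin> wiener_amalgam_space g p q"
    "dist_of (power_nonlinearity \<alpha> f) \<notin> modulation_space g p q"
proof -
  have \<alpha>0: "0 < \<alpha>" using \<alpha> by auto
  have gm: "g \<in> borel_measurable borel" by (rule schwartz_measurable[OF g(1)])
  have gc: "continuous_on UNIV g"
    using schwartz_continuous[OF g(1), of "[]"] by (simp add: iterated_partial_def)
  obtain y0 r where r: "0 < r" "r \<le> 1" and y0: "g y0 \<noteq> 0"
    and pt: "\<And>z. norm (z - y0) < 2 * r \<Longrightarrow> (norm (g y0))\<^sup>2 / 2 \<le> Re (cnj (g z) * g y0)"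
    using window_point[OF gc g(2)] by blast
  define N where "N = 2 * DIM('a) + 1"
  have N: "2 * DIM('a) < N" "0 < N" by (simp_all add: N_def)
  obtain e :: 'a where e: "e \<in> Basis" using nonempty_Basis by blast
  \<comment> \<open>Centres at mutual distance at least 2 make the balls of radius
    \<open>r \<le> 1\<close> disjoint.\<close>
  define y where "y = (\<lambda>j::nat. (2 * real j) *\<^sub>R e)"
  \<comment> \<open>The inverse power compensates the loss from moving the bump to
    \<open>y j\<close>; the geometric factor makes the pieces summable.\<close>
  define c where "c = (\<lambda>j. (1 / 2) ^ j * inverse ((1 + norm (y j)) ^ (2 * DIM('a))))"
  have yp: "0 < (1 + norm (y j)) ^ (2 * DIM('a))" "1 \<le> (1 + norm (y j)) ^ (2 * DIM('a))" for j
    by (auto intro!: zero_less_power one_le_power simp: add_pos_nonneg)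
  have c: "0 < c j" "c j \<le> (1 / 2) ^ j" "c j * (1 + norm (y j)) ^ (2 * DIM('a)) = (1 / 2) ^ j" for j
  proof -
    show "0 < c j" unfolding c_def using yp(1)[of j] by (intro mult_pos_pos positive_imp_inverse_positive) auto
    have "inverse ((1 + norm (y j)) ^ (2 * DIM('a))) \<le> 1"
      using yp(2)[of j] by (intro inverse_le_1_iff[THEN iffD2]) auto
    then show "c j \<le> (1 / 2) ^ j" unfolding c_def by (rule mult_left_le) auto
    show "c j * (1 + norm (y j)) ^ (2 * DIM('a)) = (1 / 2) ^ j"
      unfolding c_def mult.assoc left_inverse[OF less_imp_neq[OF yp(1), symmetric]] by simp
  qed
  have c1: "c j \<le> 1" for j
    using c(2)[of j] power_le_one[of "1/2::real" j] by linarith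
  have disj: "i = j" if "t \<in> ball (y i) r" "t \<in> ball (y j) r" for t i j
  proof (rule ccontr)
    assume "i \<noteq> j"
    then have "1 \<le> \<bar>real i - real j\<bar>" by linarith
    then have "2 \<le> norm ((2 * real i - 2 * real j) *\<^sub>R e)" using e by simp
    also have "\<dots> = dist (y i) (y j)" by (simp add: y_def dist_norm scaleR_left_diff_distrib)
    also have "\<dots> \<le> dist (y i) t + dist (y j) t" by (rule dist_triangle2)
    finally show False using that r by simp
  qed
  define \<gamma> where "\<gamma> = (\<lambda>j. c j powr (1 + \<alpha>))"
  have \<gamma>: "0 < \<gamma> j" for j using c(1)[of j] by (simp add: \<gamma>_def)
  define Q where "Q = (\<lambda>j h s. continuous_on UNIV h \<and> trig_series 1 (\<lambda>t. complex_of_real (h t)) \<and>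
    (\<forall>u U. u \<in> borel_measurable borel \<longrightarrow> (\<forall>t. norm (u t) \<le> U) \<longrightarrow>
       (\<forall>t\<in>ball (y j) r. u t = complex_of_real (\<gamma> j * bump r N (t - y j) powr (1 + \<alpha>) * sin_pow \<alpha> (h t + s))) \<longrightarrow>
       ennreal (real j + 1) \<le> modulation_norm g p q (dist_of u) \<and> ennreal (real j + 1) \<le> wiener_amalgam_norm g p q (dist_of u)))"
  have "\<exists>h s. Q j h s" for j
  proof -
    \<comment> \<open>Since \<open>\<gamma> j\<close> is the amplitude left by the nonlinearity,
      this choice of \<open>D\<close> makes the \<open>j\<close>-th lower bound equal to
      \<open>j + 1\<close>.\<close>
    have D: "0 < (real j + 1) / \<gamma> j" "\<gamma> j * ((real j + 1) / \<gamma> j) = real j + 1"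
      using \<gamma>[of j] by auto
    show ?thesis
      using norm_lower_bound_piece[OF g(1) r N(1) y0 pt \<alpha> p q D(1) \<gamma>[of j], of "y j"] unfolding Q_def D(2) .
  qed
  then obtain h s where Qhs: "\<And>j. Q j (h j) (s j)" by metis
  have hc: "continuous_on UNIV (h j)" and hap: "trig_series 1 (\<lambda>t. complex_of_real (h j t))" for j
    using Qhs[of j] by (auto simp: Q_def)
  define T where "T = (\<lambda>j t. c j * bump r N (t - y j) * sin (h j t + s j))"
  define f where "f = (\<lambda>t. complex_of_real (\<Sum>j. T j t))"
  have T0: "T j t = 0" if "t \<notin> ball (y j) r" for j t
    using that r N by (simp add: T_def bump_eq_0 dist_norm norm_minus_commute)
  have Tb: "\<bar>T j t\<bar> \<le> (1 / 2) ^ j" for j t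
  proof -
    have "\<bar>T j t\<bar> \<le> c j * 1 * 1"
      unfolding T_def abs_mult using c(1)[of j] r
      by (intro mult_mono) (auto simp: bump_nonneg bump_le_1)
    with c(2)[of j] show ?thesis by simp
  qed
  have half: "summable (\<lambda>j. (1 / 2 :: real) ^ j)" by (rule summable_geometric) simp
  have single: "(\<Sum>j. T j t) = T j t" if "t \<in> ball (y j) r" for j t
  proof -
    have "T i t = 0" if "i \<noteq> j" for i
      using T0[of t i] disj[OF \<open>t \<in> ball (y j) r\<close>, of i] that by blast
    then show ?thesis using suminf_finite[of "{j}" "\<lambda>j. T j t"] by simp
  qed
  have fb: "norm (f t) \<le> 1" for t
  proof (cases "\<exists>j. t \<in> ball (y j) r")
    case True
    then obtain j where j: "t \<in> ball (y j) r" by blast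
    have "\<bar>T j t\<bar> \<le> 1" using Tb[of j t] power_le_one[of "1/2::real" j] by linarith
    then show ?thesis using single[OF j] by (simp add: f_def)
  next
    case False
    then show ?thesis using T0 by (simp add: f_def)
  qed
  have Tc: "continuous_on UNIV (T j)" for j
    unfolding T_def by (intro continuous_intros hc continuous_on_compose2[OF bump_continuous[of UNIV]]) auto
  have fc: "continuous_on UNIV f"
  proof -
    have "uniform_limit UNIV (\<lambda>n t. \<Sum>j<n. T j t) (\<lambda>t. \<Sum>j. T j t) sequentially"
      by (rule Weierstrass_m_test[OF _ half]) (use Tb in simp)
    then have "continuous_on UNIV (\<lambda>t. \<Sum>j. T j t)"
      by (rule uniform_limit_theorem[rotated])
         (auto intro!: always_eventually continuous_on_sum Tc)
    then show ?thesis unfolding f_def by (intro continuous_intros)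
  qed
  have fm [measurable]: "f \<in> borel_measurable borel" by (rule borel_measurable_continuous_onI[OF fc])
  have ft: "tempered_function f" by (rule tempered_function_bounded[OF fm fb])
  obtain C where C: "0 \<le> C"
    "\<And>x w. norm (fourier (\<lambda>t. bump r N t * cnj (g (t - x))) w) \<le> C * weight x * poly_weight w"
    using stft_bump_decay[OF g(1) r(1) N(1)] by blast
  define W where "W = (\<integral>\<^sup>+w. ennreal (poly_weight (w::'a)) \<partial>lborel)"
  have W: "W < \<infinity>" unfolding W_def by (rule poly_weight_nn_integral)
  have gi: "integrable lborel (\<lambda>t. cnj (g (t - x)))" for x
    using integrable_lborel_translate[OF schwartz_integrable[OF g(1)], of "- x"] by simp
  have "\<exists>H. H \<in> borel_measurable borel \<and> (\<integral>\<^sup>+w. H w \<partial>lborel) \<le> ennreal ((1 / 2) ^ j) * (ennreal (exp 1 * C) * W) \<and>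
     (\<forall>x w. ennreal (norm (fourier (\<lambda>t. complex_of_real (T j t) * cnj (g (t - x))) w)) \<le> ennreal (weight x) * H w)" for j
  proof -
    let ?C = "C * (1 + norm (y j)) ^ (2 * DIM('a))"
    let ?v = "\<lambda>x t. complex_of_real (bump r N (t - y j)) * cnj (g (t - x))"
    let ?b = "\<lambda>t. complex_of_real (c j) * complex_of_real (sin (h j t + s j))"
    have C0: "0 \<le> ?C" using C yp(1)[of j] by simp
    have b: "trig_series (norm (complex_of_real (c j)) * exp 1) ?b"
      by (intro trig_series_cmult trig_series_sin hap)
    show ?thesis
    proof (rule fourier_trig_series_dominated[of ?v _ ?b "\<lambda>w. ennreal (?C * poly_weight w)" "\<lambda>x. ennreal (weight x)"])
      show "integrable lborel (?v x)" for x
      proof -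
        have "integrable lborel (\<lambda>t. cnj (g (t - x)) * complex_of_real (bump r N (t - y j)))"
          by (rule integrable_mult_bounded[OF gi, where K=1])
             (use r in \<open>auto simp: bump_nonneg bump_le_1 intro!: borel_measurable_continuous_onI continuous_intros continuous_on_compose2[OF bump_continuous[of UNIV]]\<close>)
        then show ?thesis by (simp add: mult.commute)
      qed
      show "ennreal (norm (fourier (?v x) w)) \<le> ennreal (weight x) * ennreal (?C * poly_weight w)" for x w
      proof -
        have "ennreal (norm (fourier (?v x) w)) \<le> ennreal (weight x * (?C * poly_weight w))"
          by (rule ennreal_leI[OF shifted_bump_domination[OF C]])
        also have "\<dots> = ennreal (weight x) * ennreal (?C * poly_weight w)"
          by (rule ennreal_mult'[OF less_imp_le[OF weight_pos]])
        finally show ?thesis .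
      qed
      fix H
      assume H: "H \<in> borel_measurable borel"
        "(\<integral>\<^sup>+w. H w \<partial>lborel) \<le> ennreal (norm (complex_of_real (c j)) * exp 1) * (\<integral>\<^sup>+w. ennreal (?C * poly_weight (w::'a)) \<partial>lborel)"
        "\<And>x w. ennreal (norm (fourier (\<lambda>t. ?v x t * ?b t) w)) \<le> ennreal (weight x) * H w"
      have "(\<integral>\<^sup>+w. ennreal (?C * poly_weight (w::'a)) \<partial>lborel) = ennreal ?C * W"
        unfolding W_def by (subst nn_integral_cmult[symmetric]) (simp_all add: ennreal_mult'[OF C0])
      then have "(\<integral>\<^sup>+w. H w \<partial>lborel) \<le> ennreal (norm (complex_of_real (c j)) * exp 1) * (ennreal ?C * W)"
        using H(2) by simp
      also have "\<dots> = ennreal (norm (complex_of_real (c j)) * exp 1 * ?C) * W"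
      proof -
        have "ennreal (norm (complex_of_real (c j)) * exp 1 * ?C) = ennreal (norm (complex_of_real (c j)) * exp 1) * ennreal ?C"
          using C0 by (intro ennreal_mult) auto
        then show ?thesis by (simp only: mult.assoc)
      qed
      \<comment> \<open>Here \<open>c j\<close> cancels the cost of the translation, and only the
        geometric factor remains.\<close>
      also have "norm (complex_of_real (c j)) * exp 1 * ?C = (1 / 2) ^ j * (exp 1 * C)"
        unfolding c(3)[symmetric] using c(1)[of j] by simp
      also have "ennreal ((1 / 2) ^ j * (exp 1 * C)) * W = ennreal ((1 / 2) ^ j) * (ennreal (exp 1 * C) * W)"
        using C(1) by (simp add: ennreal_mult mult.assoc)
      finally have H2: "(\<integral>\<^sup>+w. H w \<partial>lborel) \<le> ennreal ((1 / 2) ^ j) * (ennreal (exp 1 * C) * W)" .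
      have "(\<lambda>t. complex_of_real (T j t) * cnj (g (t - x))) = (\<lambda>t. ?v x t * ?b t)" for x
        by (simp add: T_def fun_eq_iff mult_ac)
      then have "\<forall>x w. ennreal (norm (fourier (\<lambda>t. complex_of_real (T j t) * cnj (g (t - x))) w)) \<le> ennreal (weight x) * H w"
        using H(3) by (simp only:) blast
      with H(1) H2 show ?thesis by blast
    qed (use b in auto)
  qed
  then have "\<exists>H. \<forall>j. H j \<in> borel_measurable borel \<and> (\<integral>\<^sup>+w. H j w \<partial>lborel) \<le> ennreal ((1 / 2) ^ j) * (ennreal (exp 1 * C) * W) \<and>
     (\<forall>x w. ennreal (norm (fourier (\<lambda>t. complex_of_real (T j t) * cnj (g (t - x))) w)) \<le> ennreal (weight x) * H j w)"
    by (intro choice allI)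
  then obtain H where H: "\<And>j. H j \<in> borel_measurable borel"
    "\<And>j. (\<integral>\<^sup>+w. H j w \<partial>lborel) \<le> ennreal ((1 / 2) ^ j) * (ennreal (exp 1 * C) * W)"
    "\<And>j x w. ennreal (norm (fourier (\<lambda>t. complex_of_real (T j t) * cnj (g (t - x))) w)) \<le> ennreal (weight x) * H j w"
    by blast
  note H(1)[measurable]
  have Hm: "(\<lambda>w. \<Sum>j. H j w) \<in> borel_measurable borel" by measurable
  have Hi: "(\<integral>\<^sup>+w. (\<Sum>j. H j w) \<partial>lborel) < \<infinity>"
  proof -
    have "(\<integral>\<^sup>+w. (\<Sum>j. H j w) \<partial>lborel) = (\<Sum>j. \<integral>\<^sup>+w. H j w \<partial>lborel)"
      by (rule nn_integral_suminf) measurable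
    also have "\<dots> \<le> (\<Sum>j. ennreal ((1 / 2) ^ j) * (ennreal (exp 1 * C) * W))"
      by (intro suminf_le H(2)) auto
    also have "\<dots> = (\<Sum>j. ennreal ((1 / 2) ^ j)) * (ennreal (exp 1 * C) * W)"
      by (rule ennreal_suminf_multc)
    also have "(\<Sum>j. ennreal ((1 / 2) ^ j)) = ennreal (\<Sum>j. (1 / 2) ^ j)"
      by (rule suminf_ennreal2[OF _ half]) simp
    also have "ennreal (\<Sum>j. (1 / 2) ^ j) * (ennreal (exp 1 * C) * W) < \<infinity>"
      using W by (simp only: ennreal_mult_less_top ennreal_less_top infinity_ennreal_def) blast
    finally show ?thesis .
  qed
  have dom: "ennreal (norm (stft g (dist_of f) x w)) \<le> ennreal (weight x) * (\<Sum>j. H j w)" for x w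
  proof -
    let ?F = "\<lambda>j t. complex_of_real (T j t) * cnj (g (t - x))"
    have Fi: "integrable lborel (?F j)" for j
    proof -
      have "integrable lborel (\<lambda>t. cnj (g (t - x)) * complex_of_real (T j t))"
        by (rule integrable_mult_bounded[OF gi, where K="(1/2)^j"])
           (use Tb in \<open>auto intro!: borel_measurable_continuous_onI continuous_intros Tc\<close>)
      then show ?thesis by (simp add: mult.commute)
    qed
    have Fb: "norm (?F j t) \<le> (1 / 2) ^ j * norm (cnj (g (t - x)))" for j t
      unfolding norm_mult using Tb[of j t] by (intro mult_right_mono) auto
    note S = fourier_suminf[of ?F "\<lambda>j. (1 / 2) ^ j" "\<lambda>t. norm (cnj (g (t - x)))" w, OF Fi Fb half integrable_norm[OF gi]]
    have "(\<Sum>j. ?F j t) = f t * cnj (g (t - x))" for t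
    proof -
      have "summable (\<lambda>j. norm (T j t))"
        by (rule summable_comparison_test'[OF half]) (use Tb in simp)
      then have s: "summable (\<lambda>j. T j t)" by (rule summable_norm_cancel)
      have "(\<lambda>j. complex_of_real (T j t)) sums f t"
        unfolding f_def by (intro sums_of_real summable_sums s)
      then have "(\<lambda>j. ?F j t) sums (f t * cnj (g (t - x)))" by (rule sums_mult2)
      then show ?thesis by (rule sums_unique[symmetric])
    qed
    then have "(\<lambda>j. fourier (?F j) w) sums stft g (dist_of f) x w"
      using S(1) unfolding stft_dist_of by simp
    then have "norm (stft g (dist_of f) x w) \<le> (\<Sum>j. norm (fourier (?F j) w))"
      using summable_norm[OF S(2)] by (simp add: sums_iff)
    then have "ennreal (norm (stft g (dist_of f) x w)) \<le> ennreal (\<Sum>j. norm (fourier (?F j) w))"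
      by (rule ennreal_leI)
    also have "\<dots> = (\<Sum>j. ennreal (norm (fourier (?F j) w)))"
      by (rule suminf_ennreal2[OF _ S(2), symmetric]) simp
    also have "\<dots> \<le> (\<Sum>j. ennreal (weight x) * H j w)"
      by (intro suminf_le H(3)) auto
    also have "\<dots> = ennreal (weight x) * (\<Sum>j. H j w)" by (rule ennreal_suminf_cmult)
    finally show ?thesis .
  qed
  define u where "u = power_nonlinearity \<alpha> f"
  have um: "u \<in> borel_measurable borel"
    unfolding u_def power_nonlinearity_def by measurable
  have ub: "norm (u t) \<le> 1" for t
  proof -
    have "cmod (f t) powr \<alpha> \<le> 1 powr \<alpha>" using fb[of t] \<alpha>0 by (intro powr_mono2) auto
    then have "norm (f t) * norm (cmod (f t) powr \<alpha>) \<le> 1 * 1"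
      using fb[of t] by (intro mult_mono) auto
    then show ?thesis by (simp add: u_def power_nonlinearity_def norm_mult)
  qed
  have ut: "tempered_function u" by (rule tempered_function_bounded[OF um ub])
  have uj: "u t = complex_of_real (\<gamma> j * bump r N (t - y j) powr (1 + \<alpha>) * sin_pow \<alpha> (h j t + s j))" if t: "t \<in> ball (y j) r" for j t
  proof -
    have "norm (t - y j) < r" using t by (simp add: dist_norm norm_minus_commute)
    then have a: "0 < c j * bump r N (t - y j)" by (intro mult_pos_pos c(1) bump_pos)
    have "f t = complex_of_real (c j * bump r N (t - y j) * sin (h j t + s j))"
      using single[OF t] by (simp only: f_def T_def)
    then have "u t = complex_of_real ((c j * bump r N (t - y j)) powr (1 + \<alpha>) * sin_pow \<alpha> (h j t + s j))"
      unfolding u_def power_nonlinearity_def by (simp only: power_nonlinearity_real[OF a])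
    then show ?thesis
      using c(1)[of j] bump_nonneg[of r N "t - y j"] by (simp add: powr_mult \<gamma>_def)
  qed
  \<comment> \<open>On the \<open>j\<close>-th ball all other pieces vanish, so the single function
    \<open>u\<close> meets the requirement of every \<open>j\<close>; both norms then exceed every
    integer.\<close>
  have big: "ennreal (real j + 1) \<le> modulation_norm g p q (dist_of u) \<and> ennreal (real j + 1) \<le> wiener_amalgam_norm g p q (dist_of u)" for j
    using Qhs[of j, unfolded Q_def] um ub uj by blast
  have "modulation_norm g p q (dist_of u) = \<top>" "wiener_amalgam_norm g p q (dist_of u) = \<top>"
    using big by (auto intro!: ennreal_eq_top_if_unbounded)
  then have "dist_of u \<notin> wiener_amalgam_space g p q" "dist_of u \<notin> modulation_space g p q"
    by (auto simp: wiener_amalgam_space_def modulation_space_def)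
  then show ?thesis
    using that[OF fc ft dist_of_in_spaces[OF ft fm gm p Hm Hi dom]] ut by (simp add: u_def)
qed

theorem corollary1p3:
  fixes g :: "real ^ 'n \<Rightarrow> complex" and p q :: ennreal and \<alpha> :: real
  assumes "g \<in> schwartz_space" and "g \<noteq> (\<lambda>x. 0)"
    and "1 \<le> p" and "1 \<le> q" and "q < 2"
    and "\<alpha> \<in> {0<..} - {2 * real n | n. n \<ge> 1}"
  shows "(\<exists>f :: real ^ 'n \<Rightarrow> complex. continuous_on UNIV f \<and> tempered_function f \<and>
            dist_of f \<in> wiener_amalgam_space g p 1 \<and>
            tempered_function (power_nonlinearity \<alpha> f) \<and>
            dist_of (power_nonlinearity \<alpha> f) \<notin> wiener_amalgam_space g p q) \<and>
         (\<exists>f :: real ^ 'n \<Rightarrow> complex. continuous_on UNIV f \<and> tempered_function f \<and>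
            dist_of f \<in> modulation_space g p 1 \<and>
            tempered_function (power_nonlinearity \<alpha> f) \<and>
            dist_of (power_nonlinearity \<alpha> f) \<notin> modulation_space g p q)"
  using counterexample[OF assms] by metis

end
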